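(* Let $(X_n)_{n\in\mathbb{N}_0}$ and $\Phi=(\phi_n)_{n\in\mathbb{N}_0}$ be as in the standing setting. Then $J(\Phi)$ is subprojective if and only if each $X_n$ is subprojective.
   Context: Standing setting. Let $\mathbb{N}_0=\mathbb{N}\cup\{0\}$ and let $\wp$ be the set of all non-empty finite subsets of $\mathbb{N}_0$. Let $(X_n,\|\cdot\|_n)_{n\in\mathbb{N}_0}$ be a sequence of Banach spaces with $\dim X_0=0$, and let $\Phi=(\phi_n)_{n\in\mathbb{N}_0}$ be a sequence of operators (bounded linear maps) $\phi_n\colon X_n\to X_{n+1}$ with $\|\phi_n\|\le 1$. For $n\le m$ put $\phi_n^m=\phi_{m-1}\circ\cdots\circ\phi_n\colon X_n\to X_m$, with $\phi_n^n=I_{X_n}$. Let $\Pi=\prod_{n\in\mathbb{N}_0}X_n$. For $x=(x_n)_{n\in\mathbb{N}_0}\in\Pi$ and $S=\{p_0<\cdots<p_k\}\in\wp$ define $$\rho(x,S)=\Bigl(\sum_{i=1}^k\bigl\|\phi_{p_{i-1}}^{p_i}(x_{p_{i-1}})-x_{p_i}\bigr\|_{p_i}^2+\|x_{p_k}\|_{p_k}^2\Bigr)^{1/2},$$ and $\|x\|_J=\frac{1}{\sqrt2}\sup_{S\in\wp}\rho(x,S)$. Let $\hat J(\Phi)=\{x\in\Pi:\|x\|_J<\infty\}$, a Banach space with norm $\|\cdot\|_J$, and let $J(\Phi)=\{(x_n)_{n\in\mathbb{N}_0}\in\hat J(\Phi):\lim_n\|x_n\|_n=0\}$, a closed subspace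 of $\hat J(\Phi)$ (equivalently, the closure of the finitely non-zero sequences of $\Pi$ in $\|\cdot\|_J$). A Banach space $X$ is subprojective if every closed infinite-dimensional subspace of $X$ contains an infinite-dimensional subspace complemented in $X$ (i.e. the range of a bounded linear projection on $X$); finite-dimensional spaces are trivially subprojective. *)

theory Defs
  imports "HOL-Analysis.Analysis" "HOL-Library.Function_Algebras"
begin

section \<open>Banach spaces on carrier sets\<close>

text \<open>
  A family of Banach spaces cannot be indexed over types, so a space is given by a scalar
  multiplication \<open>smul\<close> on an ambient abelian group, a linear subspace \<open>V\<close> as carrier and
  a norm \<open>nrm\<close> that matters on \<open>V\<close> only.  The ambient space carries no norm or topology.
  Any family of Banach spaces over the same field embeds linearly in one ambient vector space
  (e.g. the direct product), each member keeping its own norm, so this loses no generality.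

  Every field in class \<open>real_normed_field\<close> that is complete is isometrically isomorphic to the reals
  or to the complex numbers, so a scalar type of sort \<open>{real_normed_field, banach}\<close> covers exactly
  the real and the complex Banach spaces.

  The distance is cut off outside \<open>V\<close>, because the locale \<open>Metric_space\<close> demands
  nonnegativity and symmetry of the distance on the whole type.
\<close>

definition ndist :: "'v::ab_group_add set \<Rightarrow> ('v \<Rightarrow> real) \<Rightarrow> 'v \<Rightarrow> 'v \<Rightarrow> real" where
  "ndist V nrm x y = (if x \<in> V \<and> y \<in> V then nrm (x - y) else 0)"

locale banach_space_on = vector_space smul
  for smul :: "'k::{real_normed_field, banach} \<Rightarrow> 'v::ab_group_add \<Rightarrow> 'v" +
  fixes V :: "'v set" and nrm :: "'v \<Rightarrow> real"
  assumes carrier_subspace: "subspace V"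
    and norm_nonneg: "x \<in> V \<Longrightarrow> 0 \<le> nrm x"
    and norm_eq_zero_iff: "x \<in> V \<Longrightarrow> nrm x = 0 \<longleftrightarrow> x = 0"
    and norm_scale: "x \<in> V \<Longrightarrow> nrm (smul c x) = norm c * nrm x"
    and norm_triangle: "x \<in> V \<Longrightarrow> y \<in> V \<Longrightarrow> nrm (x + y) \<le> nrm x + nrm y"
    and complete: "Metric_space.mcomplete V (ndist V nrm)"

definition linear_on ::
  "('k \<Rightarrow> 'v::ab_group_add \<Rightarrow> 'v) \<Rightarrow> 'v set \<Rightarrow> 'v set \<Rightarrow> ('v \<Rightarrow> 'v) \<Rightarrow> bool" where
  "linear_on smul V W T \<longleftrightarrow>
     (\<forall>x\<in>V. T x \<in> W) \<and>
     (\<forall>x\<in>V. \<forall>y\<in>V. T (x + y) = T x + T y) \<and>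
     (\<forall>c. \<forall>x\<in>V. T (smul c x) = smul c (T x))"

definition bounded_linear_on ::
  "('k \<Rightarrow> 'v::ab_group_add \<Rightarrow> 'v) \<Rightarrow> 'v set \<Rightarrow> ('v \<Rightarrow> real) \<Rightarrow> 'v set \<Rightarrow> ('v \<Rightarrow> real) \<Rightarrow> ('v \<Rightarrow> 'v) \<Rightarrow> bool"
  where
  "bounded_linear_on smul V nrmV W nrmW T \<longleftrightarrow>
     linear_on smul V W T \<and> (\<exists>K. \<forall>x\<in>V. nrmW (T x) \<le> K * nrmV x)"

text \<open>Relativisation of \<open>onorm\<close>; to be used for operators satisfying \<open>bounded_linear_on\<close>, since
  the supremum of an unbounded set of reals is unspecified.\<close>

definition onorm_on :: "'v set \<Rightarrow> ('v \<Rightarrow> real) \<Rightarrow> ('v \<Rightarrow> real) \<Rightarrow> ('v \<Rightarrow> 'v) \<Rightarrow> real" where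
  "onorm_on V nrmV nrmW T = (SUP x\<in>V. nrmW (T x) / nrmV x)"

section \<open>Subprojective spaces\<close>

definition finite_dim ::
  "('k::field \<Rightarrow> 'v::ab_group_add \<Rightarrow> 'v) \<Rightarrow> 'v set \<Rightarrow> bool" where
  "finite_dim smul V \<longleftrightarrow> (\<exists>B. finite B \<and> B \<subseteq> V \<and> V \<subseteq> module.span smul B)"

definition complemented_in ::
  "('k::field \<Rightarrow> 'v::ab_group_add \<Rightarrow> 'v) \<Rightarrow> 'v set \<Rightarrow> ('v \<Rightarrow> real) \<Rightarrow> 'v set \<Rightarrow> bool" where
  "complemented_in smul V nrm N \<longleftrightarrow>
     (\<exists>P. bounded_linear_on smul V nrm V nrm P \<and> (\<forall>x\<in>V. P (P x) = P x) \<and> P ` V = N)"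

definition subprojective ::
  "('k::field \<Rightarrow> 'v::ab_group_add \<Rightarrow> 'v) \<Rightarrow> 'v set \<Rightarrow> ('v \<Rightarrow> real) \<Rightarrow> bool" where
  "subprojective smul V nrm \<longleftrightarrow>
     (\<forall>M. module.subspace smul M \<and> M \<subseteq> V \<and>
          closedin (Metric_space.mtopology V (ndist V nrm)) M \<and> \<not> finite_dim smul M \<longrightarrow>
        (\<exists>N. module.subspace smul N \<and> N \<subseteq> M \<and> \<not> finite_dim smul N \<and>
             complemented_in smul V nrm N))"

section \<open>The James-type space of a sequence of operators\<close>

text \<open>For \<open>n \<le> m\<close> this is \<open>\<phi> (m - 1) \<circ> \<dots> \<circ> \<phi> n\<close>: \<open>fold\<close> applies the head of the list first.\<close>

definition transition :: "(nat \<Rightarrow> 'v \<Rightarrow> 'v) \<Rightarrow> nat \<Rightarrow> nat \<Rightarrow> 'v \<Rightarrow> 'v" where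
  "transition \<phi> n m = fold \<phi> [n..<m]"

definition J_rho ::
  "(nat \<Rightarrow> 'v::ab_group_add \<Rightarrow> real) \<Rightarrow> (nat \<Rightarrow> 'v \<Rightarrow> 'v) \<Rightarrow> (nat \<Rightarrow> 'v) \<Rightarrow> nat set \<Rightarrow> real" where
  "J_rho nrm \<phi> x S =
     (let p = (!) (sorted_list_of_set S); k = card S - 1 in
      sqrt ((\<Sum>i=1..k. (nrm (p i) (transition \<phi> (p (i - 1)) (p i) (x (p (i - 1))) - x (p i)))\<^sup>2)
            + (nrm (p k) (x (p k)))\<^sup>2))"

text \<open>The set of nonempty finite sets of indices.\<close>

definition fin_index_sets :: "nat set set" where
  "fin_index_sets = {S. finite S \<and> S \<noteq> {}}"

text \<open>Meaningful on \<open>J_hat\<close> only: elsewhere the supremum is infinite mathematically, and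
  unspecified as a real number.\<close>

definition J_norm ::
  "(nat \<Rightarrow> 'v::ab_group_add \<Rightarrow> real) \<Rightarrow> (nat \<Rightarrow> 'v \<Rightarrow> 'v) \<Rightarrow> (nat \<Rightarrow> 'v) \<Rightarrow> real" where
  "J_norm nrm \<phi> x = 1 / sqrt 2 * (SUP S\<in>fin_index_sets. J_rho nrm \<phi> x S)"

text \<open>Finiteness of the supremum is expressed by \<open>bdd_above\<close>.\<close>

definition J_hat ::
  "(nat \<Rightarrow> 'v::ab_group_add set) \<Rightarrow> (nat \<Rightarrow> 'v \<Rightarrow> real) \<Rightarrow> (nat \<Rightarrow> 'v \<Rightarrow> 'v) \<Rightarrow> (nat \<Rightarrow> 'v) set" where
  "J_hat X nrm \<phi> = {x. (\<forall>n. x n \<in> X n) \<and> bdd_above (J_rho nrm \<phi> x ` fin_index_sets)}"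

definition J_space ::
  "(nat \<Rightarrow> 'v::ab_group_add set) \<Rightarrow> (nat \<Rightarrow> 'v \<Rightarrow> real) \<Rightarrow> (nat \<Rightarrow> 'v \<Rightarrow> 'v) \<Rightarrow> (nat \<Rightarrow> 'v) set" where
  "J_space X nrm \<phi> = {x \<in> J_hat X nrm \<phi>. (\<lambda>n. nrm n (x n)) \<longlonglongrightarrow> 0}"

text \<open>Sequences are added pointwise by \<open>HOL-Library.Function_Algebras\<close>; this is the matching
  scalar multiplication.\<close>

definition scale_seq :: "('k \<Rightarrow> 'v \<Rightarrow> 'v) \<Rightarrow> 'k \<Rightarrow> (nat \<Rightarrow> 'v) \<Rightarrow> nat \<Rightarrow> 'v" where
  "scale_seq smul c x = (\<lambda>n. smul c (x n))"

end

theory Submission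
  imports Defs "HOL-Computational_Algebra.Fundamental_Theorem_Algebra"
begin

text \<open>
  Write \<open>J\<close> for \<open>J_space X nrm \<phi>\<close>.  A coordinate space \<open>X n\<close> sits in \<open>J\<close> as the sequences supported at \<open>n\<close>, and the \<open>n\<close>-th coordinate is a
  bounded left inverse of this embedding.  Hence subprojectivity passes from \<open>J\<close> to \<open>X n\<close>
  (\<open>subprojective_coordinate\<close>): embed the given subspace, find a complemented subspace inside its
  image, and compress the projection to the coordinate.

  Conversely, let \<open>M\<close> be a closed infinite-dimensional subspace of \<open>J\<close> and compare the norm on \<open>M\<close>
  with the seminorms \<open>head b x = (\<Sum>i<b. nrm i (x i))\<close>.

  If some \<open>head b\<close> dominates the norm on an infinite-dimensional subspace of \<open>M\<close>, take the least such
  \<open>b\<close>.  It is positive, and \<open>head (b - 1)\<close> dominates the norm on no infinite-dimensional subspace, so it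
  is arbitrarily small relative to the norm on a suitable one (\<open>small_seminorm_subspace\<close>).  There the
  coordinate \<open>b - 1\<close> alone dominates the norm, and a complemented subspace is pulled back from that
  coordinate space (\<open>complemented_of_coordinate_bound\<close>).

  Otherwise \<open>M\<close> contains, for every \<open>b\<close>, unit vectors that nearly vanish on the first \<open>b\<close> coordinates.  As
  tails of elements of \<open>J\<close> are small in norm, a gliding hump argument gives unit vectors \<open>x k\<close> of \<open>M\<close> that
  are tiny perturbations of blocks \<open>u k\<close>, supported in the disjoint intervals \<open>{s k<..<q k}\<close> with
  \<open>q k \<le> s (k + 1)\<close>.  Sums of such blocks satisfy an upper Hilbert space estimate (\<open>block_sum_bound\<close>).
  For the matching projection one subtracts from a vector \<open>v\<close>, on the \<open>k\<close>-th interval, the image of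
  \<open>v (s k)\<close> under the transition maps.  This does not change the differences that enter the norm, turns
  the missing boundary terms into such differences, and fixes \<open>u k\<close>; since the intervals are
  disjoint, the squared norms of all these pieces add up to at most twice \<open>(J_norm nrm \<phi> v)\<^sup>2\<close>
  (\<open>recentre_square_sum\<close>).  Composing the pieces with functionals that norm \<open>u k\<close> up to a constant gives
  functionals \<open>g k\<close> biorthogonal to the \<open>u k\<close>, and \<open>v \<mapsto> (\<Sum>k. g k v \<cdot> x k)\<close> is a bounded operator
  that is nearly the identity on the closed span of the \<open>x k\<close>.  A contraction argument turns it into a
  projection onto that span (\<open>perturbed_biorthogonal_complemented\<close>).

  Norming functionals are needed over an arbitrary complete normed extension field of the reals.  By a
  theorem of Ostrowski such a field is the real or the complex field
  (\<open>real_normed_field_real_or_complex\<close>), and the real Hahn--Banach theorem, proved here through minimal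
  sublinear functionals, then gives functionals over the field in the usual way.
\<close>

section \<open>Normed extension fields of the reals\<close>

definition real_poly_eval :: "'k::real_normed_field \<Rightarrow> real poly \<Rightarrow> 'k" where
  "real_poly_eval a p = poly (map_poly of_real p) a"

lemma real_poly_eval_0 [simp]: "real_poly_eval a 0 = 0"
  by (simp add: real_poly_eval_def)

lemma real_poly_eval_pCons [simp]:
  "real_poly_eval a (pCons c p) = of_real c + a * real_poly_eval a p"
  by (simp add: real_poly_eval_def map_poly_pCons)

lemma real_poly_eval_add: "real_poly_eval a (p + q) = real_poly_eval a p + real_poly_eval a q"
proof (induction p arbitrary: q)
  case (pCons c p)
  show ?case
    by (cases q) (simp add: pCons.IH distrib_left)
qed simp

lemma real_poly_eval_smult: "real_poly_eval a (smult c p) = of_real c * real_poly_eval a p"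
  by (induction p) (simp_all add: algebra_simps)

lemma real_poly_eval_mult: "real_poly_eval a (p * q) = real_poly_eval a p * real_poly_eval a q"
  by (induction p) (simp_all add: real_poly_eval_add real_poly_eval_smult algebra_simps)

lemma real_poly_eval_1 [simp]: "real_poly_eval a 1 = 1"
  by (simp add: one_pCons)

lemma real_poly_eval_power: "real_poly_eval a (p ^ n) = real_poly_eval a p ^ n"
  by (induction n) (simp_all add: real_poly_eval_mult)

lemma real_poly_eval_prod: "real_poly_eval a (\<Prod>i\<in>I. p i) = (\<Prod>i\<in>I. real_poly_eval a (p i))"
  by (induction I rule: infinite_finite_induct) (simp_all add: real_poly_eval_mult)

text \<open>
  The real polynomial with roots \<open>z\<close> and its conjugate.  In a field without complex units,
  \<open>norm (real_poly_eval a (conj_quadratic z))\<close> replaces the squared distance from \<open>a\<close> to \<open>z\<close>.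
\<close>

definition conj_quadratic :: "complex \<Rightarrow> real poly" where
  "conj_quadratic z = [:(cmod z)\<^sup>2, - 2 * Re z, 1:]"

lemma poly_conj_quadratic: "poly (conj_quadratic z) x = (cmod (of_real x - z))\<^sup>2"
  unfolding conj_quadratic_def cmod_power2 by (simp add: power2_eq_square algebra_simps)

text \<open>
  The threshold is chosen so that the value exceeds the one at \<open>z = 0\<close>; this confines minimisers to a disc.
\<close>

lemma norm_conj_quadratic_large:
  fixes a :: "'k::real_normed_field"
  assumes "cmod z > 3 * norm a + 1"
  shows "norm (real_poly_eval a (conj_quadratic z)) > (norm a)\<^sup>2"
proof -
  let ?t = "cmod z" and ?n = "norm a"
  have ev: "real_poly_eval a (conj_quadratic z) = of_real (?t\<^sup>2) - (of_real (2 * Re z) * a - a\<^sup>2)"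
    by (simp add: conj_quadratic_def power2_eq_square algebra_simps)
  have "norm (of_real (2 * Re z) * a - a\<^sup>2) \<le> norm (of_real (2 * Re z) * a) + norm (a\<^sup>2)"
    by (rule norm_triangle_ineq4)
  also have "\<dots> = 2 * \<bar>Re z\<bar> * ?n + ?n\<^sup>2"
    by (simp add: norm_mult norm_power abs_mult)
  also have "\<dots> \<le> 2 * ?t * ?n + ?n\<^sup>2"
    using abs_Re_le_cmod[of z] by (intro add_right_mono mult_right_mono) auto
  finally have "norm (of_real (?t\<^sup>2) - (of_real (2 * Re z) * a - a\<^sup>2)) \<ge> ?t\<^sup>2 - (2 * ?t * ?n + ?n\<^sup>2)"
    using norm_triangle_ineq2[of "of_real (?t\<^sup>2)" "of_real (2 * Re z) * a - a\<^sup>2"]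
    by (simp add: norm_power)
  moreover have "?t * (?t - 2 * ?n) \<ge> (3 * ?n + 1) * (?n + 1)"
    using assms norm_ge_zero[of a] by (intro mult_mono) auto
  hence "?t * ?t - 2 * ?t * ?n \<ge> 3 * (?n * ?n) + 4 * ?n + 1"
    by (simp add: algebra_simps)
  hence "?t\<^sup>2 - (2 * ?t * ?n + ?n\<^sup>2) > ?n\<^sup>2"
    using norm_ge_zero[of a] zero_le_square[of ?n] unfolding power2_eq_square by linarith
  ultimately show ?thesis
    unfolding ev by linarith
qed

text \<open>
  The idea is a maximum principle.  Among the points where \<open>f z = norm (real_poly_eval a (conj_quadratic z))\<close>
  attains its minimum \<open>m\<close>, pick \<open>z0\<close> of largest modulus, and suppose \<open>m > 0\<close>.  For \<open>0 < e < m\<close> the polynomial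
  \<open>conj_quadratic z0 + e\<close> has a root \<open>z1\<close> of larger modulus, so \<open>f z1 > m\<close>.  Now
  \<open>G = conj_quadratic z0 ^ n - (- e) ^ n\<close> vanishes at \<open>z1\<close>, and \<open>G\<^sup>2\<close> is the product of the
  conjugate quadratics of its \<open>2 * n\<close> complex roots.  Evaluation at \<open>a\<close> gives
  \<open>f z1 * m ^ (2 * n - 1) \<le> (m ^ n + e ^ n)\<^sup>2\<close>, and \<open>n \<rightarrow> \<infinity>\<close> gives \<open>f z1 \<le> m\<close>.
\<close>

lemma real_normed_field_conj_quadratic_root:
  fixes a :: "'k::real_normed_field"
  shows "\<exists>z. real_poly_eval a (conj_quadratic z) = 0"
proof -
  define f where "f z = norm (real_poly_eval a (conj_quadratic z))" for z
  define R where "R = 3 * norm a + 1"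
  have R: "R \<ge> 0" by (simp add: R_def add_nonneg_nonneg)
  have f_alt: "f = (\<lambda>z. norm (of_real ((cmod z)\<^sup>2) + a * (of_real (- 2 * Re z) + a)))"
    by (auto simp: f_def conj_quadratic_def)
  have cont: "continuous_on S f" for S
    unfolding f_alt by (intro continuous_intros)
  have f0: "f 0 = (norm a)\<^sup>2"
    by (simp add: f_def conj_quadratic_def power2_eq_square norm_mult)
  have large: "f z > f 0" if "cmod z > R" for z
    using norm_conj_quadratic_large[of a z] that f0 by (simp add: R_def f_def)
  obtain z' where z': "z' \<in> cball 0 R" "\<And>y. y \<in> cball 0 R \<Longrightarrow> f z' \<le> f y"
    using continuous_attains_inf[OF compact_cball _ cont] R by (metis cball_eq_empty not_less)
  define m where "m = f z'"
  have m_min: "m \<le> f z" for z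
  proof (cases "cmod z \<le> R")
    case True
    thus ?thesis using z'(2)[of z] by (simp add: m_def)
  next
    case False
    thus ?thesis using large[of z] z'(2)[of 0] R by (simp add: m_def)
  qed
  define Z where "Z = {z \<in> cball 0 R. f z = m}"
  have "closed Z"
    unfolding Z_def using continuous_closed_preimage_constant[OF cont closed_cball] by blast
  hence "compact Z"
    using bounded_subset[OF bounded_cball, of Z 0 R] by (simp add: compact_eq_bounded_closed Z_def subset_iff)
  moreover have "Z \<noteq> {}"
    using z'(1) by (auto simp: Z_def m_def)
  ultimately obtain z0 where z0: "z0 \<in> Z" "\<And>z. z \<in> Z \<Longrightarrow> cmod z \<le> cmod z0"
    using continuous_attains_sup[of Z cmod] by (metis continuous_on_norm_id)
  have m_nonneg: "m \<ge> 0" by (simp add: m_def f_def)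
  have "m = 0"
  proof (rule ccontr)
    assume "m \<noteq> 0"
    with m_nonneg have m: "m > 0" by simp
    define e where "e = m / 2"
    have e: "e > 0" "e < m" using m by (auto simp: e_def)
    define z1 where "z1 = Complex (Re z0) (sqrt ((Im z0)\<^sup>2 + e))"
    have norm_z1: "(cmod z1)\<^sup>2 = (cmod z0)\<^sup>2 + e"
      using e by (simp add: z1_def cmod_power2 add_nonneg_nonneg)
    have "cmod z1 > cmod z0"
      using norm_z1 e by (intro power2_less_imp_less[of "cmod z0" "cmod z1"]) auto
    hence z1_notin: "z1 \<notin> Z" using z0(2)[of z1] by auto
    have f_z1: "f z1 > m"
    proof (rule ccontr)
      assume "\<not> f z1 > m"
      hence "f z1 = m" using m_min[of z1] by simp
      moreover have "cmod z1 \<le> R"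
        using large[of z1] m_min[of 0] \<open>f z1 = m\<close> by (meson less_le_trans not_less order_less_irrefl)
      ultimately show False using z1_notin by (simp add: Z_def)
    qed
    have bound: "f z1 * m ^ (2 * n - 1) \<le> (m ^ n + e ^ n)\<^sup>2" if n: "n > 0" for n
    proof -
      define G where "G = conj_quadratic z0 ^ n - [:(- e) ^ n:]"
      define QC where "QC = [:complex_of_real ((cmod z0)\<^sup>2), of_real (- 2 * Re z0), 1:]"
      define GC where "GC = QC ^ n - [:of_real ((- e) ^ n):]"
      have deg_QC: "degree QC = 2" "lead_coeff QC = 1" by (simp_all add: QC_def)
      have QCn: "degree (QC ^ n) = 2 * n" "lead_coeff (QC ^ n) = 1"
        by (subst degree_power_eq; use deg_QC in auto) (metis deg_QC(2) lead_coeff_power power_one)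
      have deg_GC: "degree GC = 2 * n"
        unfolding GC_def diff_conv_add_uminus using n QCn(1) by (subst degree_add_eq_left) auto
      have lead_GC: "lead_coeff GC = 1"
        using n QCn deg_GC by (auto simp: GC_def coeff_pCons split: nat.splits)
      obtain root where root: "GC = (\<Prod>i<2 * n. [:- root i, 1:])"
        using complex_poly_decompose'[of GC] lead_GC deg_GC by (metis smult_1_left)
      have QC_real: "poly QC (of_real x) = of_real (poly (conj_quadratic z0) x)" for x
        by (simp add: QC_def conj_quadratic_def)
      have GC_real: "poly GC (of_real x) = of_real (poly G x)" for x
        by (simp add: GC_def G_def QC_real)
      (* Real polynomials that agree at every real point are equal, so the complex factorisation
         of G need only be compared on the real line. *)
      have "poly (G * G) x = poly (\<Prod>i<2 * n. conj_quadratic (root i)) x" for x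
      proof -
        have "poly (G * G) x = (cmod (poly GC (of_real x)))\<^sup>2"
          by (simp add: GC_real power2_eq_square)
        also have "\<dots> = (\<Prod>i<2 * n. (cmod (of_real x - root i))\<^sup>2)"
          by (simp add: root poly_prod flip: prod_norm prod_power_distrib)
        finally show ?thesis by (simp add: poly_prod poly_conj_quadratic)
      qed
      hence GG: "G * G = (\<Prod>i<2 * n. conj_quadratic (root i))"
        using poly_eq_poly_eq_iff by blast
      have "poly QC z1 = of_real (- e)"
      proof -
        have "poly QC z1 = (z1 - of_real (Re z0))\<^sup>2 + of_real ((Im z0)\<^sup>2)"
          unfolding QC_def cmod_power2 by (simp add: power2_eq_square algebra_simps)
        also have "z1 - of_real (Re z0) = \<i> * of_real (sqrt ((Im z0)\<^sup>2 + e))"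
          by (simp add: z1_def complex_eq_iff)
        also have "(\<dots>)\<^sup>2 = - of_real ((Im z0)\<^sup>2 + e)"
          using e by (simp add: power_mult_distrib add_nonneg_nonneg flip: of_real_power)
        finally show ?thesis by simp
      qed
      hence "poly GC z1 = 0" by (simp add: GC_def)
      then obtain i0 where i0: "i0 < 2 * n" "z1 = root i0"
        unfolding root by (auto simp: poly_prod)
      have norm_GG: "norm (real_poly_eval a G) ^ 2 = (\<Prod>i<2 * n. f (root i))"
        using arg_cong[OF GG, of "\<lambda>p. norm (real_poly_eval a p)"]
        by (simp add: real_poly_eval_mult real_poly_eval_prod norm_mult power2_eq_square f_def
              flip: prod_norm)
      have "f z1 * m ^ (2 * n - 1) = f (root i0) * (\<Prod>i\<in>{..<2 * n} - {i0}. m)"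
        using i0 by simp
      also have "\<dots> \<le> f (root i0) * (\<Prod>i\<in>{..<2 * n} - {i0}. f (root i))"
        using m_min m_nonneg by (intro mult_left_mono prod_mono) (auto simp: f_def)
      also have "\<dots> = (\<Prod>i<2 * n. f (root i))"
        using i0 by (subst prod.remove[of _ i0]) auto
      also have "\<dots> = norm (real_poly_eval a G) ^ 2" by (simp add: norm_GG)
      also have "\<dots> \<le> (m ^ n + e ^ n)\<^sup>2"
      proof (rule power_mono)
        have ev: "real_poly_eval a G = real_poly_eval a (conj_quadratic z0) ^ n + of_real (- ((- e) ^ n))"
        proof -
          have "G = conj_quadratic z0 ^ n + [:- ((- e) ^ n):]" by (simp add: G_def)
          thus ?thesis by (simp add: real_poly_eval_add real_poly_eval_power)
        qed
        have "norm (real_poly_eval a (conj_quadratic z0)) = m"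
          using z0(1) by (simp add: Z_def f_def)
        thus "norm (real_poly_eval a G) \<le> m ^ n + e ^ n"
          unfolding ev using norm_triangle_ineq[of "real_poly_eval a (conj_quadratic z0) ^ n" "of_real (- ((- e) ^ n))"] e
          by (simp add: norm_power power_abs del: of_real_minus of_real_power)
      qed simp
      finally show ?thesis .
    qed
    have "f z1 / m \<le> (1 + (e / m) ^ n)\<^sup>2" if n: "n > 0" for n
    proof -
      have "f z1 * m ^ (2 * n - 1) / m ^ (2 * n) \<le> (m ^ n + e ^ n)\<^sup>2 / m ^ (2 * n)"
        using bound[OF n] m by (intro divide_right_mono) auto
      also have "m ^ (2 * n) = m * m ^ (2 * n - 1)"
        using n by (simp flip: power_Suc)
      hence "f z1 * m ^ (2 * n - 1) / m ^ (2 * n) = f z1 / m" using m by simp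
      also have "(m ^ n + e ^ n)\<^sup>2 / m ^ (2 * n) = ((m ^ n + e ^ n) / m ^ n)\<^sup>2"
        by (simp add: power_divide power_mult mult.commute)
      also have "(m ^ n + e ^ n) / m ^ n = 1 + (e / m) ^ n"
        using m by (simp add: power_divide add_divide_distrib)
      finally show ?thesis .
    qed
    moreover have "(\<lambda>n. (1 + (e / m) ^ n)\<^sup>2) \<longlonglongrightarrow> (1 + 0)\<^sup>2"
      using e m by (intro tendsto_intros LIMSEQ_realpow_zero) auto
    ultimately have "f z1 / m \<le> (1 + 0)\<^sup>2"
      by (intro tendsto_lowerbound) (auto intro: eventually_sequentiallyI[of 1])
    thus False using f_z1 m by simp
  qed
  thus ?thesis unfolding m_def f_def by auto
qed

text \<open>
  By the previous lemma every element \<open>a\<close> satisfies \<open>(a - r)\<^sup>2 = - s\<^sup>2\<close> for real \<open>r\<close> and \<open>s\<close>.  If \<open>s \<noteq> 0\<close> for some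
  \<open>a\<close>, then \<open>(a - r) / s\<close> is a square root of \<open>- 1\<close>, and with such a root every equation of this form
  has only the solutions \<open>r + s i\<close> and \<open>r - s i\<close>.
\<close>

theorem real_normed_field_real_or_complex:
  "(\<forall>a :: 'k::real_normed_field. \<exists>r. a = of_real r) \<or>
   (\<exists>i :: 'k. i * i = - 1 \<and> (\<forall>a. \<exists>r s. a = of_real r + of_real s * i))"
proof -
  have quad: "\<exists>r s. (a - of_real r)\<^sup>2 = - ((of_real s)\<^sup>2)" for a :: 'k
  proof -
    obtain z where "real_poly_eval a (conj_quadratic z) = 0"
      using real_normed_field_conj_quadratic_root by blast
    hence "(a - of_real (Re z))\<^sup>2 + (of_real (Im z))\<^sup>2 = 0"
      unfolding conj_quadratic_def cmod_power2 by (simp add: power2_eq_square algebra_simps)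
    thus ?thesis by (metis eq_neg_iff_add_eq_0)
  qed
  show ?thesis
  proof (rule disjCI)
    assume "\<not> (\<exists>i :: 'k. i * i = - 1 \<and> (\<forall>a. \<exists>r s. a = of_real r + of_real s * i))"
    hence no_i: "\<exists>a. \<forall>r s. a \<noteq> of_real r + of_real s * i" if "i * i = - 1" for i :: 'k
      using that by blast
    have no_unit: "i * i \<noteq> - 1" for i :: 'k
    proof
      assume i: "i * i = - 1"
      then obtain a where a: "\<And>r s. a \<noteq> of_real r + of_real s * i"
        using no_i by blast
      obtain r s where "(a - of_real r)\<^sup>2 = - ((of_real s)\<^sup>2)" using quad by blast
      also have "\<dots> = (of_real s * i)\<^sup>2"
        unfolding power_mult_distrib power2_eq_square[of i] i by simp
      finally have "a - of_real r = of_real s * i \<or> a - of_real r = - (of_real s * i)"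
        by (simp add: power2_eq_iff)
      hence "a = of_real r + of_real s * i \<or> a = of_real r + of_real (- s) * i"
        by (auto simp: algebra_simps)
      with a show False by blast
    qed
    show "\<forall>a :: 'k. \<exists>r. a = of_real r"
    proof
      fix a :: 'k
      obtain r s where rs: "(a - of_real r)\<^sup>2 = - ((of_real s)\<^sup>2)" using quad by blast
      show "\<exists>r. a = of_real r"
      proof (cases "s = 0")
        case False
        have "((a - of_real r) / of_real s) * ((a - of_real r) / of_real s) = - 1"
          using rs False by (simp add: field_simps power2_eq_square)
        with no_unit show ?thesis by blast
      qed (use rs in auto)
    qed
  qed
qed

section \<open>Normed spaces on carrier sets\<close>

text \<open>
  Completeness is split off from \<open>banach_space_on\<close>, because the completeness of \<open>J\<close> is a statement about
  the metric of its norm.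
\<close>

locale normed_space_on = vector_space smul
  for smul :: "'k::real_normed_field \<Rightarrow> 'v::ab_group_add \<Rightarrow> 'v" +
  fixes V :: "'v set" and nrm :: "'v \<Rightarrow> real"
  assumes subspace_V: "subspace V"
    and nrm_nonneg: "x \<in> V \<Longrightarrow> 0 \<le> nrm x"
    and nrm_eq_0_iff: "x \<in> V \<Longrightarrow> nrm x = 0 \<longleftrightarrow> x = 0"
    and nrm_scale: "x \<in> V \<Longrightarrow> nrm (smul c x) = norm c * nrm x"
    and nrm_triangle: "x \<in> V \<Longrightarrow> y \<in> V \<Longrightarrow> nrm (x + y) \<le> nrm x + nrm y"
begin

lemma zero_mem [simp]: "0 \<in> V"
  and add_mem: "x \<in> V \<Longrightarrow> y \<in> V \<Longrightarrow> x + y \<in> V"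
  and scale_mem: "x \<in> V \<Longrightarrow> smul c x \<in> V"
  and uminus_mem: "x \<in> V \<Longrightarrow> - x \<in> V"
  and diff_mem: "x \<in> V \<Longrightarrow> y \<in> V \<Longrightarrow> x - y \<in> V"
  and sum_mem: "(\<And>i. i \<in> I \<Longrightarrow> f i \<in> V) \<Longrightarrow> sum f I \<in> V"
  using subspace_V
  by (auto intro: subspace_0 subspace_add subspace_scale subspace_neg subspace_diff subspace_sum)

lemmas mem_simps = add_mem scale_mem uminus_mem diff_mem sum_mem

lemma nrm_0 [simp]: "nrm 0 = 0"
  using nrm_eq_0_iff[of 0] by simp

lemma nrm_uminus: "x \<in> V \<Longrightarrow> nrm (- x) = nrm x"
  using nrm_scale[of x "- 1"] by simp

lemma nrm_scale_real: "x \<in> V \<Longrightarrow> nrm (smul (of_real r) x) = \<bar>r\<bar> * nrm x"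
  by (simp add: nrm_scale)

lemma nrm_minus_commute: "x \<in> V \<Longrightarrow> y \<in> V \<Longrightarrow> nrm (x - y) = nrm (y - x)"
  using nrm_uminus[of "x - y"] by (simp add: diff_mem)

lemma nrm_diff_le: "x \<in> V \<Longrightarrow> y \<in> V \<Longrightarrow> nrm (x - y) \<le> nrm x + nrm y"
  using nrm_triangle[of x "- y"] by (simp add: uminus_mem nrm_uminus)

lemma nrm_diff_ge: "x \<in> V \<Longrightarrow> y \<in> V \<Longrightarrow> nrm x - nrm y \<le> nrm (x - y)"
  using nrm_triangle[of "x - y" y] by (simp add: diff_mem)

lemma nrm_diff_triangle:
  "x \<in> V \<Longrightarrow> y \<in> V \<Longrightarrow> z \<in> V \<Longrightarrow> nrm (x - z) \<le> nrm (x - y) + nrm (y - z)"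
  using nrm_triangle[of "x - y" "y - z"] by (simp add: diff_mem)

lemma nrm_sum_le: "(\<And>i. i \<in> I \<Longrightarrow> f i \<in> V) \<Longrightarrow> nrm (sum f I) \<le> (\<Sum>i\<in>I. nrm (f i))"
proof (induction I rule: infinite_finite_induct)
  case (insert i I)
  thus ?case
    using nrm_triangle[of "f i" "sum f I"] by (auto simp: sum_mem)
qed auto

lemma metric: "Metric_space V (ndist V nrm)"
proof
  show "ndist V nrm x y \<ge> 0" for x y
    by (simp add: ndist_def nrm_nonneg diff_mem)
  show "ndist V nrm x y = ndist V nrm y x" for x y
    by (simp add: ndist_def nrm_minus_commute)
  show "ndist V nrm x y = 0 \<longleftrightarrow> x = y" if "x \<in> V" "y \<in> V" for x y
    using that by (simp add: ndist_def nrm_eq_0_iff diff_mem)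
  show "ndist V nrm x z \<le> ndist V nrm x y + ndist V nrm y z"
    if "x \<in> V" "y \<in> V" "z \<in> V" for x y z
    using that by (simp add: ndist_def nrm_diff_triangle)
qed

text \<open>
  Closedness in the metric topology, rewritten without reference to it (\<open>closedin_iff_near_closed\<close>).
\<close>

definition near_closed :: "'v set \<Rightarrow> bool" where
  "near_closed M \<longleftrightarrow> (\<forall>l\<in>V. (\<forall>e>0. \<exists>x\<in>M. nrm (x - l) < e) \<longrightarrow> l \<in> M)"

lemma closedin_iff_near_closed:
  assumes "M \<subseteq> V"
  shows "closedin (Metric_space.mtopology V (ndist V nrm)) M \<longleftrightarrow> near_closed M"
proof -
  interpret Metric_space V "ndist V nrm" by (rule metric)
  have "closedin mtopology M \<longleftrightarrow> mtopology closure_of M \<subseteq> M"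
    using closure_of_subset_eq[of M mtopology] assms by simp
  also have "mtopology closure_of M = {l \<in> V. \<forall>e>0. \<exists>x\<in>M. nrm (x - l) < e}"
  proof -
    have "(y \<in> M \<and> y \<in> mball x r) \<longleftrightarrow> (y \<in> M \<and> nrm (y - x) < r)" if "x \<in> V" for x y r
      using that assms nrm_minus_commute[of x y] by (auto simp: ndist_def)
    thus ?thesis unfolding metric_closure_of by blast
  qed
  finally show ?thesis
    by (auto simp: near_closed_def)
qed

lemma near_closed_limit:
  assumes "near_closed M" "\<And>n. s n \<in> M" "l \<in> V" "(\<lambda>n. nrm (s n - l)) \<longlonglongrightarrow> 0"
  shows "l \<in> M"
proof -
  have "\<exists>x\<in>M. nrm (x - l) < e" if "e > 0" for e
  proof -
    have "\<exists>n. nrm (s n - l) < e"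
      using eventually_happens'[OF sequentially_bot order_tendstoD(2)[OF assms(4) that]] .
    thus ?thesis using assms(2) by blast
  qed
  thus ?thesis using assms by (auto simp: near_closed_def)
qed

definition nclosure :: "'v set \<Rightarrow> 'v set" where
  "nclosure M = {l \<in> V. \<forall>e>0. \<exists>x\<in>M. nrm (x - l) < e}"

lemma nclosure_subset: "nclosure M \<subseteq> V"
  by (auto simp: nclosure_def)

lemma subset_nclosure: "M \<subseteq> V \<Longrightarrow> M \<subseteq> nclosure M"
proof
  fix x assume "M \<subseteq> V" "x \<in> M"
  moreover have "nrm (x - x) < e" if "e > 0" for e using that by simp
  ultimately show "x \<in> nclosure M" unfolding nclosure_def by blast
qed

lemma nclosure_minimal: "near_closed N \<Longrightarrow> M \<subseteq> N \<Longrightarrow> nclosure M \<subseteq> N"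
  unfolding nclosure_def near_closed_def by blast

lemma near_closed_nclosure:
  assumes "M \<subseteq> V"
  shows "near_closed (nclosure M)"
  unfolding near_closed_def
proof safe
  fix l assume l: "l \<in> V" "\<forall>e>0. \<exists>x\<in>nclosure M. nrm (x - l) < e"
  have "\<exists>x\<in>M. nrm (x - l) < e" if "e > 0" for e
  proof -
    obtain y where y: "y \<in> nclosure M" "nrm (y - l) < e / 2"
      using l(2) \<open>e > 0\<close> by (meson half_gt_zero)
    moreover have "e / 2 > 0" using \<open>e > 0\<close> by simp
    ultimately obtain x where x: "x \<in> M" "nrm (x - y) < e / 2"
      unfolding nclosure_def by blast
    have "x \<in> V" "y \<in> V" using x y assms nclosure_subset by auto
    hence "nrm (x - l) < e"
      using nrm_diff_triangle[of x y l] x y l by simp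
    thus ?thesis using x by blast
  qed
  with l show "l \<in> nclosure M" by (simp add: nclosure_def)
qed

lemma subspace_nclosure:
  assumes M: "subspace M" "M \<subseteq> V"
  shows "subspace (nclosure M)"
proof (rule subspaceI)
  show "0 \<in> nclosure M"
    using subset_nclosure[OF M(2)] subspace_0[OF M(1)] by blast
next
  fix x y assume xy: "x \<in> nclosure M" "y \<in> nclosure M"
  have V: "x \<in> V" "y \<in> V" using xy nclosure_subset by auto
  have "\<exists>z\<in>M. nrm (z - (x + y)) < e" if "e > 0" for e
  proof -
    have "e / 2 > 0" using that by simp
    with xy obtain x' y' where x': "x' \<in> M" "nrm (x' - x) < e / 2"
      and y': "y' \<in> M" "nrm (y' - y) < e / 2"
      unfolding nclosure_def by blast
    have "nrm ((x' - x) + (y' - y)) < e"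
      using nrm_triangle[of "x' - x" "y' - y"] x' y' V M by (auto simp: diff_mem subset_iff)
    moreover have "(x' - x) + (y' - y) = (x' + y') - (x + y)" by simp
    ultimately show ?thesis using subspace_add[OF M(1) x'(1) y'(1)] by metis
  qed
  thus "x + y \<in> nclosure M" using V by (simp add: nclosure_def add_mem)
next
  fix c x assume x: "x \<in> nclosure M"
  have V: "x \<in> V" using x nclosure_subset by auto
  have "\<exists>z\<in>M. nrm (z - smul c x) < e" if "e > 0" for e
  proof -
    have "e / (norm c + 1) > 0" using that by (simp add: add_nonneg_pos)
    with x obtain x' where x': "x' \<in> M" "nrm (x' - x) < e / (norm c + 1)"
      unfolding nclosure_def by blast
    have x'x: "x' - x \<in> V" using x' V M by (auto simp: diff_mem)
    have "nrm (smul c (x' - x)) = norm c * nrm (x' - x)" using x'x by (rule nrm_scale)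
    also have "\<dots> \<le> (norm c + 1) * nrm (x' - x)"
      using nrm_nonneg[OF x'x] by (simp add: algebra_simps)
    also have "\<dots> < e"
      using x'(2) by (simp add: pos_less_divide_eq add_nonneg_pos mult.commute)
    finally have "nrm (smul c x' - smul c x) < e" by (simp add: scale_right_diff_distrib)
    thus ?thesis using subspace_scale[OF M(1) x'(1)] by metis
  qed
  thus "smul c x \<in> nclosure M" using V by (simp add: nclosure_def scale_mem)
qed

section \<open>Hahn--Banach theorem\<close>

text \<open>
  Vanishing outside the carrier makes a sublinear functional determined by its restriction, so that
  minimality below is with respect to a partial order.
\<close>

definition sublinear :: "('v \<Rightarrow> real) \<Rightarrow> bool" where
  "sublinear p \<longleftrightarrow> (\<forall>x\<in>V. \<forall>y\<in>V. p (x + y) \<le> p x + p y) \<and>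
     (\<forall>r\<ge>0. \<forall>x\<in>V. p (smul (of_real r) x) \<le> r * p x) \<and> (\<forall>x. x \<notin> V \<longrightarrow> p x = 0)"

lemma sublinear_add: "sublinear p \<Longrightarrow> x \<in> V \<Longrightarrow> y \<in> V \<Longrightarrow> p (x + y) \<le> p x + p y"
  and sublinear_outside: "sublinear p \<Longrightarrow> x \<notin> V \<Longrightarrow> p x = 0"
  by (auto simp: sublinear_def)

lemma sublinear_scale:
  assumes p: "sublinear p" and x: "x \<in> V" and r: "r \<ge> 0"
  shows "p (smul (of_real r) x) = r * p x"
proof -
  have le: "p (smul (of_real r) x) \<le> r * p x" if "r \<ge> 0" "x \<in> V" for r x
    using p that unfolding sublinear_def by blast
  show ?thesis
  proof (cases "r = 0")
    case True
    have "0 \<le> p 0" using sublinear_add[OF p zero_mem zero_mem] by simp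
    with le[of 0 0] True show ?thesis by simp
  next
    case False
    hence "r > 0" using r by simp
    have "p (smul (of_real (1 / r)) (smul (of_real r) x)) \<le> 1 / r * p (smul (of_real r) x)"
      using r x by (intro le) (auto simp: scale_mem)
    hence "r * p x \<le> p (smul (of_real r) x)" using \<open>r > 0\<close> by (simp add: field_simps)
    with le[OF r x] show ?thesis by simp
  qed
qed

lemma sublinear_0 [simp]: "sublinear p \<Longrightarrow> p 0 = 0"
  using sublinear_scale[of p 0 0] by simp

lemma sublinear_ge: "sublinear p \<Longrightarrow> x \<in> V \<Longrightarrow> - p (- x) \<le> p x"
  using sublinear_add[of p x "- x"] by (simp add: uminus_mem)

text \<open>
  The largest sublinear functional below \<open>p\<close> that is at most \<open>- p y\<close> at \<open>- y\<close>.  A minimal \<open>p\<close> equals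
  all its shifts, so that \<open>p (- y) \<le> - p y\<close> for all \<open>y\<close>, which makes \<open>p\<close> linear.
\<close>

definition sublinear_shift :: "('v \<Rightarrow> real) \<Rightarrow> 'v \<Rightarrow> 'v \<Rightarrow> real" where
  "sublinear_shift p y x =
     (if x \<in> V then INF t\<in>{0..}. p (x + smul (of_real t) y) - t * p y else 0)"

context
  fixes p y assumes p: "sublinear p" and y: "y \<in> V"
begin

lemma sublinear_shift_bdd:
  assumes x: "x \<in> V"
  shows "bdd_below ((\<lambda>t. p (x + smul (of_real t) y) - t * p y) ` {0..})"
proof (rule bdd_belowI2[where m = "- p (- x)"])
  fix t :: real assume t: "t \<in> {0..}"
  have "p (smul (of_real t) y) \<le> p (x + smul (of_real t) y) + p (- x)"
    using sublinear_add[OF p, of "x + smul (of_real t) y" "- x"] x y by (simp add: mem_simps)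
  thus "- p (- x) \<le> p (x + smul (of_real t) y) - t * p y"
    using sublinear_scale[OF p y, of t] t by simp
qed

lemma sublinear_shift_le:
  assumes "x \<in> V" "t \<ge> 0"
  shows "sublinear_shift p y x \<le> p (x + smul (of_real t) y) - t * p y"
  using assms cINF_lower[OF sublinear_shift_bdd, of x t] by (simp add: sublinear_shift_def)

lemma sublinear_shift_greatest:
  assumes "x \<in> V" "\<And>t. t \<ge> 0 \<Longrightarrow> c \<le> p (x + smul (of_real t) y) - t * p y"
  shows "c \<le> sublinear_shift p y x"
  using assms by (auto simp: sublinear_shift_def intro!: cINF_greatest)

lemma sublinear_shift_le_self: "sublinear_shift p y x \<le> p x"
  using sublinear_shift_le[of x 0] sublinear_outside[OF p, of x]
  by (cases "x \<in> V") (auto simp: sublinear_shift_def)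

lemma sublinear_shift_uminus: "sublinear_shift p y (- y) \<le> - p y"
  using sublinear_shift_le[of "- y" 1] y p by (simp add: uminus_mem)

lemma sublinear_shift_scale_le:
  assumes x: "x \<in> V" and r: "r > 0"
  shows "sublinear_shift p y (smul (of_real r) x) \<le> r * sublinear_shift p y x"
proof -
  have "sublinear_shift p y (smul (of_real r) x) / r \<le> sublinear_shift p y x"
  proof (rule sublinear_shift_greatest[OF x])
    fix t :: real assume t: "t \<ge> 0"
    have "sublinear_shift p y (smul (of_real r) x)
          \<le> p (smul (of_real r) x + smul (of_real (r * t)) y) - r * t * p y"
      using sublinear_shift_le[of "smul (of_real r) x" "r * t"] x r t by (simp add: scale_mem)
    also have "smul (of_real r) x + smul (of_real (r * t)) y = smul (of_real r) (x + smul (of_real t) y)"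
      by (simp add: scale_right_distrib)
    also have "p \<dots> = r * p (x + smul (of_real t) y)"
      using x y r by (intro sublinear_scale[OF p]) (auto simp: mem_simps)
    finally show "sublinear_shift p y (smul (of_real r) x) / r \<le> p (x + smul (of_real t) y) - t * p y"
      using r by (simp add: field_simps)
  qed
  thus ?thesis using r by (simp add: field_simps)
qed

lemma sublinear_sublinear_shift: "sublinear (sublinear_shift p y)"
  unfolding sublinear_def
proof (intro conjI ballI allI impI)
  fix x x' assume x: "x \<in> V" "x' \<in> V"
  have "sublinear_shift p y (x + x') - sublinear_shift p y x \<le> sublinear_shift p y x'"
  proof (rule sublinear_shift_greatest[OF x(2)])
    fix s :: real assume s: "s \<ge> 0"
    have "sublinear_shift p y (x + x') - (p (x' + smul (of_real s) y) - s * p y)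
          \<le> sublinear_shift p y x"
    proof (rule sublinear_shift_greatest[OF x(1)])
      fix t :: real assume t: "t \<ge> 0"
      have "sublinear_shift p y (x + x')
            \<le> p (x + x' + smul (of_real (t + s)) y) - (t + s) * p y"
        using sublinear_shift_le[of "x + x'" "t + s"] x s t by (simp add: mem_simps)
      also have "x + x' + smul (of_real (t + s)) y
                 = (x + smul (of_real t) y) + (x' + smul (of_real s) y)"
        by (simp add: scale_left_distrib algebra_simps)
      also have "p \<dots> \<le> p (x + smul (of_real t) y) + p (x' + smul (of_real s) y)"
        using x y by (intro sublinear_add[OF p]) (auto simp: mem_simps)
      finally show "sublinear_shift p y (x + x') - (p (x' + smul (of_real s) y) - s * p y)
            \<le> p (x + smul (of_real t) y) - t * p y"
        by (simp add: algebra_simps)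
    qed
    thus "sublinear_shift p y (x + x') - sublinear_shift p y x
          \<le> p (x' + smul (of_real s) y) - s * p y" by simp
  qed
  thus "sublinear_shift p y (x + x') \<le> sublinear_shift p y x + sublinear_shift p y x'" by simp
next
  fix r :: real and x assume r: "r \<ge> 0" and x: "x \<in> V"
  show "sublinear_shift p y (smul (of_real r) x) \<le> r * sublinear_shift p y x"
    using sublinear_shift_scale_le[OF x, of r] sublinear_shift_le_self[of 0] r p by (cases "r = 0") auto
qed (simp add: sublinear_shift_def)

end

text \<open>
  Zorn's lemma for the reversed pointwise order.  A chain has its pointwise infimum as a lower bound; the
  infimum is finite because \<open>- p0 (- x) \<le> - p (- x) \<le> p x\<close>, and it is subadditive because any two members
  of a chain lie above one of them.
\<close>

lemma minimal_sublinear_exists: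
  assumes p0: "sublinear p0"
  obtains p where "sublinear p" "\<And>x. p x \<le> p0 x"
    "\<And>q. sublinear q \<Longrightarrow> (\<And>x. q x \<le> p x) \<Longrightarrow> q = p"
proof -
  define A where "A = {p. sublinear p \<and> (\<forall>x. p x \<le> p0 x)}"
  define P where "P = (\<lambda>p q :: 'v \<Rightarrow> real. \<forall>x. q x \<le> p x)"
  have "\<exists>m\<in>A. \<forall>a\<in>A. P m a \<longrightarrow> a = m"
  proof (rule predicate_Zorn)
    show "partial_order_on A (relation_of P A)"
      by (rule partial_order_on_relation_ofI) (auto simp: P_def fun_eq_iff intro: order.trans order.antisym)
  next
    fix C assume C: "C \<in> Chains (relation_of P A)"
    have C_A: "C \<subseteq> A" and total: "p \<in> C \<Longrightarrow> q \<in> C \<Longrightarrow> P p q \<or> P q p" for p q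
      using C by (auto simp: Chains_def relation_of_def)
    show "\<exists>u\<in>A. \<forall>a\<in>C. P a u"
    proof (cases "C = {}")
      case True
      with p0 show ?thesis by (auto simp: A_def)
    next
      case False
      have bdd: "bdd_below ((\<lambda>p. p x) ` C)" for x
      proof (cases "x \<in> V")
        case True
        show ?thesis
        proof (rule bdd_belowI2[where m = "- p0 (- x)"])
          fix p assume "p \<in> C"
          hence "sublinear p" "p (- x) \<le> p0 (- x)" using C_A by (auto simp: A_def)
          with sublinear_ge[of p x] True show "- p0 (- x) \<le> p x" by simp
        qed
      next
        case x: False
        show ?thesis
        proof (rule bdd_belowI2[where m = 0])
          fix p assume "p \<in> C"
          hence "sublinear p" using C_A by (auto simp: A_def)
          with sublinear_outside x show "0 \<le> p x" by fastforce
        qed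
      qed
      define u where "u x = (INF p\<in>C. p x)" for x
      have u_le: "u x \<le> p x" if "p \<in> C" for p x
        unfolding u_def using bdd that by (intro cINF_lower)
      have u_greatest: "c \<le> u x" if "\<And>p. p \<in> C \<Longrightarrow> c \<le> p x" for c x
        unfolding u_def using False that by (intro cINF_greatest)
      have sub: "sublinear p" if "p \<in> C" for p using that C_A by (auto simp: A_def)
      have "sublinear u"
        unfolding sublinear_def
      proof (intro conjI ballI allI impI)
        fix x y assume xy: "x \<in> V" "y \<in> V"
        have "u (x + y) - u x \<le> u y"
        proof (rule u_greatest)
          fix q assume q: "q \<in> C"
          have "u (x + y) - q y \<le> u x"
          proof (rule u_greatest)
            fix p assume pC: "p \<in> C"
            obtain r where r: "r \<in> C" "r x \<le> p x" "r y \<le> q y"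
              using total[OF pC q] pC q by (auto simp: P_def)
            show "u (x + y) - q y \<le> p x"
              using u_le[OF r(1), of "x + y"] sublinear_add[OF sub[OF r(1)] xy] r by linarith
          qed
          thus "u (x + y) - u x \<le> q y" by simp
        qed
        thus "u (x + y) \<le> u x + u y" by simp
      next
        fix r :: real and x assume r: "0 \<le> r" and x: "x \<in> V"
        show "u (smul (of_real r) x) \<le> r * u x"
        proof (cases "r = 0")
          case True
          obtain p where "p \<in> C" using False by blast
          with u_le[of p 0] sub True show ?thesis by simp
        next
          case r0: False
          with r have "r > 0" by simp
          have "u (smul (of_real r) x) / r \<le> u x"
          proof (rule u_greatest)
            fix p assume "p \<in> C"
            with u_le[of p "smul (of_real r) x"] sublinear_scale[OF sub, of p x r] x r \<open>r > 0\<close>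
            show "u (smul (of_real r) x) / r \<le> p x" by (simp add: field_simps)
          qed
          thus ?thesis using \<open>r > 0\<close> by (simp add: field_simps)
        qed
      next
        fix x assume "x \<notin> V"
        hence "(\<lambda>p. p x) ` C = {0}"
          using False sub sublinear_outside by (auto simp: image_iff)
        thus "u x = 0" by (simp add: u_def)
      qed
      moreover have "u x \<le> p0 x" for x
      proof -
        obtain p where "p \<in> C" using False by blast
        hence "u x \<le> p x" "p x \<le> p0 x" using u_le C_A by (auto simp: A_def)
        thus ?thesis by linarith
      qed
      ultimately show ?thesis using u_le by (auto simp: A_def P_def)
    qed
  qed
  then obtain p where "p \<in> A" "\<And>q. q \<in> A \<Longrightarrow> P p q \<Longrightarrow> q = p" by blast
  thus ?thesis by (intro that[of p]) (auto simp: A_def P_def intro: order.trans)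
qed

text \<open>
  A minimal sublinear functional is linear.  Starting from the shift of the norm by \<open>u\<close> instead of the norm
  itself forces the value \<open>nrm u\<close> at \<open>u\<close>.
\<close>

lemma real_Hahn_Banach:
  assumes u: "u \<in> V"
  obtains g :: "'v \<Rightarrow> real" where
    "\<And>x y. x \<in> V \<Longrightarrow> y \<in> V \<Longrightarrow> g (x + y) = g x + g y"
    "\<And>r x. x \<in> V \<Longrightarrow> g (smul (of_real r) x) = r * g x"
    "\<And>x. x \<in> V \<Longrightarrow> \<bar>g x\<bar> \<le> nrm x" "g u = nrm u"
proof -
  define p0 where "p0 x = (if x \<in> V then nrm x else 0)" for x
  have p0: "sublinear p0"
    by (auto simp: sublinear_def p0_def mem_simps nrm_triangle nrm_scale_real)
  obtain p where p: "sublinear p" "\<And>x. p x \<le> sublinear_shift p0 u x"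
    "\<And>q. sublinear q \<Longrightarrow> (\<And>x. q x \<le> p x) \<Longrightarrow> q = p"
    using minimal_sublinear_exists[OF sublinear_sublinear_shift[OF p0 u]] by blast
  have p_uminus: "p (- y) = - p y" if y: "y \<in> V" for y
  proof -
    have "sublinear_shift p y = p"
      using p(3) sublinear_sublinear_shift[OF p(1) y] sublinear_shift_le_self[OF p(1) y] by blast
    with sublinear_shift_uminus[OF p(1) y] sublinear_ge[OF p(1) y] show ?thesis by simp
  qed
  have p_le: "p x \<le> nrm x" if "x \<in> V" for x
    using p(2)[of x] sublinear_shift_le_self[OF p0 u, of x] that by (simp add: p0_def)
  show ?thesis
  proof (rule that[of p])
    fix x y assume xy: "x \<in> V" "y \<in> V"
    have "p (- x + - y) \<le> p (- x) + p (- y)"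
      using xy by (intro sublinear_add[OF p(1)]) (auto simp: mem_simps)
    moreover have "p (- x + - y) = - p (x + y)"
      using p_uminus[of "x + y"] xy by (simp add: mem_simps)
    ultimately show "p (x + y) = p x + p y"
      using sublinear_add[OF p(1) xy] p_uminus xy by fastforce
  next
    fix r :: real and x assume x: "x \<in> V"
    show "p (smul (of_real r) x) = r * p x"
    proof (cases "r \<ge> 0")
      case False
      have "p (smul (of_real r) x) = p (- smul (of_real (- r)) x)" by simp
      also have "\<dots> = - p (smul (of_real (- r)) x)" using x by (intro p_uminus scale_mem)
      also have "\<dots> = r * p x" using sublinear_scale[OF p(1) x, of "- r"] False by simp
      finally show ?thesis .
    qed (rule sublinear_scale[OF p(1) x])
  next
    fix x assume x: "x \<in> V"
    show "\<bar>p x\<bar> \<le> nrm x"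
      using p_le[OF x] p_le[of "- x"] x by (simp add: p_uminus uminus_mem nrm_uminus)
  next
    have "p (- u) \<le> - nrm u"
      using p(2)[of "- u"] sublinear_shift_uminus[OF p0 u] u by (simp add: p0_def)
    thus "p u = nrm u" using p_uminus[OF u] p_le[OF u] by simp
  qed
qed

definition functional_on :: "'v set \<Rightarrow> ('v \<Rightarrow> 'k) \<Rightarrow> bool" where
  "functional_on W f \<longleftrightarrow> (\<forall>x\<in>W. \<forall>y\<in>W. f (x + y) = f x + f y) \<and> (\<forall>c. \<forall>x\<in>W. f (smul c x) = c * f x)"

text \<open>
  Multiply by the conjugate: the norm of the product is \<open>a\<^sup>2 + b\<^sup>2\<close>, and the conjugate has norm at most
  \<open>\<bar>a\<bar> + \<bar>b\<bar>\<close>.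
\<close>

lemma norm_real_add_unit_ge:
  fixes i :: 'k
  assumes i: "i * i = - 1"
  shows "\<bar>a\<bar> / 2 \<le> norm (of_real a + of_real b * i)"
proof (cases "a = 0")
  case False
  have "norm i * norm i = 1" using arg_cong[OF i, of norm] by (simp add: norm_mult)
  hence ni: "norm i = 1" using norm_ge_zero[of i] by (simp add: square_eq_1_iff)
  have pos: "\<bar>a\<bar> + \<bar>b\<bar> > 0" using False by simp
  have "a\<^sup>2 + b\<^sup>2 = norm (of_real (a\<^sup>2 + b\<^sup>2) :: 'k)" by (simp add: add_nonneg_nonneg del: of_real_add of_real_power)
  also have "(of_real (a\<^sup>2 + b\<^sup>2) :: 'k) = (of_real a + of_real b * i) * (of_real a - of_real b * i)"
  proof -
    have "(of_real b * i) * (of_real b * i) = - (of_real b * of_real b)"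
      using arg_cong[OF i, of "\<lambda>t. of_real b * of_real b * t"] by (simp add: ac_simps)
    thus ?thesis by (simp add: power2_eq_square algebra_simps)
  qed
  also have "norm \<dots> = norm (of_real a + of_real b * i) * norm (of_real a - of_real b * i)"
    by (rule norm_mult)
  also have "\<dots> \<le> norm (of_real a + of_real b * i) * (\<bar>a\<bar> + \<bar>b\<bar>)"
    using norm_triangle_ineq4[of "of_real a" "of_real b * i"]
    by (intro mult_left_mono) (auto simp: norm_mult ni)
  finally have *: "a\<^sup>2 + b\<^sup>2 \<le> norm (of_real a + of_real b * i) * (\<bar>a\<bar> + \<bar>b\<bar>)" .
  have "\<bar>a\<bar> / 2 * (\<bar>a\<bar> + \<bar>b\<bar>) \<le> a\<^sup>2 + b\<^sup>2"
  proof -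
    have "0 \<le> (\<bar>a\<bar> - \<bar>b\<bar>)\<^sup>2" by simp
    hence "2 * (\<bar>a\<bar> * \<bar>b\<bar>) \<le> a\<^sup>2 + b\<^sup>2" by (simp add: power2_diff)
    moreover have "\<bar>a\<bar> / 2 * (\<bar>a\<bar> + \<bar>b\<bar>) = a\<^sup>2 / 2 + \<bar>a\<bar> * \<bar>b\<bar> / 2"
      by (simp add: power2_eq_square field_simps flip: abs_mult)
    ultimately show ?thesis using zero_le_power2[of a] zero_le_power2[of b] by linarith
  qed
  with * have "\<bar>a\<bar> / 2 * (\<bar>a\<bar> + \<bar>b\<bar>) \<le> norm (of_real a + of_real b * i) * (\<bar>a\<bar> + \<bar>b\<bar>)" by linarith
  thus ?thesis using pos by (rule mult_right_le_imp_le)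
qed auto

text \<open>
  Over a field with a unit \<open>i\<close> a real functional \<open>g\<close> is turned into the linear functional
  \<open>x \<mapsto> g x - i * g (i x)\<close>.  It has norm at most \<open>2\<close> and size at least \<open>nrm u / 2\<close> at \<open>u\<close>; rescaling it to
  the value \<open>nrm u\<close> at \<open>u\<close> produces the constant \<open>4\<close>.
\<close>

lemma Hahn_Banach_functional:
  assumes u: "u \<in> V"
  obtains f where "functional_on V f" "\<And>x. x \<in> V \<Longrightarrow> norm (f x) \<le> 4 * nrm x"
    "f u = of_real (nrm u)"
proof -
  obtain g where g: "\<And>x y. x \<in> V \<Longrightarrow> y \<in> V \<Longrightarrow> g (x + y) = g x + g y"
    "\<And>r x. x \<in> V \<Longrightarrow> g (smul (of_real r) x) = r * g x"
    "\<And>x. x \<in> V \<Longrightarrow> \<bar>g x\<bar> \<le> nrm x" "g u = nrm u"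
    using real_Hahn_Banach[OF u] by blast
  consider "\<And>a :: 'k. \<exists>r. a = of_real r"
    | i where "i * i = (- 1 :: 'k)" "\<And>a :: 'k. \<exists>r s. a = of_real r + of_real s * i"
    using real_normed_field_real_or_complex by blast
  thus ?thesis
  proof cases
    case 1
    show ?thesis
    proof (rule that[of "\<lambda>x. of_real (g x)"])
      show "functional_on V (\<lambda>x. of_real (g x))"
        unfolding functional_on_def
      proof (intro conjI ballI allI)
        fix c :: 'k and x assume "x \<in> V"
        with 1[of c] show "of_real (g (smul c x)) = c * of_real (g x)" by (auto simp: g(2))
      qed (simp add: g)
      show "norm (of_real (g x) :: 'k) \<le> 4 * nrm x" if "x \<in> V" for x
        using g(3)[OF that] by simp
    qed (simp add: g)
  next
    case 2
    have "norm i * norm i = 1" using arg_cong[OF 2(1), of norm] by (simp add: norm_mult)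
    hence ni: "norm i = 1" using norm_ge_zero[of i] by (simp add: square_eq_1_iff)
    define f where "f x = of_real (g x) - i * of_real (g (smul i x))" for x
    have f_add: "f (x + y) = f x + f y" if "x \<in> V" "y \<in> V" for x y
      using that by (simp add: f_def g scale_mem scale_right_distrib algebra_simps)
    have f_real: "f (smul (of_real r) x) = of_real r * f x" if "x \<in> V" for r x
    proof -
      have "smul i (smul (of_real r) x) = smul (of_real r) (smul i x)"
        by (simp add: mult.commute)
      thus ?thesis using that by (simp only: f_def g(2) scale_mem) (simp add: algebra_simps)
    qed
    have f_i: "f (smul i x) = i * f x" if "x \<in> V" for x
    proof -
      have "g (smul i (smul i x)) = g (smul (of_real (- 1)) x)" using 2(1) by simp
      also have "\<dots> = - g x" using g(2)[OF that, of "- 1"] by simp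
      finally have "f (smul i x) = of_real (g (smul i x)) + i * of_real (g x)"
        by (simp add: f_def)
      also have "\<dots> = i * f x"
        using 2(1) by (simp add: f_def right_diff_distrib flip: mult.assoc)
      finally show ?thesis .
    qed
    have f_scale: "f (smul c x) = c * f x" if x: "x \<in> V" for c x
    proof -
      obtain r s where c: "c = of_real r + of_real s * i" using 2(2) by blast
      have "smul c x = smul (of_real r) x + smul (of_real s) (smul i x)"
        by (simp add: c scale_left_distrib)
      thus ?thesis using x by (simp add: c f_add f_real f_i scale_mem algebra_simps del: scale_scale)
    qed
    have f_le: "norm (f x) \<le> 2 * nrm x" if x: "x \<in> V" for x
    proof -
      have "norm (f x) \<le> \<bar>g x\<bar> + \<bar>g (smul i x)\<bar>"
        unfolding f_def using norm_triangle_ineq4[of "of_real (g x)" "i * of_real (g (smul i x))"]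
        by (simp add: norm_mult ni)
      also have "\<dots> \<le> nrm x + nrm x"
        using g(3)[OF x] g(3)[OF scale_mem[OF x], of i] x by (simp add: nrm_scale ni)
      finally show ?thesis by simp
    qed
    have f_u: "nrm u / 2 \<le> norm (f u)"
      using norm_real_add_unit_ge[OF 2(1), of "g u" "- g (smul i u)"] nrm_nonneg[OF u]
      by (simp add: f_def g(4) mult.commute)
    show ?thesis
    proof (cases "u = 0")
      case True
      show ?thesis
        by (rule that[of "\<lambda>_. 0"]) (auto simp: functional_on_def True nrm_nonneg)
    next
      case False
      hence nu: "nrm u > 0" using nrm_nonneg[OF u] nrm_eq_0_iff[OF u] by linarith
      hence fu: "f u \<noteq> 0" using f_u by auto
      show ?thesis
      proof (rule that[of "\<lambda>x. f x * (of_real (nrm u) / f u)"])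
        show "functional_on V (\<lambda>x. f x * (of_real (nrm u) / f u))"
          by (simp add: functional_on_def f_add f_scale distrib_right add_divide_distrib mult.assoc)
        show "norm (f x * (of_real (nrm u) / f u)) \<le> 4 * nrm x" if x: "x \<in> V" for x
        proof -
          have "norm (f x * (of_real (nrm u) / f u)) = norm (f x) * (nrm u / norm (f u))"
            using nu by (simp add: norm_mult norm_divide)
          also have "\<dots> \<le> (2 * nrm x) * 2"
            using f_le[OF x] f_u nu fu nrm_nonneg[OF x]
            by (intro mult_mono) (auto simp: field_simps)
          finally show ?thesis by simp
        qed
        show "f u * (of_real (nrm u) / f u) = of_real (nrm u)" using fu by simp
      qed
    qed
  qed
qed

end

sublocale banach_space_on \<subseteq> normed_space_on smul V nrm
  using carrier_subspace norm_nonneg norm_eq_zero_iff norm_scale norm_triangle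
  by unfold_locales auto

lemma (in banach_space_on) Cauchy_imp_limit:
  assumes s: "\<And>n. s n \<in> V"
    and Cauchy: "\<And>e. e > 0 \<Longrightarrow> \<exists>N. \<forall>m\<ge>N. \<forall>n\<ge>N. nrm (s m - s n) < e"
  obtains l where "l \<in> V" "(\<lambda>n. nrm (s n - l)) \<longlonglongrightarrow> 0"
proof -
  interpret Metric_space V "ndist V nrm" by (rule metric)
  have "MCauchy s"
    using s Cauchy by (fastforce simp: MCauchy_def ndist_def)
  with complete obtain l where l: "limitin mtopology s l sequentially"
    by (auto simp: mcomplete_def)
  hence "l \<in> V" "(\<lambda>n. ndist V nrm (s n) l) \<longlonglongrightarrow> 0"
    by (auto simp: limitin_metric_dist_null)
  thus ?thesis using that s by (simp add: ndist_def)
qed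

lemma banach_space_onI:
  fixes smul :: "'k::{real_normed_field, banach} \<Rightarrow> 'v::ab_group_add \<Rightarrow> 'v"
  assumes "normed_space_on smul V nrm"
    and complete: "\<And>s. (\<And>n. s n \<in> V) \<Longrightarrow>
      (\<And>e. e > 0 \<Longrightarrow> \<exists>N. \<forall>m\<ge>N. \<forall>n\<ge>N. nrm (s m - s n) < e) \<Longrightarrow>
      \<exists>l\<in>V. (\<lambda>n. nrm (s n - l)) \<longlonglongrightarrow> 0"
  shows "banach_space_on smul V nrm"
proof -
  interpret normed_space_on smul V nrm by fact
  interpret M: Metric_space V "ndist V nrm" by (rule metric)
  have "M.mcomplete"
    unfolding M.mcomplete_def
  proof (intro allI impI)
    fix s assume s: "M.MCauchy s"
    hence sV: "s n \<in> V" for n by (auto simp: M.MCauchy_def)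
    have "\<exists>N. \<forall>m\<ge>N. \<forall>n\<ge>N. nrm (s m - s n) < e" if "e > 0" for e
      using s that sV by (simp add: M.MCauchy_def ndist_def)
    then obtain l where l: "l \<in> V" "(\<lambda>n. nrm (s n - l)) \<longlonglongrightarrow> 0"
      using complete[of s] sV by blast
    hence "limitin M.mtopology s l sequentially"
      using sV by (simp add: M.limitin_metric_dist_null ndist_def)
    thus "\<exists>x. limitin M.mtopology s x sequentially" by blast
  qed
  thus ?thesis
    using subspace_V nrm_nonneg nrm_eq_0_iff nrm_scale nrm_triangle
    by unfold_locales
qed

section \<open>Infinite-dimensional subspaces and small seminorms\<close>

lemma null_sequence_squeeze:
  fixes f g :: "nat \<Rightarrow> real"
  assumes "\<And>n. 0 \<le> f n" "\<And>n. f n \<le> g n" "g \<longlonglongrightarrow> 0"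
  shows "f \<longlonglongrightarrow> 0"
  by (rule tendsto_sandwich[OF _ _ tendsto_const assms(3)]) (use assms in auto)

context vector_space
begin

lemma in_span_range_imp_sum:
  fixes x :: "nat \<Rightarrow> 'b"
  assumes "y \<in> span (range x)"
  obtains n a where "y = (\<Sum>i<n. scale (a i) (x i))"
proof -
  define S where "S = {y. \<exists>n a. (\<forall>i\<ge>n. a i = 0) \<and> y = (\<Sum>i<n. scale (a i) (x i))}"
  have extend: "(\<Sum>i<n. scale (a i) (x i)) = (\<Sum>i<N. scale (a i) (x i))"
    if "\<forall>i\<ge>n. a i = 0" "n \<le> N" for a and n N :: nat
    using that by (intro sum.mono_neutral_left) auto
  have "subspace S"
  proof (rule subspaceI)
    show "0 \<in> S" unfolding S_def by (intro CollectI exI[of _ 0] exI[of _ "\<lambda>_. 0"]) auto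
  next
    fix y z assume "y \<in> S" "z \<in> S"
    then obtain m a n b where
      y: "\<forall>i\<ge>m. a i = 0" "y = (\<Sum>i<m. scale (a i) (x i))" and
      z: "\<forall>i\<ge>n. b i = 0" "z = (\<Sum>i<n. scale (b i) (x i))"
      unfolding S_def by blast
    have "y + z = (\<Sum>i<max m n. scale (a i + b i) (x i))"
      using y z extend[of m a "max m n"] extend[of n b "max m n"]
      by (simp add: scale_left_distrib sum.distrib)
    thus "y + z \<in> S"
      unfolding S_def using y z
      by (intro CollectI exI[of _ "max m n"] exI[of _ "\<lambda>i. a i + b i"]) auto
  next
    fix c y assume "y \<in> S"
    then obtain m a where y: "\<forall>i\<ge>m. a i = 0" "y = (\<Sum>i<m. scale (a i) (x i))"
      unfolding S_def by blast
    thus "scale c y \<in> S"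
      unfolding S_def
      by (intro CollectI exI[of _ m] exI[of _ "\<lambda>i. c * a i"]) (auto simp: scale_sum_right)
  qed
  moreover have "x j \<in> S" for j
    unfolding S_def
    by (intro CollectI exI[of _ "Suc j"] exI[of _ "\<lambda>i. if i = j then 1 else 0"])
       (auto simp: if_distrib[of "\<lambda>c. scale c _"] if_distribR sum.If_cases cong: if_cong)
  ultimately have "span (range x) \<subseteq> S" by (intro span_minimal) auto
  with assms that show ?thesis unfolding S_def by blast
qed

lemma not_finite_dim_sequence:
  fixes x :: "nat \<Rightarrow> 'b"
  assumes indep: "\<And>n a i. (\<Sum>i<n. scale (a i) (x i)) = 0 \<Longrightarrow> i < n \<Longrightarrow> a i = 0"
    and M: "range x \<subseteq> M"
  shows "\<not> finite_dim scale M"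
proof
  assume "finite_dim scale M"
  then obtain B where B: "finite B" "M \<subseteq> span B"
    unfolding finite_dim_def by blast
  have "inj x"
  proof (rule injI, rule ccontr)
    fix i j assume ij: "x i = x j" "i \<noteq> j"
    define a :: "nat \<Rightarrow> 'a" where "a k = (if k = i then 1 else if k = j then - 1 else 0)" for k
    have "(\<Sum>k<Suc (i + j). scale (a k) (x k)) = (\<Sum>k\<in>{i, j}. scale (a k) (x k))"
      by (rule sum.mono_neutral_right) (auto simp: a_def)
    also have "\<dots> = 0" using ij by (simp add: a_def)
    finally have "a i = 0" by (rule indep) simp
    thus False by (simp add: a_def)
  qed
  have "independent (range x)"
  proof
    assume "dependent (range x)"
    then obtain t u v where t: "finite t" "t \<subseteq> range x" "(\<Sum>v\<in>t. scale (u v) v) = 0"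
      "v \<in> t" "u v \<noteq> 0"
      unfolding dependent_explicit by blast
    obtain I where I: "finite I" "t = x ` I"
      using t(1,2) by (metis finite_subset_image)
    then obtain n where n: "I \<subseteq> {..<n}" using finite_nat_iff_bounded by blast
    define a where "a i = (if i \<in> I then u (x i) else 0)" for i
    have "(\<Sum>i<n. scale (a i) (x i)) = (\<Sum>i\<in>I. scale (a i) (x i))"
      using n by (intro sum.mono_neutral_right) (auto simp: a_def)
    also have "\<dots> = (\<Sum>i\<in>I. scale (u (x i)) (x i))" by (simp add: a_def)
    also have "\<dots> = (\<Sum>v\<in>t. scale (u v) v)"
      using \<open>inj x\<close> by (simp add: I sum.reindex inj_on_subset)
    finally have "(\<Sum>i<n. scale (a i) (x i)) = 0" using t by simp
    moreover obtain i where "i \<in> I" "v = x i" using t(4) I by blast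
    ultimately have "u v = 0" using indep[where n = n and a = a and i = i] n by (auto simp: a_def)
    with t show False by simp
  qed
  moreover have "range x \<subseteq> span B" using M B by blast
  ultimately have "finite (range x)"
    using independent_span_bound[OF B(1)] by blast
  thus False using finite_imageD[OF _ \<open>inj x\<close>] by auto
qed

lemma finite_dim_of_kernel:
  assumes M: "subspace M"
    and f: "\<And>x y. x \<in> M \<Longrightarrow> y \<in> M \<Longrightarrow> f (x + y) = f x + f y"
      "\<And>c x. x \<in> M \<Longrightarrow> f (scale c x) = c * f x"
    and ker: "finite_dim scale {x \<in> M. f x = 0}"
  shows "finite_dim scale M"
proof (cases "\<exists>x0\<in>M. f x0 \<noteq> 0")
  case False
  hence "{x \<in> M. f x = 0} = M" by auto
  with ker show ?thesis by simp
next
  case True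
  then obtain x0 where x0: "x0 \<in> M" "f x0 \<noteq> 0" by blast
  obtain B where B: "finite B" "B \<subseteq> {x \<in> M. f x = 0}" "{x \<in> M. f x = 0} \<subseteq> span B"
    using ker unfolding finite_dim_def by blast
  have "M \<subseteq> span (insert x0 B)"
  proof
    fix x assume x: "x \<in> M"
    have "x + scale (- (f x / f x0)) x0 \<in> {x \<in> M. f x = 0}"
      using x x0 f M by (simp add: subspace_add subspace_scale subspace_neg f del: scale_minus_left)
    hence "x + scale (- (f x / f x0)) x0 \<in> span (insert x0 B)"
      using B(3) span_mono[of B "insert x0 B"] by blast
    moreover have "scale (f x / f x0) x0 \<in> span (insert x0 B)"
      by (intro span_scale span_base) simp
    ultimately have "x + scale (- (f x / f x0)) x0 + scale (f x / f x0) x0 \<in> span (insert x0 B)"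
      by (rule span_add)
    thus "x \<in> span (insert x0 B)" by simp
  qed
  moreover have "insert x0 B \<subseteq> M" using x0 B by auto
  ultimately show ?thesis
    unfolding finite_dim_def using B(1) by (intro exI[of _ "insert x0 B"]) auto
qed

end

context normed_space_on
begin

lemma functional_on_add: "functional_on W f \<Longrightarrow> x \<in> W \<Longrightarrow> y \<in> W \<Longrightarrow> f (x + y) = f x + f y"
  and functional_on_scale: "functional_on W f \<Longrightarrow> x \<in> W \<Longrightarrow> f (smul c x) = c * f x"
  by (auto simp: functional_on_def)

lemma functional_on_sum:
  assumes f: "functional_on V f" and x: "\<And>i. i \<in> I \<Longrightarrow> x i \<in> V"
  shows "f (\<Sum>i\<in>I. smul (a i) (x i)) = (\<Sum>i\<in>I. a i * f (x i))"
  using x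
proof (induction I rule: infinite_finite_induct)
  case (insert i I)
  thus ?case
    using f by (simp add: functional_on_add functional_on_scale mem_simps)
qed (use functional_on_scale[OF f, of 0 0] in auto)

lemma nrm_scaled_sum_le:
  assumes x: "\<And>i. i \<in> I \<Longrightarrow> x i \<in> V"
  shows "nrm (\<Sum>i\<in>I. smul (a i) (x i)) \<le> (\<Sum>i\<in>I. norm (a i) * nrm (x i))"
proof -
  have "nrm (\<Sum>i\<in>I. smul (a i) (x i)) \<le> (\<Sum>i\<in>I. nrm (smul (a i) (x i)))"
    using x by (intro nrm_sum_le scale_mem)
  also have "\<dots> = (\<Sum>i\<in>I. norm (a i) * nrm (x i))"
    using x by (intro sum.cong) (auto simp: nrm_scale)
  finally show ?thesis .
qed

text \<open>
  Solving the triangular system for the coefficients one after another gives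
  \<open>norm (a j) \<le> 4 * nrm y + (\<Sum>i<j. 4 * norm (a i))\<close>, and \<open>4 * 5 ^ j\<close> solves the corresponding recurrence.
\<close>

lemma triangular_coefficient_bound:
  assumes x: "\<And>i. x i \<in> V" "\<And>i. nrm (x i) = 1"
    and f: "\<And>j. functional_on V (f j)" "\<And>j y. y \<in> V \<Longrightarrow> norm (f j y) \<le> 4 * nrm y"
    and diag: "\<And>j. f j (x j) = 1" and upper: "\<And>i j. i > j \<Longrightarrow> f j (x i) = 0"
    and j: "j < n"
  shows "norm (a j) \<le> 4 * 5 ^ j * nrm (\<Sum>i<n. smul (a i) (x i))"
  using j
proof (induction j rule: less_induct)
  case (less j)
  define y where "y = (\<Sum>i<n. smul (a i) (x i))"
  have y: "y \<in> V" using x by (auto simp: y_def mem_simps)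
  have "f j y = (\<Sum>i<n. a i * f j (x i))"
    unfolding y_def using x f by (intro functional_on_sum) auto
  also have "\<dots> = (\<Sum>i\<le>j. a i * f j (x i))"
    using less.prems upper by (intro sum.mono_neutral_right) auto
  also have "\<dots> = (\<Sum>i<j. a i * f j (x i)) + a j"
    using diag by (simp add: lessThan_Suc_atMost[symmetric])
  finally have "a j = f j y - (\<Sum>i<j. a i * f j (x i))" by simp
  hence "norm (a j) \<le> norm (f j y) + norm (\<Sum>i<j. a i * f j (x i))"
    by (simp add: norm_triangle_ineq4)
  also have "norm (\<Sum>i<j. a i * f j (x i)) \<le> (\<Sum>i<j. (4 * 5 ^ i * nrm y) * 4)"
  proof (rule sum_norm_le)
    fix i assume i: "i \<in> {..<j}"
    have "norm (a i) \<le> 4 * 5 ^ i * nrm y" using less i by (simp add: y_def)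
    moreover have "norm (f j (x i)) \<le> 4" using f(2)[OF x(1), of j i] x(2)[of i] by simp
    ultimately show "norm (a i * f j (x i)) \<le> (4 * 5 ^ i * nrm y) * 4"
      unfolding norm_mult using nrm_nonneg[OF y] by (intro mult_mono) auto
  qed
  also have "(\<Sum>i<j. (4 * 5 ^ i * nrm y) * 4) = (5 ^ j - 1) * (4 * nrm y)"
    by (induction j) (simp_all add: algebra_simps)
  also have "norm (f j y) \<le> 4 * nrm y" using f y by blast
  finally show ?case by (simp add: y_def algebra_simps)
qed

text \<open>
  Choose unit vectors \<open>x n\<close> with rapidly decreasing \<open>T (x n)\<close>, each in the common kernel of functionals
  \<open>f i\<close>, \<open>i < n\<close>, that norm the earlier vectors.  Such vectors exist, because the common kernel is
  infinite-dimensional and \<open>T\<close> does not dominate the norm there.  On the span of the \<open>x n\<close> the coefficients are controlled by the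
  norm with constants \<open>4 * 5 ^ n\<close> that do not depend on the choices, so \<open>T\<close> is small on the whole span.
\<close>

lemma small_seminorm_subspace:
  assumes M: "subspace M" "M \<subseteq> V" "\<not> finite_dim smul M"
    and T_nonneg: "\<And>x. x \<in> V \<Longrightarrow> T x \<ge> 0"
    and T_add: "\<And>x y. x \<in> V \<Longrightarrow> y \<in> V \<Longrightarrow> T (x + y) \<le> T x + T y"
    and T_scale: "\<And>c x. x \<in> V \<Longrightarrow> T (smul c x) = norm c * T x"
    and unbounded: "\<And>W c. subspace W \<Longrightarrow> W \<subseteq> M \<Longrightarrow> \<not> finite_dim smul W \<Longrightarrow>
      \<exists>x\<in>W. c * T x < nrm x"
    and e: "e > 0"
  obtains W where "subspace W" "W \<subseteq> M" "\<not> finite_dim smul W" "\<And>x. x \<in> W \<Longrightarrow> T x \<le> e * nrm x"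
proof -
  (* This makes the sum of 4 * 5 ^ n * d n at most e. *)
  define d where "d n = e / (8 * 10 ^ n)" for n :: nat
  have d: "d n > 0" for n using e by (simp add: d_def)
  define good where "good n = (\<lambda>(W, x, f). subspace W \<and> W \<subseteq> M \<and> \<not> finite_dim smul W \<and> x \<in> W \<and> nrm x = 1 \<and>
      T x \<le> d n \<and> functional_on V f \<and> (\<forall>y\<in>V. norm (f y) \<le> 4 * nrm y) \<and> f x = 1)" for n
  have step: "\<exists>x f. good n (W, x, f)" if W: "subspace W" "W \<subseteq> M" "\<not> finite_dim smul W" for W n
  proof -
    obtain x0 where x0: "x0 \<in> W" "(1 / d n) * T x0 < nrm x0" using unbounded[OF W] by blast
    have V: "x0 \<in> V" using x0 W M by blast
    have "(1 / d n) * T x0 \<ge> 0" using T_nonneg[OF V] d[of n] by simp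
    with x0 have nx0: "nrm x0 > 0" by linarith
    define x where "x = smul (of_real (1 / nrm x0)) x0"
    have x: "x \<in> W" "x \<in> V" "nrm x = 1"
      unfolding x_def using x0 W V nx0 by (auto simp: subspace_scale scale_mem nrm_scale_real simp del: of_real_divide)
    have "T x = T x0 / nrm x0" using T_scale[OF V] nx0 by (simp add: x_def norm_divide)
    also have "\<dots> \<le> d n" using x0(2) nx0 d[of n] by (simp add: field_simps)
    finally have "T x \<le> d n" .
    moreover obtain f where "functional_on V f" "\<And>y. y \<in> V \<Longrightarrow> norm (f y) \<le> 4 * nrm y" "f x = of_real (nrm x)"
      using Hahn_Banach_functional[OF x(2)] by blast
    ultimately show ?thesis using W x by (auto simp: good_def)
  qed
  have "\<exists>s. \<forall>n. good n (s n) \<and> fst (s (Suc n)) = {y \<in> fst (s n). snd (snd (s n)) y = 0}"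
  proof (rule dependent_nat_choice)
    show "\<exists>s. good 0 s" using step[OF M(1) _ M(3)] by blast
  next
    fix s n assume s: "good n s"
    obtain W x f where s_eq: "s = (W, x, f)" by (cases s)
    define W' where "W' = {y \<in> W. f y = 0}"
    have W: "subspace W" "W \<subseteq> M" "\<not> finite_dim smul W" and f: "functional_on V f"
      using s by (auto simp: good_def s_eq)
    have add: "f (x + y) = f x + f y" and scale: "f (smul c x) = c * f x" if "x \<in> W" "y \<in> W" for x y c
      using that W(2) M(2) f by (auto simp: functional_on_def subset_iff)
    have "subspace W'"
      using W(1) add scale scale[of 0 0 0]
      by (intro subspaceI) (auto simp: W'_def subspace_0 subspace_add subspace_scale)
    moreover have "\<not> finite_dim smul W'"
      using finite_dim_of_kernel[OF W(1), of f] add scale W(3) unfolding W'_def by blast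
    ultimately obtain x' f' where "good (Suc n) (W', x', f')"
      using step[of W' "Suc n"] W(2) by (auto simp: W'_def)
    thus "\<exists>s'. good (Suc n) s' \<and> fst s' = {y \<in> fst s. snd (snd s) y = 0}"
      by (intro exI[of _ "(W', x', f')"]) (simp add: s_eq W'_def)
  qed
  then obtain s where s: "\<And>n. good n (s n)"
    "\<And>n. fst (s (Suc n)) = {y \<in> fst (s n). snd (snd (s n)) y = 0}" by blast
  define W where "W n = fst (s n)" for n
  define x where "x n = fst (snd (s n))" for n
  define f where "f n = snd (snd (s n))" for n
  have good: "W n \<subseteq> M" "x n \<in> W n" "nrm (x n) = 1" "T (x n) \<le> d n" "functional_on V (f n)"
    "y \<in> V \<Longrightarrow> norm (f n y) \<le> 4 * nrm y" "f n (x n) = 1" for n y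
    using s(1)[of n] by (auto simp: good_def W_def x_def f_def split: prod.splits)
  have W_Suc: "W (Suc n) = {y \<in> W n. f n y = 0}" for n using s(2) by (simp add: W_def f_def)
  have W_mono: "W n \<subseteq> W m" if "m \<le> n" for m n
    using that by (induction rule: dec_induct) (auto simp: W_Suc)
  have xM: "x n \<in> M" and xV: "x n \<in> V" for n using good(1,2) M(2) by blast+
  have upper: "f j (x i) = 0" if "i > j" for i j
    using W_mono[of "Suc j" i] good(2)[of i] that by (auto simp: W_Suc)
  have coeff: "norm (a j) \<le> 4 * 5 ^ j * nrm (\<Sum>i<n. smul (a i) (x i))" if "j < n" for a j n
    using that xV good upper by (intro triangular_coefficient_bound[where f = f]) auto
  show ?thesis
  proof (rule that)
    show "subspace (span (range x))" by (rule subspace_span)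
    show "span (range x) \<subseteq> M" using xM M(1) by (intro span_minimal) auto
    show "\<not> finite_dim smul (span (range x))"
    proof (rule not_finite_dim_sequence)
      show "range x \<subseteq> span (range x)" by (rule span_superset)
      show "a i = 0" if "(\<Sum>i<n. smul (a i) (x i)) = 0" "i < n" for a n i
        using coeff[OF that(2), of a] that(1) by simp
    qed
    fix y assume "y \<in> span (range x)"
    then obtain n a where y: "y = (\<Sum>i<n. smul (a i) (x i))" using in_span_range_imp_sum by blast
    have yV: "y \<in> V" unfolding y using xV by (auto simp: mem_simps)
    have "T (\<Sum>i<m. smul (a i) (x i)) \<le> (\<Sum>i<m. norm (a i) * T (x i))" for m
    proof (induction m)
      case 0
      show ?case using T_scale[of 0 0] by simp
    next
      case (Suc m)
      thus ?case
        using T_add[of "\<Sum>i<m. smul (a i) (x i)" "smul (a m) (x m)"] xV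
        by (simp add: T_scale mem_simps)
    qed
    hence "T y \<le> (\<Sum>i<n. norm (a i) * T (x i))" by (simp add: y)
    also have "\<dots> \<le> (\<Sum>i<n. (4 * 5 ^ i * nrm y) * d i)"
      using coeff good(4) T_nonneg[OF xV] nrm_nonneg[OF yV] by (intro sum_mono mult_mono) (auto simp: y)
    also have "\<dots> = (\<Sum>i<n. (1 / 2) ^ i) * (e / 2 * nrm y)"
    proof -
      have "(4 * 5 ^ i * nrm y) * d i = (1 / 2) ^ i * (e / 2 * nrm y)" for i
      proof -
        have "(10 :: real) ^ i = 2 ^ i * 5 ^ i" by (simp flip: power_mult_distrib)
        thus ?thesis by (simp add: d_def power_one_over field_simps)
      qed
      thus ?thesis by (simp only: sum_distrib_right)
    qed
    also have "\<dots> \<le> 2 * (e / 2 * nrm y)"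
    proof (rule mult_right_mono)
      show "(\<Sum>i<n. (1 / 2) ^ i) \<le> (2 :: real)" by (simp add: sum_gp_strict)
    qed (use e nrm_nonneg[OF yV] in auto)
    finally show "T y \<le> e * nrm y" by simp
  qed
qed

end

context banach_space_on
begin

section \<open>Complementation by perturbation\<close>

text \<open>
  The restriction of \<open>L\<close> to \<open>N\<close> is invertible by a Neumann series argument, and the inverse of this restriction composed with \<open>L\<close> is a
  projection onto \<open>N\<close>.  Instead of summing the series one solves \<open>L z = L v\<close> for \<open>z \<in> N\<close> as the fixed point
  equation of the contraction \<open>z \<mapsto> z - L z + L v\<close>.
\<close>

lemma complemented_of_near_identity:
  assumes N: "subspace N" "N \<subseteq> V" "near_closed N"
    and L_mem: "\<And>v. v \<in> V \<Longrightarrow> L v \<in> N"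
    and L_add: "\<And>v w. v \<in> V \<Longrightarrow> w \<in> V \<Longrightarrow> L (v + w) = L v + L w"
    and L_scale: "\<And>c v. v \<in> V \<Longrightarrow> L (smul c v) = smul c (L v)"
    and L_bound: "\<And>v. v \<in> V \<Longrightarrow> nrm (L v) \<le> K * nrm v"
    and near: "\<And>z. z \<in> N \<Longrightarrow> nrm (L z - z) \<le> t * nrm z" and t: "0 \<le> t" "t < 1"
  shows "complemented_in smul V nrm N"
proof -
  have NV: "z \<in> V" if "z \<in> N" for z using that N by blast
  have L_V: "L v \<in> V" if "v \<in> V" for v using L_mem[OF that] NV by blast
  have L_diff: "L (v - w) = L v - L w" if "v \<in> V" "w \<in> V" for v w
    using L_add[of "v - w" w] that by (simp add: mem_simps)
  have unique: "z = z'" if z: "z \<in> N" "z' \<in> N" "L z = L z'" for z z'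
  proof -
    have zz: "z - z' \<in> N" "z - z' \<in> V" using z N by (auto simp: subspace_diff)
    have "nrm (z - z') \<le> t * nrm (z - z')"
      using near[OF zz(1)] z zz nrm_minus_commute[of z z'] by (simp add: L_diff NV)
    hence "(1 - t) * nrm (z - z') \<le> 0" by (simp add: algebra_simps)
    hence "nrm (z - z') \<le> 0" using t by (simp add: mult_le_0_iff)
    thus ?thesis using nrm_nonneg[OF zz(2)] nrm_eq_0_iff[OF zz(2)] by simp
  qed
  have exist: "\<exists>z\<in>N. L z = L v" if v: "v \<in> V" for v
  proof -
    define z where "z n = ((\<lambda>z. z - L z + L v) ^^ n) 0" for n
    have z_0: "z 0 = 0" and z_Suc: "z (Suc n) = z n - L (z n) + L v" for n
      by (simp_all add: z_def)
    have zN: "z n \<in> N" for n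
    proof (induction n)
      case 0
      show ?case using N(1) by (simp add: z_0 subspace_0)
    next
      case (Suc n)
      thus ?case using L_mem[OF v] L_mem[OF NV] N(1) by (simp add: z_Suc subspace_add subspace_diff)
    qed
    have zV: "z n \<in> V" for n using zN NV by blast
    have contract: "nrm (z (n + k) - z n) \<le> t ^ n * nrm (z k)" for n k
    proof (induction n)
      case 0
      show ?case by (simp add: z_0)
    next
      case (Suc n)
      have "z (Suc n + k) - z (Suc n) = - (L (z (n + k) - z n) - (z (n + k) - z n))"
        using zV by (simp add: z_Suc L_diff)
      hence "nrm (z (Suc n + k) - z (Suc n)) = nrm (L (z (n + k) - z n) - (z (n + k) - z n))"
        using zV nrm_minus_commute[of "L (z (n + k) - z n)" "z (n + k) - z n"] by (simp add: mem_simps L_V)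
      also have "\<dots> \<le> t * nrm (z (n + k) - z n)"
        using zN N(1) by (intro near) (auto simp: subspace_diff)
      also have "\<dots> \<le> t * (t ^ n * nrm (z k))"
        using Suc t by (intro mult_left_mono) auto
      finally show ?case by simp
    qed
    define c where "c = nrm (L v)"
    have c: "c \<ge> 0" using nrm_nonneg L_V[OF v] by (simp add: c_def)
    have z_bound: "nrm (z k) \<le> c / (1 - t)" for k
    proof (induction k)
      case 0
      show ?case using c t by (simp add: z_0)
    next
      case (Suc k)
      have "z (Suc k) = - (L (z k) - z k) + L v" by (simp add: z_Suc)
      hence "nrm (z (Suc k)) \<le> nrm (L (z k) - z k) + c"
        using nrm_triangle[of "- (L (z k) - z k)" "L v"] nrm_minus_commute[of "L (z k)" "z k"] zV v
        by (simp add: c_def mem_simps L_V)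
      also have "\<dots> \<le> t * (c / (1 - t)) + c"
        using near[OF zN[of k]] mult_left_mono[OF Suc t(1)] by simp
      also have "\<dots> = c / (1 - t)" using t by (simp add: field_simps)
      finally show ?case .
    qed
    have close: "nrm (z (n + k) - z n) \<le> t ^ n * (c / (1 - t))" for n k
      using contract[of n k] mult_left_mono[OF z_bound[of k], of "t ^ n"] t by simp
    have lim0: "(\<lambda>n. t ^ n * (c / (1 - t))) \<longlonglongrightarrow> 0"
      using t by (intro tendsto_mult_left_zero LIMSEQ_realpow_zero) auto
    obtain l where l: "l \<in> V" "(\<lambda>n. nrm (z n - l)) \<longlonglongrightarrow> 0"
    proof (rule Cauchy_imp_limit[of z])
      fix e :: real assume "e > 0"
      hence "\<forall>\<^sub>F n in sequentially. t ^ n * (c / (1 - t)) < e / 2"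
        by (intro order_tendstoD(2)[OF lim0]) simp
      then obtain N0 where N0: "t ^ N0 * (c / (1 - t)) < e / 2"
        using eventually_happens'[OF sequentially_bot] by blast
      have "nrm (z m - z n) < e" if "m \<ge> N0" "n \<ge> N0" for m n
      proof -
        have "nrm (z m - z n) \<le> nrm (z m - z N0) + nrm (z n - z N0)"
          using nrm_diff_triangle[of "z m" "z N0" "z n"] zV nrm_minus_commute[of "z N0" "z n"] by simp
        moreover have "nrm (z m - z N0) \<le> t ^ N0 * (c / (1 - t))" "nrm (z n - z N0) \<le> t ^ N0 * (c / (1 - t))"
          using close[of N0 "m - N0"] close[of N0 "n - N0"] that by simp_all
        ultimately show ?thesis using N0 by linarith
      qed
      thus "\<exists>N0. \<forall>m\<ge>N0. \<forall>n\<ge>N0. nrm (z m - z n) < e" by blast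
    qed (use zV in auto)
    have lN: "l \<in> N" using near_closed_limit[OF N(3) zN l] .
    have "nrm (L l - L v) \<le> K * nrm (z n - l) + (nrm (z (Suc n) - l) + nrm (z n - l))" for n
    proof -
      have "L l - L v = (- L (z n - l)) + (L (z n) - L v)"
        using zV l by (simp add: L_diff)
      also have "L (z n) - L v = z n - z (Suc n)" by (simp add: z_Suc)
      finally have "nrm (L l - L v) \<le> nrm (L (z n - l)) + nrm (z n - z (Suc n))"
        using nrm_triangle[of "- L (z n - l)" "z n - z (Suc n)"] zV l
        by (simp add: nrm_uminus mem_simps L_V)
      moreover have "nrm (z n - z (Suc n)) \<le> nrm (z n - l) + nrm (z (Suc n) - l)"
        using nrm_diff_triangle[of "z n" l "z (Suc n)"] nrm_minus_commute[of l "z (Suc n)"] zV l by simp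
      moreover have "nrm (L (z n - l)) \<le> K * nrm (z n - l)" using zV l by (intro L_bound) (simp add: mem_simps)
      ultimately show ?thesis by linarith
    qed
    moreover have "(\<lambda>n. K * nrm (z n - l) + (nrm (z (Suc n) - l) + nrm (z n - l))) \<longlonglongrightarrow> K * 0 + (0 + 0)"
      using l(2) by (intro tendsto_intros LIMSEQ_Suc)
    ultimately have "nrm (L l - L v) \<le> 0"
      by (intro tendsto_lowerbound[where F = sequentially]) auto
    hence "L l = L v"
      using l(1) v nrm_nonneg[of "L l - L v"] nrm_eq_0_iff[of "L l - L v"] by (simp add: mem_simps L_V)
    with lN show ?thesis by blast
  qed
  define P where "P v = (THE z. z \<in> N \<and> L z = L v)" for v
  have P: "P v \<in> N \<and> L (P v) = L v" if v: "v \<in> V" for v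
  proof -
    obtain z where z: "z \<in> N" "L z = L v" using exist[OF v] by blast
    show ?thesis
      unfolding P_def
    proof (rule theI[of "\<lambda>z. z \<in> N \<and> L z = L v"])
      show "z \<in> N \<and> L z = L v" using z by blast
      show "y = z" if "y \<in> N \<and> L y = L v" for y
        by (rule unique) (use that z in simp_all)
    qed
  qed
  have P_eq: "P v = z" if "z \<in> N" "L z = L v" "v \<in> V" for v z
    using P[OF that(3)] that unique by metis
  have "linear_on smul V V P"
    unfolding linear_on_def using P NV N(1)
    by (auto intro!: P_eq simp: L_add L_scale subspace_add subspace_scale mem_simps)
  moreover have "nrm (P v) \<le> K / (1 - t) * nrm v" if v: "v \<in> V" for v
  proof -
    have PV: "P v \<in> V" using P[OF v] NV by blast
    have "nrm (P v) \<le> nrm (L (P v)) + nrm (L (P v) - P v)"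
      using nrm_diff_le[of "L (P v)" "L (P v) - P v"] PV by (simp add: mem_simps L_V)
    also have "\<dots> \<le> K * nrm v + t * nrm (P v)"
      using P[OF v] L_bound[OF v] near[of "P v"] by simp
    finally have "(1 - t) * nrm (P v) \<le> K * nrm v" by (simp add: algebra_simps)
    thus ?thesis using t by (simp add: field_simps)
  qed
  moreover have "P z = z" if "z \<in> N" for z using P_eq that NV by blast
  moreover have "P ` V = N"
  proof
    show "P ` V \<subseteq> N" using P by blast
    show "N \<subseteq> P ` V"
    proof
      fix z assume "z \<in> N"
      hence "z = P z" "z \<in> V" using P_eq[of z z] NV by simp_all
      thus "z \<in> P ` V" by (rule image_eqI)
    qed
  qed
  ultimately show ?thesis
    unfolding complemented_in_def bounded_linear_on_def using P by blast
qed

lemma limit_unique: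
  assumes "\<And>n. s n \<in> V" "l \<in> V" "l' \<in> V"
    and "(\<lambda>n. nrm (s n - l)) \<longlonglongrightarrow> 0" "(\<lambda>n. nrm (s n - l')) \<longlonglongrightarrow> 0"
  shows "l = l'"
proof -
  have "nrm (l - l') \<le> nrm (s n - l) + nrm (s n - l')" for n
    using nrm_diff_triangle[of l "s n" l'] nrm_minus_commute[of l "s n"] assms by simp
  moreover have "(\<lambda>n. nrm (s n - l) + nrm (s n - l')) \<longlonglongrightarrow> 0 + 0"
    using assms by (intro tendsto_add)
  ultimately have "nrm (l - l') \<le> 0"
    by (intro tendsto_lowerbound[where F = sequentially]) auto
  thus ?thesis
    using nrm_nonneg[of "l - l'"] nrm_eq_0_iff[of "l - l'"] assms by (simp add: mem_simps)
qed

text \<open>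
  The operator \<open>L v = (\<Sum>k. g k v \<cdot> x k)\<close> maps \<open>w = (\<Sum>l. a l \<cdot> u l)\<close> to \<open>z = (\<Sum>l. a l \<cdot> x l)\<close>.  The
  functionals bound the coefficients \<open>a l\<close> by \<open>C * nrm w\<close>, so \<open>z - w\<close> is small compared with \<open>w\<close> and hence
  with \<open>z\<close>; therefore \<open>L z - z = L (z - w)\<close> is small as well, and \<open>L\<close> is nearly the identity on the closed span of the \<open>x k\<close>.
\<close>

lemma perturbed_biorthogonal_complemented:
  fixes x u :: "nat \<Rightarrow> 'v"
  assumes M: "subspace M" "M \<subseteq> V" "near_closed M"
    and x: "\<And>k. x k \<in> M" and u: "\<And>k. u k \<in> V"
    and g: "\<And>k. functional_on V (g k)" "\<And>k v. v \<in> V \<Longrightarrow> norm (g k v) \<le> C * nrm v"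
    and biorth: "\<And>k l. g k (u l) = (if k = l then 1 else 0)"
    and bound: "\<And>n v. v \<in> V \<Longrightarrow> nrm (\<Sum>k<n. smul (g k v) (x k)) \<le> K * nrm v"
    and Cauchy: "\<And>v e. v \<in> V \<Longrightarrow> e > 0 \<Longrightarrow> \<exists>N. \<forall>m\<ge>N. \<forall>n\<ge>N.
      nrm ((\<Sum>k<m. smul (g k v) (x k)) - (\<Sum>k<n. smul (g k v) (x k))) < e"
    and pert: "\<And>n. (\<Sum>k<n. nrm (x k - u k)) \<le> \<sigma>"
    and small: "0 \<le> C" "0 \<le> K" "C * \<sigma> \<le> 1 / 2" "K * C * \<sigma> \<le> 1 / 4"
  shows "\<exists>N. subspace N \<and> N \<subseteq> M \<and> \<not> finite_dim smul N \<and> complemented_in smul V nrm N"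
proof -
  have xV: "x k \<in> V" for k using x M by blast
  define S where "S n v = (\<Sum>k<n. smul (g k v) (x k))" for n v
  have SV: "S n v \<in> V" for n v unfolding S_def using xV by (simp add: mem_simps)
  have S_span: "S n v \<in> span (range x)" for n v
    unfolding S_def by (intro span_sum span_scale span_base) auto
  define L where "L v = (SOME l. l \<in> V \<and> (\<lambda>n. nrm (S n v - l)) \<longlonglongrightarrow> 0)" for v
  have L: "L v \<in> V \<and> (\<lambda>n. nrm (S n v - L v)) \<longlonglongrightarrow> 0" if v: "v \<in> V" for v
    unfolding L_def
  proof (rule someI_ex)
    obtain l where "l \<in> V" "(\<lambda>n. nrm (S n v - l)) \<longlonglongrightarrow> 0"
      by (rule Cauchy_imp_limit[of "\<lambda>n. S n v"]) (use SV Cauchy[OF v] in \<open>auto simp: S_def\<close>)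
    thus "\<exists>l. l \<in> V \<and> (\<lambda>n. nrm (S n v - l)) \<longlonglongrightarrow> 0" by blast
  qed
  have L_eq: "L v = l" if "v \<in> V" "l \<in> V" "(\<lambda>n. nrm (S n v - l)) \<longlonglongrightarrow> 0" for v l
    using limit_unique[of "\<lambda>n. S n v" "L v" l] SV L that by blast
  have S_add: "S n (v + w) = S n v + S n w" if "v \<in> V" "w \<in> V" for n v w
    using that by (simp add: S_def functional_on_add[OF g(1)] scale_left_distrib sum.distrib)
  have S_scale: "S n (smul c v) = smul c (S n v)" if "v \<in> V" for n c v
    using that by (simp add: S_def functional_on_scale[OF g(1)] scale_sum_right)
  have L_add: "L (v + w) = L v + L w" if vw: "v \<in> V" "w \<in> V" for v w
  proof (rule L_eq)
    show "(\<lambda>n. nrm (S n (v + w) - (L v + L w))) \<longlonglongrightarrow> 0"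
    proof (rule null_sequence_squeeze)
      show "(\<lambda>n. nrm (S n v - L v) + nrm (S n w - L w)) \<longlonglongrightarrow> 0"
        using tendsto_add[OF conjunct2[OF L[OF vw(1)]] conjunct2[OF L[OF vw(2)]]] by simp
      fix n
      have "S n (v + w) - (L v + L w) = (S n v - L v) + (S n w - L w)" using vw by (simp add: S_add)
      thus "nrm (S n (v + w) - (L v + L w)) \<le> nrm (S n v - L v) + nrm (S n w - L w)"
        using nrm_triangle[of "S n v - L v" "S n w - L w"] L SV vw by (simp only: diff_mem)
      show "0 \<le> nrm (S n (v + w) - (L v + L w))"
        using L SV vw by (intro nrm_nonneg) (simp add: mem_simps)
    qed
  qed (use L vw in \<open>auto simp: mem_simps\<close>)
  have L_scale: "L (smul c v) = smul c (L v)" if v: "v \<in> V" for c v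
  proof (rule L_eq)
    have "nrm (S n (smul c v) - smul c (L v)) = norm c * nrm (S n v - L v)" for n
      using nrm_scale[of "S n v - L v" c] L SV v by (simp add: S_scale mem_simps scale_right_diff_distrib)
    thus "(\<lambda>n. nrm (S n (smul c v) - smul c (L v))) \<longlonglongrightarrow> 0"
      using tendsto_mult_right_zero[of "\<lambda>n. nrm (S n v - L v)"] L v by simp
  qed (use L v in \<open>auto simp: mem_simps\<close>)
  have L_bound: "nrm (L v) \<le> K * nrm v" if v: "v \<in> V" for v
  proof -
    have "nrm (L v) \<le> K * nrm v + nrm (S n v - L v)" for n
      using nrm_diff_ge[of "L v" "S n v"] nrm_minus_commute[of "L v" "S n v"] bound[OF v, of n] L[OF v] SV
      by (simp add: S_def)
    moreover have "(\<lambda>n. K * nrm v + nrm (S n v - L v)) \<longlonglongrightarrow> K * nrm v + 0"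
      using L v by (intro tendsto_intros) auto
    ultimately show ?thesis by (intro tendsto_lowerbound[where F = sequentially]) auto
  qed
  have L_diff: "L (v - w) = L v - L w" if "v \<in> V" "w \<in> V" for v w
    using L_add[of "v - w" w] that by (simp add: mem_simps)
  have span_V: "span (range x) \<subseteq> V" using xV subspace_V by (intro span_minimal) auto
  define N where "N = nclosure (span (range x))"
  have N: "subspace N" "N \<subseteq> V" "near_closed N"
    using subspace_nclosure[OF subspace_span span_V] nclosure_subset near_closed_nclosure[OF span_V]
    by (auto simp: N_def)
  have span_N: "span (range x) \<subseteq> N" unfolding N_def by (rule subset_nclosure[OF span_V])
  have NM: "N \<subseteq> M"
    unfolding N_def using x M by (intro nclosure_minimal span_minimal) auto
  have w_close: "nrm ((\<Sum>l<n. smul (a l) (x l)) - (\<Sum>l<n. smul (a l) (u l)))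
                   \<le> C * \<sigma> * nrm (\<Sum>l<n. smul (a l) (u l))"
    and L_w: "L (\<Sum>l<n. smul (a l) (u l)) = (\<Sum>l<n. smul (a l) (x l))"
    and g_w: "\<And>k. g k (\<Sum>l<n. smul (a l) (u l)) = (if k < n then a k else 0)" for n a
  proof -
    define w where "w = (\<Sum>l<n. smul (a l) (u l))"
    have w: "w \<in> V" unfolding w_def using u by (simp add: mem_simps)
    have gw: "g k w = (if k < n then a k else 0)" for k
    proof -
      have "g k w = (\<Sum>l<n. a l * g k (u l))"
        unfolding w_def using g u by (intro functional_on_sum) auto
      also have "\<dots> = (\<Sum>l<n. if l = k then a l else 0)" by (intro sum.cong) (auto simp: biorth)
      finally show ?thesis by simp
    qed
    thus "\<And>k. g k (\<Sum>l<n. smul (a l) (u l)) = (if k < n then a k else 0)" by (simp add: w_def)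
    have "S m w = (\<Sum>l<n. smul (a l) (x l))" if "m \<ge> n" for m
      unfolding S_def gw using that by (intro sum.mono_neutral_cong_right) auto
    hence "\<forall>\<^sub>F m in sequentially. nrm (S m w - (\<Sum>l<n. smul (a l) (x l))) = 0"
      by (intro eventually_sequentiallyI[of n]) simp
    hence "(\<lambda>m. nrm (S m w - (\<Sum>l<n. smul (a l) (x l)))) \<longlonglongrightarrow> 0"
      by (rule tendsto_eventually)
    thus "L (\<Sum>l<n. smul (a l) (u l)) = (\<Sum>l<n. smul (a l) (x l))"
      using w xV by (intro L_eq) (auto simp: w_def mem_simps)
    have "(\<Sum>l<n. smul (a l) (x l)) - w = (\<Sum>l<n. smul (a l) (x l - u l))"
      by (simp add: w_def scale_right_diff_distrib sum_subtractf)
    also have "nrm \<dots> \<le> (\<Sum>l<n. norm (a l) * nrm (x l - u l))"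
      using xV u by (intro nrm_scaled_sum_le) (simp add: mem_simps)
    also have "\<dots> \<le> (\<Sum>l<n. (C * nrm w) * nrm (x l - u l))"
    proof (intro sum_mono mult_right_mono)
      fix l assume "l \<in> {..<n}"
      thus "norm (a l) \<le> C * nrm w" using g(2)[OF w, of l] gw[of l] by simp
    qed (use xV u in \<open>auto intro!: nrm_nonneg simp: mem_simps\<close>)
    also have "\<dots> \<le> (C * nrm w) * \<sigma>"
      unfolding sum_distrib_left[symmetric] using pert small nrm_nonneg[OF w]
      by (intro mult_left_mono) auto
    finally show "nrm ((\<Sum>l<n. smul (a l) (x l)) - (\<Sum>l<n. smul (a l) (u l)))
                   \<le> C * \<sigma> * nrm (\<Sum>l<n. smul (a l) (u l))"
      by (simp add: w_def mult.commute mult.left_commute)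
  qed
  have near_span: "nrm (L z - z) \<le> 1 / 2 * nrm z" and w_le: "nrm w \<le> 2 * nrm z"
    if z: "z = (\<Sum>l<n. smul (a l) (x l))" and w: "w = (\<Sum>l<n. smul (a l) (u l))" for z w n a
  proof -
    have V: "z \<in> V" "w \<in> V" unfolding z w using xV u by (auto simp: mem_simps)
    have zw: "nrm (z - w) \<le> C * \<sigma> * nrm w" using w_close by (simp add: z w)
    also have "\<dots> \<le> 1 / 2 * nrm w" using small nrm_nonneg[OF V(2)] by (intro mult_right_mono) auto
    finally have "nrm (z - w) \<le> 1 / 2 * nrm w" .
    thus wz: "nrm w \<le> 2 * nrm z" using nrm_diff_ge[of w z] nrm_minus_commute[of w z] V by simp
    have "nrm (L z - z) = nrm (L (z - w))" using L_w[where n = n and a = a] V by (simp add: L_diff z w)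
    also have "\<dots> \<le> K * nrm (z - w)" using V by (intro L_bound) (simp add: mem_simps)
    also have "\<dots> \<le> K * (C * \<sigma> * nrm w)" using zw small by (intro mult_left_mono) auto
    also have "\<dots> = (K * C * \<sigma>) * nrm w" by simp
    also have "\<dots> \<le> (1 / 4) * (2 * nrm z)"
      using small wz nrm_nonneg[OF V(2)] by (intro mult_mono) auto
    finally show "nrm (L z - z) \<le> 1 / 2 * nrm z" by simp
  qed
  (* The estimate passes from the span to its closure because L is bounded. *)
  have near: "nrm (L z - z) \<le> 1 / 2 * nrm z" if z: "z \<in> N" for z
  proof (rule field_le_epsilon)
    fix e :: real assume e: "e > 0"
    have zV: "z \<in> V" using z N by blast
    have "e / (K + 2) > 0" using e small by simp
    then obtain z' where z': "z' \<in> span (range x)" "nrm (z' - z) < e / (K + 2)"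
      using z unfolding N_def nclosure_def by blast
    have z'V: "z' \<in> V" using z' span_V by blast
    obtain n a where "z' = (\<Sum>l<n. smul (a l) (x l))" using in_span_range_imp_sum z'(1) by blast
    hence near': "nrm (L z' - z') \<le> 1 / 2 * nrm z'" using near_span by blast
    have "L z - z = - L (z' - z) + ((L z' - z') + (z' - z))" using zV z'V by (simp add: L_diff)
    hence "nrm (L z - z) = nrm (- L (z' - z) + ((L z' - z') + (z' - z)))" by (rule arg_cong)
    also have "\<dots> \<le> nrm (- L (z' - z)) + nrm ((L z' - z') + (z' - z))"
      using zV z'V conjunct1[OF L[OF zV]] conjunct1[OF L[OF z'V]] conjunct1[OF L[OF diff_mem[OF z'V zV]]]
      by (intro nrm_triangle) (simp_all add: mem_simps)
    also have "nrm (- L (z' - z)) = nrm (L (z' - z))"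
      using L[OF diff_mem[OF z'V zV]] by (intro nrm_uminus) simp
    also have "nrm ((L z' - z') + (z' - z)) \<le> nrm (L z' - z') + nrm (z' - z)"
      using zV z'V L by (intro nrm_triangle) (auto simp: mem_simps)
    also have "nrm (L (z' - z)) \<le> K * nrm (z' - z)"
      using zV z'V by (intro L_bound) (simp add: mem_simps)
    finally have "nrm (L z - z) \<le> K * nrm (z' - z) + (1 / 2 * nrm z' + nrm (z' - z))"
      using near' by linarith
    moreover have "nrm z' \<le> nrm z + nrm (z' - z)" using nrm_diff_ge[of z' z] zV z'V by simp
    ultimately have "nrm (L z - z) \<le> 1 / 2 * nrm z + (K + 3 / 2) * nrm (z' - z)"
      by (simp add: algebra_simps)
    also have "(K + 3 / 2) * nrm (z' - z) \<le> (K + 2) * nrm (z' - z)"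
      using nrm_nonneg[of "z' - z"] zV z'V by (intro mult_right_mono) (auto simp: mem_simps)
    also have "\<dots> \<le> e" using z'(2) small by (simp add: field_simps)
    finally show "nrm (L z - z) \<le> 1 / 2 * nrm z + e" by simp
  qed
  have "complemented_in smul V nrm N"
  proof (rule complemented_of_near_identity[OF N _ L_add L_scale L_bound near])
    fix v assume v: "v \<in> V"
    show "L v \<in> N"
      using near_closed_limit[OF N(3), of "\<lambda>n. S n v" "L v"] S_span span_N L[OF v] by blast
  qed auto
  moreover have "\<not> finite_dim smul N"
  proof (rule not_finite_dim_sequence)
    show "range x \<subseteq> N" using span_N span_superset by blast
    fix a n i assume 0: "(\<Sum>i<n. smul (a i) (x i)) = 0" and i: "i < n"
    define w where "w = (\<Sum>l<n. smul (a l) (u l))"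
    have wV: "w \<in> V" unfolding w_def using u by (simp add: mem_simps)
    have "nrm w \<le> 0" using w_le[OF 0[symmetric] w_def] by simp
    hence "g i w = 0" using g(2)[OF wV, of i] nrm_nonneg[OF wV] by simp
    moreover have "g i w = (if i < n then a i else 0)" unfolding w_def by (rule g_w)
    ultimately show "a i = 0" using i by simp
  qed
  ultimately show ?thesis using N NM by blast
qed

end

section \<open>James-type space of a sequence of contractions\<close>

locale james_space = vector_space smul
  for smul :: "'k::{real_normed_field, banach} \<Rightarrow> 'v::ab_group_add \<Rightarrow> 'v" +
  fixes X :: "nat \<Rightarrow> 'v set" and nrm :: "nat \<Rightarrow> 'v \<Rightarrow> real" and \<phi> :: "nat \<Rightarrow> 'v \<Rightarrow> 'v"
  assumes banach: "banach_space_on smul (X n) (nrm n)"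
    and \<phi>_bounded: "bounded_linear_on smul (X n) (nrm n) (X (Suc n)) (nrm (Suc n)) (\<phi> n)"
    and \<phi>_onorm: "onorm_on (X n) (nrm n) (nrm (Suc n)) (\<phi> n) \<le> 1"
begin

sublocale B: banach_space_on smul "X n" "nrm n" for n
  by (rule banach)

lemma \<phi>_mem: "x \<in> X n \<Longrightarrow> \<phi> n x \<in> X (Suc n)"
  and \<phi>_add: "x \<in> X n \<Longrightarrow> y \<in> X n \<Longrightarrow> \<phi> n (x + y) = \<phi> n x + \<phi> n y"
  and \<phi>_scale: "x \<in> X n \<Longrightarrow> \<phi> n (smul c x) = smul c (\<phi> n x)"
  using \<phi>_bounded[of n] by (auto simp: bounded_linear_on_def linear_on_def)

lemma \<phi>_contraction:
  assumes x: "x \<in> X n"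
  shows "nrm (Suc n) (\<phi> n x) \<le> nrm n x"
proof -
  obtain K where K: "\<And>x. x \<in> X n \<Longrightarrow> nrm (Suc n) (\<phi> n x) \<le> K * nrm n x"
    using \<phi>_bounded[of n] by (auto simp: bounded_linear_on_def)
  have "bdd_above ((\<lambda>x. nrm (Suc n) (\<phi> n x) / nrm n x) ` X n)"
  proof (rule bdd_aboveI2)
    fix x assume x: "x \<in> X n"
    show "nrm (Suc n) (\<phi> n x) / nrm n x \<le> max K 0"
    proof (cases "nrm n x = 0")
      case False
      hence "nrm n x > 0" using B.nrm_nonneg[OF x] by simp
      hence "nrm (Suc n) (\<phi> n x) / nrm n x \<le> K" using K[OF x] by (simp add: field_simps)
      thus ?thesis by simp
    qed simp
  qed
  hence "nrm (Suc n) (\<phi> n x) / nrm n x \<le> onorm_on (X n) (nrm n) (nrm (Suc n)) (\<phi> n)"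
    unfolding onorm_on_def using x by (intro cSUP_upper)
  with \<phi>_onorm[of n] have le: "nrm (Suc n) (\<phi> n x) / nrm n x \<le> 1" by linarith
  show ?thesis
  proof (cases "nrm n x = 0")
    case True
    with K[OF x] show ?thesis by simp
  next
    case False
    hence "nrm n x > 0" using B.nrm_nonneg[OF x] by simp
    with le show ?thesis by (simp add: field_simps)
  qed
qed

abbreviation tr :: "nat \<Rightarrow> nat \<Rightarrow> 'v \<Rightarrow> 'v" where
  "tr \<equiv> transition \<phi>"

lemma tr_refl [simp]: "tr n n x = x"
  by (simp add: transition_def)

lemma tr_Suc: "n \<le> m \<Longrightarrow> tr n (Suc m) x = \<phi> m (tr n m x)"
  by (simp add: transition_def)

lemma tr_mem: "n \<le> m \<Longrightarrow> x \<in> X n \<Longrightarrow> tr n m x \<in> X m"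
  by (induction m rule: dec_induct) (auto simp: tr_Suc \<phi>_mem)

lemma tr_add: "n \<le> m \<Longrightarrow> x \<in> X n \<Longrightarrow> y \<in> X n \<Longrightarrow> tr n m (x + y) = tr n m x + tr n m y"
  by (induction m rule: dec_induct) (auto simp: tr_Suc \<phi>_add tr_mem)

lemma tr_scale: "n \<le> m \<Longrightarrow> x \<in> X n \<Longrightarrow> tr n m (smul c x) = smul c (tr n m x)"
  by (induction m rule: dec_induct) (auto simp: tr_Suc \<phi>_scale tr_mem)

lemma tr_0 [simp]: "n \<le> m \<Longrightarrow> tr n m 0 = 0"
  using tr_scale[of n m 0 0] by simp

lemma tr_diff: "n \<le> m \<Longrightarrow> x \<in> X n \<Longrightarrow> y \<in> X n \<Longrightarrow> tr n m (x - y) = tr n m x - tr n m y"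
  using tr_add[of n m "x - y" y] by (simp add: B.mem_simps)

lemma tr_contraction: "n \<le> m \<Longrightarrow> x \<in> X n \<Longrightarrow> nrm m (tr n m x) \<le> nrm n x"
proof (induction m rule: dec_induct)
  case (step m)
  thus ?case using \<phi>_contraction[OF tr_mem[of n m x]] by (simp add: tr_Suc)
qed simp

lemma tr_tr: "j \<le> k \<Longrightarrow> i \<le> j \<Longrightarrow> tr j k (tr i j x) = tr i k x"
  by (induction k rule: dec_induct) (simp_all add: tr_Suc)

abbreviation smulJ :: "'k \<Rightarrow> (nat \<Rightarrow> 'v) \<Rightarrow> nat \<Rightarrow> 'v" where
  "smulJ \<equiv> scale_seq smul"

definition seqs :: "(nat \<Rightarrow> 'v) set" where "seqs = {x. \<forall>n. x n \<in> X n}"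

lemma seqsD: "x \<in> seqs \<Longrightarrow> x n \<in> X n"
  by (simp add: seqs_def)

definition jump :: "(nat \<Rightarrow> 'v) \<Rightarrow> nat \<Rightarrow> nat \<Rightarrow> real" where
  "jump x i j = (nrm j (tr i j (x i) - x j))\<^sup>2"

text \<open>
  Strictly increasing lists replace the finite index sets, so that splitting and concatenating index
  sets becomes list surgery; \<open>rho2\<close> is the square of \<open>J_rho\<close> (\<open>J_rho_eq\<close>).  The final term \<open>last_sq\<close>
  is kept apart, because only \<open>var\<close> is additive over consecutive lists up to a nonnegative jump.
\<close>

fun var :: "(nat \<Rightarrow> 'v) \<Rightarrow> nat list \<Rightarrow> real" where
  "var x (i # j # l) = jump x i j + var x (j # l)"
| "var x _ = 0"

definition last_sq :: "(nat \<Rightarrow> 'v) \<Rightarrow> nat list \<Rightarrow> real" where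
  "last_sq x l = (if l = [] then 0 else (nrm (last l) (x (last l)))\<^sup>2)"

definition rho2 :: "(nat \<Rightarrow> 'v) \<Rightarrow> nat list \<Rightarrow> real" where
  "rho2 x l = var x l + last_sq x l"

lemma jump_nonneg [simp]: "jump x i j \<ge> 0"
  by (simp add: jump_def)

lemma last_sq_nonneg [simp]: "last_sq x l \<ge> 0"
  by (simp add: last_sq_def)

lemma var_nonneg [simp]: "var x l \<ge> 0"
  by (induction x l rule: var.induct) auto

lemma rho2_nonneg [simp]: "rho2 x l \<ge> 0"
  by (simp add: rho2_def)

lemma rho2_simps [simp]:
  "rho2 x [] = 0" "rho2 x [i] = (nrm i (x i))\<^sup>2"
  "rho2 x (i # j # l) = jump x i j + rho2 x (j # l)"
  by (simp_all add: rho2_def last_sq_def)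

lemma var_append:
  "var x (l1 @ l2) = var x l1 + var x l2 + (if l1 = [] \<or> l2 = [] then 0 else jump x (last l1) (hd l2))"
proof (induction l1 rule: induct_list012)
  case (2 i)
  show ?case by (cases l2) auto
qed auto

lemma last_sq_append: "last_sq x (l1 @ l2) = (if l2 = [] then last_sq x l1 else last_sq x l2)"
  by (simp add: last_sq_def)

lemma var_cong: "(\<And>j. j \<in> set l \<Longrightarrow> x j = y j) \<Longrightarrow> var x l = var y l"
  by (induction x l rule: var.induct) (auto simp: jump_def)

lemma last_sq_cong: "(\<And>j. j \<in> set l \<Longrightarrow> x j = y j) \<Longrightarrow> last_sq x l = last_sq y l"
  by (simp add: last_sq_def)

lemma var_zero: "sorted_wrt (<) l \<Longrightarrow> (\<And>j. j \<in> set l \<Longrightarrow> x j = 0) \<Longrightarrow> var x l = 0"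
  by (induction x l rule: var.induct) (auto simp: jump_def)

lemma rho2_eq_sum:
  assumes "l \<noteq> []"
  shows "(\<Sum>i=1..length l - 1. (nrm (l ! i) (tr (l ! (i - 1)) (l ! i) (x (l ! (i - 1))) - x (l ! i)))\<^sup>2)
      + (nrm (l ! (length l - 1)) (x (l ! (length l - 1))))\<^sup>2 = rho2 x l"
  using assms
proof (induction l rule: induct_list012)
  case (3 i j l)
  define F where "F = (\<lambda>l m. (nrm (l ! m) (tr (l ! (m - 1)) (l ! m) (x (l ! (m - 1))) - x (l ! m)))\<^sup>2)"
  have "(\<Sum>m=1..Suc (length l). F (i # j # l) m)
        = F (i # j # l) 1 + (\<Sum>m=Suc 1..Suc (length l). F (i # j # l) m)"
    by (rule sum.atLeast_Suc_atMost) simp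
  also have "(\<Sum>m=Suc 1..Suc (length l). F (i # j # l) m) = (\<Sum>m=1..length l. F (i # j # l) (Suc m))"
    by (rule sum.shift_bounds_cl_Suc_ivl)
  also have "\<dots> = (\<Sum>m=1..length l. F (j # l) m)"
    by (intro sum.cong) (auto simp: F_def nth_Cons')
  also have "F (i # j # l) 1 = jump x i j" by (simp add: F_def jump_def)
  finally show ?case using 3 by (simp add: F_def)
qed auto

lemma J_rho_eq:
  assumes "finite S" "S \<noteq> {}"
  shows "J_rho nrm \<phi> x S = sqrt (rho2 x (sorted_list_of_set S))"
proof -
  have len: "length (sorted_list_of_set S) = card S" by simp
  have ne: "sorted_list_of_set S \<noteq> []" using assms by simp
  show ?thesis
    unfolding J_rho_def Let_def rho2_eq_sum[OF ne, symmetric] len by (rule refl)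
qed

abbreviation N :: "(nat \<Rightarrow> 'v) \<Rightarrow> real" where "N \<equiv> J_norm nrm \<phi>"
abbreviation J_hat' :: "(nat \<Rightarrow> 'v) set" where "J_hat' \<equiv> J_hat X nrm \<phi>"
abbreviation J :: "(nat \<Rightarrow> 'v) set" where "J \<equiv> J_space X nrm \<phi>"

lemma rho2_le_of_J_hat:
  assumes x: "x \<in> J_hat'" and l: "sorted_wrt (<) l"
  shows "rho2 x l \<le> 2 * (N x)\<^sup>2" and "N x \<ge> 0"
proof -
  define s where "s = (SUP S\<in>fin_index_sets. J_rho nrm \<phi> x S)"
  have bdd: "bdd_above (J_rho nrm \<phi> x ` fin_index_sets)" using x by (simp add: J_hat_def)
  have upper: "sqrt (rho2 x l) \<le> s" if "sorted_wrt (<) l" "l \<noteq> []" for l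
  proof -
    have "J_rho nrm \<phi> x (set l) \<le> s"
      unfolding s_def using that by (intro cSUP_upper bdd) (auto simp: fin_index_sets_def)
    moreover have "sorted_list_of_set (set l) = l"
      using that by (simp add: strict_sorted_imp_sorted strict_sorted_iff sorted_list_of_set.idem_if_sorted_distinct)
    ultimately show ?thesis using that by (simp add: J_rho_eq)
  qed
  have s: "s \<ge> 0"
    using upper[of "[0]"] real_sqrt_ge_zero[OF rho2_nonneg[of x "[0]"]] by (simp del: rho2_simps real_sqrt_ge_0_iff)
  have N: "N x = s / sqrt 2" by (simp add: J_norm_def s_def)
  show "N x \<ge> 0" using s by (simp add: N)
  have "rho2 x l \<le> s\<^sup>2"
  proof (cases "l = []")
    case False
    have "(sqrt (rho2 x l))\<^sup>2 \<le> s\<^sup>2" using upper[OF l False] by (intro power_mono) auto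
    thus ?thesis by simp
  qed simp
  thus "rho2 x l \<le> 2 * (N x)\<^sup>2" by (simp add: N power_divide)
qed

lemma N_nonneg: "x \<in> J_hat' \<Longrightarrow> N x \<ge> 0"
  using rho2_le_of_J_hat(2)[of x "[]"] by simp

lemma J_hatI:
  assumes x: "x \<in> seqs" and K: "K \<ge> 0" and bound: "\<And>l. sorted_wrt (<) l \<Longrightarrow> rho2 x l \<le> 2 * K\<^sup>2"
  shows "x \<in> J_hat'" "N x \<le> K"
proof -
  have *: "J_rho nrm \<phi> x S \<le> sqrt 2 * K" if "S \<in> fin_index_sets" for S
  proof -
    have "rho2 x (sorted_list_of_set S) \<le> 2 * K\<^sup>2"
      by (intro bound) simp
    hence "sqrt (rho2 x (sorted_list_of_set S)) \<le> sqrt (2 * K\<^sup>2)" by (rule real_sqrt_le_mono)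
    thus ?thesis using that K by (simp add: J_rho_eq fin_index_sets_def real_sqrt_mult)
  qed
  show "x \<in> J_hat'" using x * by (auto simp: J_hat_def seqs_def intro!: bdd_aboveI2)
  have "{0} \<in> fin_index_sets" by (simp add: fin_index_sets_def)
  hence "(SUP S\<in>fin_index_sets. J_rho nrm \<phi> x S) \<le> sqrt 2 * K" using * by (intro cSUP_least) auto
  thus "N x \<le> K" by (simp add: J_norm_def field_simps)
qed

lemma J_hat_seqs: "x \<in> J_hat' \<Longrightarrow> x \<in> seqs"
  by (simp add: J_hat_def seqs_def)

lemma J_J_hat: "x \<in> J \<Longrightarrow> x \<in> J_hat'"
  by (simp add: J_space_def)

lemma J_seqs: "x \<in> J \<Longrightarrow> x \<in> seqs"
  by (simp add: J_hat_seqs J_J_hat)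

lemma J_mem: "x \<in> J \<Longrightarrow> x n \<in> X n"
  by (rule seqsD[OF J_seqs])

lemma last_sq_le:
  assumes "x \<in> J_hat'"
  shows "(nrm n (x n))\<^sup>2 \<le> 2 * (N x)\<^sup>2"
  using rho2_le_of_J_hat(1)[OF assms, of "[n]"] by simp

lemma coordinate_le:
  assumes x: "x \<in> J_hat'"
  shows "nrm n (x n) \<le> 2 * N x"
proof (rule power2_le_imp_le)
  have "(nrm n (x n))\<^sup>2 \<le> 4 * (N x)\<^sup>2" using last_sq_le[OF x, of n] zero_le_power2[of "N x"] by linarith
  thus "(nrm n (x n))\<^sup>2 \<le> (2 * N x)\<^sup>2" by simp
qed (use N_nonneg[OF x] in auto)

lemma seqs_add: "x \<in> seqs \<Longrightarrow> y \<in> seqs \<Longrightarrow> x + y \<in> seqs"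
  and seqs_diff: "x \<in> seqs \<Longrightarrow> y \<in> seqs \<Longrightarrow> x - y \<in> seqs"
  and seqs_scale: "x \<in> seqs \<Longrightarrow> smulJ c x \<in> seqs"
  by (auto simp: seqs_def scale_seq_def B.mem_simps)

lemma jump_diff_mem: "x \<in> seqs \<Longrightarrow> i \<le> j \<Longrightarrow> tr i j (x i) - x j \<in> X j"
  by (intro B.diff_mem tr_mem seqsD)

lemma sqrt_sum_triangle:
  fixes a b c d r s t :: real
  assumes "0 \<le> a" "a \<le> b + c" "0 \<le> b" "0 \<le> c" "0 \<le> r" "0 \<le> s" "0 \<le> t" "sqrt r \<le> sqrt s + sqrt t"
  shows "sqrt (a\<^sup>2 + r) \<le> sqrt (b\<^sup>2 + s) + sqrt (c\<^sup>2 + t)"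
proof -
  have "a\<^sup>2 + r \<le> (b + c)\<^sup>2 + (sqrt s + sqrt t)\<^sup>2"
    using assms power_mono[of a "b + c" 2] power_mono[of "sqrt r" "sqrt s + sqrt t" 2]
    by (intro add_mono) simp_all
  hence "sqrt (a\<^sup>2 + r) \<le> sqrt ((b + c)\<^sup>2 + (sqrt s + sqrt t)\<^sup>2)" by (rule real_sqrt_le_mono)
  also have "\<dots> \<le> sqrt (b\<^sup>2 + (sqrt s)\<^sup>2) + sqrt (c\<^sup>2 + (sqrt t)\<^sup>2)"
    by (rule real_sqrt_sum_squares_triangle_ineq)
  finally show ?thesis using assms by simp
qed

lemma sqrt_rho2_triangle:
  assumes x: "x \<in> seqs" and y: "y \<in> seqs" and l: "sorted_wrt (<) l"
  shows "sqrt (rho2 (x + y) l) \<le> sqrt (rho2 x l) + sqrt (rho2 y l)"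
  using l
proof (induction l rule: induct_list012)
  case (2 i)
  show ?case using B.nrm_triangle B.nrm_nonneg seqsD x y by (simp add: B.add_mem)
next
  case (3 i j l)
  have ij: "i \<le> j" using 3 by simp
  have mem: "tr i j (x i) - x j \<in> X j" "tr i j (y i) - y j \<in> X j"
    using ij x y by (auto intro: jump_diff_mem)
  have eq: "tr i j ((x + y) i) - (x + y) j = (tr i j (x i) - x j) + (tr i j (y i) - y j)"
    using ij x y by (simp add: tr_add seqsD)
  have IH: "sqrt (rho2 (x + y) (j # l)) \<le> sqrt (rho2 x (j # l)) + sqrt (rho2 y (j # l))"
  proof (rule "3.IH"(2))
    show "sorted_wrt (<) (j # l)" using 3(3) by simp
  qed
  have "sqrt (jump (x + y) i j + rho2 (x + y) (j # l))
        \<le> sqrt (jump x i j + rho2 x (j # l)) + sqrt (jump y i j + rho2 y (j # l))"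
    unfolding jump_def eq
    by (rule sqrt_sum_triangle[OF _ _ _ _ _ _ _ IH])
       (use mem in \<open>simp_all add: B.nrm_nonneg B.nrm_triangle B.add_mem\<close>)
  thus ?case by (simp add: plus_fun_def)
qed simp

lemma rho2_scale:
  assumes x: "x \<in> seqs" and l: "sorted_wrt (<) l"
  shows "rho2 (smulJ c x) l = (norm c)\<^sup>2 * rho2 x l"
  using l
proof (induction l rule: induct_list012)
  case (2 i)
  show ?case using x by (simp add: scale_seq_def B.nrm_scale seqsD power_mult_distrib)
next
  case (3 i j l)
  have "tr i j (smulJ c x i) - smulJ c x j = smul c (tr i j (x i) - x j)"
    using 3 x by (simp add: scale_seq_def tr_scale seqsD scale_right_diff_distrib)
  hence "jump (smulJ c x) i j = (norm c)\<^sup>2 * jump x i j"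
    using 3 x by (simp add: jump_def B.nrm_scale jump_diff_mem power_mult_distrib)
  thus ?case using 3 by (simp add: algebra_simps)
qed simp

text \<open>
  Each coordinate enters at most two of the terms.  This crude bound makes \<open>rho2\<close> for a fixed list
  continuous under coordinatewise convergence, which is what completeness needs.
\<close>

lemma sqrt_rho2_le_sum:
  assumes y: "y \<in> seqs" and l: "sorted_wrt (<) l"
  shows "sqrt (rho2 y l) \<le> 2 * (\<Sum>i\<leftarrow>l. nrm i (y i))"
proof -
  have aux: "sqrt (rho2 y (i # l)) \<le> nrm i (y i) + 2 * (\<Sum>i\<leftarrow>l. nrm i (y i))"
    if "sorted_wrt (<) (i # l)" for i l
    using that
  proof (induction l arbitrary: i)
    case Nil
    show ?case using B.nrm_nonneg seqsD[OF y] by simp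
  next
    case (Cons j l)
    have ij: "i \<le> j" using Cons by simp
    have "nrm j (tr i j (y i) - y j) \<le> nrm j (tr i j (y i)) + nrm j (y j)"
      using y ij by (intro B.nrm_diff_le tr_mem) (auto simp: seqsD)
    also have "\<dots> \<le> nrm i (y i) + nrm j (y j)"
      using tr_contraction[OF ij seqsD[OF y]] by simp
    finally have "nrm j (tr i j (y i) - y j) \<le> nrm i (y i) + nrm j (y j)" .
    moreover have "sqrt (rho2 y (i # j # l)) \<le> nrm j (tr i j (y i) - y j) + sqrt (rho2 y (j # l))"
      using sqrt_add_le_add_sqrt[of "jump y i j" "rho2 y (j # l)"] B.nrm_nonneg[OF jump_diff_mem[OF y ij]]
      by (simp add: jump_def)
    moreover have "sqrt (rho2 y (j # l)) \<le> nrm j (y j) + 2 * (\<Sum>i\<leftarrow>l. nrm i (y i))"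
      using Cons by simp
    ultimately show ?case by simp
  qed
  show ?thesis
  proof (cases l)
    case (Cons i l')
    with aux[of i l'] l B.nrm_nonneg[OF seqsD[OF y], of i] show ?thesis by simp
  qed simp
qed

lemma vector_space_scale_seq: "vector_space smulJ"
  by unfold_locales
     (auto simp: scale_seq_def fun_eq_iff scale_right_distrib scale_left_distrib)

lemma J_hat_add:
  assumes x: "x \<in> J_hat'" and y: "y \<in> J_hat'"
  shows "x + y \<in> J_hat'" "N (x + y) \<le> N x + N y"
proof -
  have "rho2 (x + y) l \<le> 2 * (N x + N y)\<^sup>2" if l: "sorted_wrt (<) l" for l
  proof -
    have "sqrt (rho2 (x + y) l) \<le> sqrt (rho2 x l) + sqrt (rho2 y l)"
      using x y l by (intro sqrt_rho2_triangle) (auto simp: J_hat_seqs)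
    also have "sqrt (rho2 x l) \<le> sqrt (2 * (N x)\<^sup>2)" "sqrt (rho2 y l) \<le> sqrt (2 * (N y)\<^sup>2)"
      using x y l by (auto intro: rho2_le_of_J_hat(1))
    hence "sqrt (rho2 x l) + sqrt (rho2 y l) \<le> sqrt 2 * (N x + N y)"
      using N_nonneg[OF x] N_nonneg[OF y] by (simp add: real_sqrt_mult algebra_simps)
    finally have "sqrt (rho2 (x + y) l) \<le> sqrt 2 * (N x + N y)" .
    hence "(sqrt (rho2 (x + y) l))\<^sup>2 \<le> (sqrt 2 * (N x + N y))\<^sup>2" by (intro power_mono) auto
    thus ?thesis by (simp add: power_mult_distrib)
  qed
  thus "x + y \<in> J_hat'" "N (x + y) \<le> N x + N y"
    using J_hatI[of "x + y" "N x + N y"] N_nonneg[OF x] N_nonneg[OF y] J_hat_seqs x y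
    by (auto simp: seqs_add)
qed

lemma J_hat_scale_le:
  assumes x: "x \<in> J_hat'"
  shows "smulJ c x \<in> J_hat'" "N (smulJ c x) \<le> norm c * N x"
proof -
  have "rho2 (smulJ c x) l \<le> 2 * (norm c * N x)\<^sup>2" if l: "sorted_wrt (<) l" for l
    using mult_left_mono[OF rho2_le_of_J_hat(1)[OF x l], of "(norm c)\<^sup>2"] J_hat_seqs[OF x] l
    by (simp add: rho2_scale power_mult_distrib algebra_simps)
  thus "smulJ c x \<in> J_hat'" "N (smulJ c x) \<le> norm c * N x"
    using J_hatI[of "smulJ c x" "norm c * N x"] N_nonneg[OF x] J_hat_seqs[OF x]
    by (auto simp: seqs_scale)
qed

lemma J_hat_scale:
  assumes x: "x \<in> J_hat'"
  shows "N (smulJ c x) = norm c * N x"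
proof (cases "c = 0")
  case True
  thus ?thesis using J_hat_scale_le[OF x, of c] N_nonneg[of "smulJ c x"] by simp
next
  case False
  have "smulJ (1 / c) (smulJ c x) = x"
    using False by (simp add: scale_seq_def)
  hence "N x \<le> norm (1 / c) * N (smulJ c x)"
    using J_hat_scale_le(2)[OF J_hat_scale_le(1)[OF x, of c], of "1 / c"] by simp
  hence "norm c * N x \<le> N (smulJ c x)"
    using False by (simp add: norm_divide field_simps)
  thus ?thesis using J_hat_scale_le(2)[OF x, of c] by simp
qed

lemma zero_J: "0 \<in> J" and N_0: "N 0 = 0"
proof -
  have 0: "rho2 0 l = 0" if "sorted_wrt (<) l" for l
    using that by (induction l rule: induct_list012) (auto simp: jump_def)
  have "0 \<in> seqs" by (simp add: seqs_def)
  hence "0 \<in> J_hat'" "N 0 \<le> 0" using J_hatI[of 0 0] 0 by auto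
  thus "0 \<in> J" "N 0 = 0" using N_nonneg[of 0] by (auto simp: J_space_def)
qed

lemma normed_space_J: "normed_space_on smulJ J N"
proof -
  interpret S: vector_space "smulJ" by (rule vector_space_scale_seq)
  show ?thesis
  proof
    show "S.subspace J"
    proof (rule S.subspaceI)
      show "0 \<in> J" by (rule zero_J)
    next
      fix x y assume xy: "x \<in> J" "y \<in> J"
      have "(\<lambda>n. nrm n ((x + y) n)) \<longlonglongrightarrow> 0"
      proof (rule null_sequence_squeeze)
        show "(\<lambda>n. nrm n (x n) + nrm n (y n)) \<longlonglongrightarrow> 0"
          using xy by (auto simp: J_space_def intro: tendsto_add_zero)
      qed (use xy J_mem B.nrm_triangle in \<open>auto intro!: B.nrm_nonneg B.add_mem\<close>)
      thus "x + y \<in> J" using xy J_hat_add(1)[of x y] by (auto simp: J_space_def)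
    next
      fix c x assume x: "x \<in> J"
      have "(\<lambda>n. nrm n (smulJ c x n)) = (\<lambda>n. norm c * nrm n (x n))"
        using J_mem[OF x] by (simp add: scale_seq_def B.nrm_scale)
      moreover have "(\<lambda>n. norm c * nrm n (x n)) \<longlonglongrightarrow> 0"
        using x by (auto simp: J_space_def intro: tendsto_mult_right_zero)
      ultimately show "smulJ c x \<in> J"
        using x J_hat_scale_le(1)[of x c] by (auto simp: J_space_def)
    qed
  next
    fix x assume x: "x \<in> J"
    show "0 \<le> N x" using N_nonneg J_J_hat x by blast
    show "N x = 0 \<longleftrightarrow> x = 0"
    proof
      assume "N x = 0"
      hence "nrm n (x n) \<le> 0" for n using coordinate_le[OF J_J_hat[OF x], of n] by simp
      hence "x n = 0" for n
        using B.nrm_nonneg[OF J_mem[OF x], of n] B.nrm_eq_0_iff[OF J_mem[OF x], of n] by (simp add: antisym)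
      thus "x = 0" by (simp add: fun_eq_iff)
    qed (simp add: N_0)
    show "N (smulJ c x) = norm c * N x" for c
      using J_hat_scale J_J_hat x by blast
    show "N (x + y) \<le> N x + N y" if "y \<in> J" for y
      using J_hat_add(2) J_J_hat x that by blast
  qed
qed

text \<open>
  The coordinatewise limit of a Cauchy sequence is the limit in norm, because the bound on
  \<open>rho2 (s n - s m) t\<close> for a fixed list \<open>t\<close> survives \<open>m \<rightarrow> \<infinity>\<close>.  The coordinates of the limit tend to zero
  because the coordinates are bounded by the norm uniformly in the index.
\<close>

lemma banach_space_J: "banach_space_on smulJ J N"
proof (rule banach_space_onI[OF normed_space_J])
  interpret S: normed_space_on "smulJ" J N by (rule normed_space_J)
  fix s :: "nat \<Rightarrow> nat \<Rightarrow> 'v"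
  assume s: "\<And>n. s n \<in> J"
    and Cauchy: "\<And>e. e > 0 \<Longrightarrow> \<exists>M. \<forall>m\<ge>M. \<forall>n\<ge>M. N (s m - s n) < e"
  have "\<exists>l\<in>X j. (\<lambda>n. nrm j (s n j - l)) \<longlonglongrightarrow> 0" for j
  proof -
    have "\<exists>M. \<forall>m\<ge>M. \<forall>n\<ge>M. nrm j (s m j - s n j) < e" if "e > 0" for e
    proof -
      obtain M where M: "\<forall>m\<ge>M. \<forall>n\<ge>M. N (s m - s n) < e / 2" using Cauchy[of "e / 2"] \<open>e > 0\<close> by auto
      have "nrm j (s m j - s n j) < e" if "m \<ge> M" "n \<ge> M" for m n
        using coordinate_le[of "s m - s n" j] J_J_hat[OF S.diff_mem[OF s s], of m n] M that
        by fastforce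
      thus ?thesis by blast
    qed
    thus ?thesis using B.Cauchy_imp_limit[of "\<lambda>n. s n j" j] J_mem[OF s] by metis
  qed
  then obtain l where l: "\<And>j. l j \<in> X j" "\<And>j. (\<lambda>n. nrm j (s n j - l j)) \<longlonglongrightarrow> 0" by metis
  have l_seqs: "l \<in> seqs" using l by (simp add: seqs_def)
  have close: "s n - l \<in> J_hat' \<and> N (s n - l) \<le> e"
    if e: "e > 0" and M: "\<And>m. m \<ge> M \<Longrightarrow> N (s n - s m) < e" for e M n
  proof -
    have "rho2 (s n - l) t \<le> 2 * e\<^sup>2" if t: "sorted_wrt (<) t" for t
    proof -
      have "sqrt (rho2 (s n - l) t) \<le> sqrt 2 * e + 2 * (\<Sum>i\<leftarrow>t. nrm i (s m i - l i))" if "m \<ge> M" for m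
      proof -
        have d: "s n - s m \<in> J" "s m - l \<in> seqs" using S.diff_mem[OF s s] seqs_diff[OF J_seqs[OF s] l_seqs] by auto
        have "sqrt (rho2 ((s n - s m) + (s m - l)) t) \<le> sqrt (rho2 (s n - s m) t) + sqrt (rho2 (s m - l) t)"
          using d t by (intro sqrt_rho2_triangle) (auto intro: J_seqs)
        moreover have "sqrt (rho2 (s n - s m) t) \<le> sqrt 2 * e"
        proof -
          have "rho2 (s n - s m) t \<le> 2 * (N (s n - s m))\<^sup>2"
            using J_J_hat[OF d(1)] t by (rule rho2_le_of_J_hat(1))
          also have "\<dots> \<le> 2 * e\<^sup>2"
            using M[OF \<open>m \<ge> M\<close>] N_nonneg[OF J_J_hat[OF d(1)]] by (intro mult_left_mono power_mono) auto
          finally have "sqrt (rho2 (s n - s m) t) \<le> sqrt (2 * e\<^sup>2)" by (rule real_sqrt_le_mono)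
          thus ?thesis using e by (simp add: real_sqrt_mult)
        qed
        moreover have "sqrt (rho2 (s m - l) t) \<le> 2 * (\<Sum>i\<leftarrow>t. nrm i (s m i - l i))"
          using sqrt_rho2_le_sum[OF d(2) t] by simp
        ultimately show ?thesis by simp
      qed
      moreover have "(\<lambda>m. \<Sum>i\<leftarrow>t. nrm i (s m i - l i)) \<longlonglongrightarrow> 0"
        by (induction t) (auto intro: tendsto_add_zero l)
      hence "(\<lambda>m. sqrt 2 * e + 2 * (\<Sum>i\<leftarrow>t. nrm i (s m i - l i))) \<longlonglongrightarrow> sqrt 2 * e + 2 * 0"
        by (intro tendsto_intros)
      ultimately have "sqrt (rho2 (s n - l) t) \<le> sqrt 2 * e + 2 * 0"
        by (intro tendsto_lowerbound[where F = sequentially]) (auto intro: eventually_sequentiallyI[of M])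
      hence "(sqrt (rho2 (s n - l) t))\<^sup>2 \<le> (sqrt 2 * e)\<^sup>2" by (intro power_mono) auto
      thus ?thesis by (simp add: power_mult_distrib)
    qed
    thus ?thesis using J_hatI[of "s n - l" e] e seqs_diff[OF J_seqs[OF s] l_seqs] by simp
  qed
  have lim: "\<exists>M. \<forall>n\<ge>M. s n - l \<in> J_hat' \<and> N (s n - l) \<le> e" if "e > 0" for e
    using Cauchy[OF that] close[OF that] by metis
  have "l \<in> J_hat'"
  proof -
    obtain M where "s M - l \<in> J_hat'" using lim[of 1] by auto
    hence "smulJ (- 1) (s M - l) \<in> J_hat'" by (rule J_hat_scale_le(1))
    hence "s M + smulJ (- 1) (s M - l) \<in> J_hat'" using J_hat_add(1) J_J_hat[OF s] by blast
    moreover have "s M + smulJ (- 1) (s M - l) = l" by (simp add: scale_seq_def fun_eq_iff)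
    ultimately show ?thesis by simp
  qed
  moreover have "(\<lambda>j. nrm j (l j)) \<longlonglongrightarrow> 0"
  proof (rule LIMSEQ_I)
    fix e :: real assume e: "e > 0"
    obtain M where M: "s M - l \<in> J_hat'" "N (s M - l) \<le> e / 4" using lim[of "e / 4"] e by auto
    have "(\<lambda>j. nrm j (s M j)) \<longlonglongrightarrow> 0" using s by (simp add: J_space_def)
    hence "\<forall>\<^sub>F j in sequentially. nrm j (s M j) < e / 2" using e by (intro order_tendstoD(2)) auto
    then obtain j0 where j0: "\<And>j. j \<ge> j0 \<Longrightarrow> nrm j (s M j) < e / 2" by (auto simp: eventually_sequentially)
    have "norm (nrm j (l j) - 0) < e" if "j \<ge> j0" for j
    proof -
      have "nrm j (s M j - l j) \<le> e / 2" using coordinate_le[OF M(1), of j] M(2) by simp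
      moreover have "nrm j (l j) - nrm j (s M j) \<le> nrm j (s M j - l j)"
        using B.nrm_diff_ge[of "l j" j "s M j"] B.nrm_minus_commute[of "l j" j "s M j"] l J_mem[OF s] by simp
      ultimately show ?thesis using j0[OF that] B.nrm_nonneg[OF l(1), of j] by simp
    qed
    thus "\<exists>no. \<forall>j\<ge>no. norm (nrm j (l j) - 0) < e" by blast
  qed
  ultimately have lJ: "l \<in> J" by (simp add: J_space_def)
  moreover have "(\<lambda>n. N (s n - l)) \<longlonglongrightarrow> 0"
  proof (rule LIMSEQ_I)
    fix e :: real assume "e > 0"
    then obtain M where "\<forall>n\<ge>M. s n - l \<in> J_hat' \<and> N (s n - l) \<le> e / 2" using lim[of "e / 2"] by auto
    thus "\<exists>no. \<forall>n\<ge>no. norm (N (s n - l) - 0) < e" using N_nonneg \<open>e > 0\<close> by fastforce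
  qed
  ultimately show "\<exists>l\<in>J. (\<lambda>n. N (s n - l)) \<longlonglongrightarrow> 0" by blast
qed

end

section \<open>Blocks and tails\<close>

lemma finite_dim_image:
  assumes "module_hom s1 s2 f" and "finite_dim s1 S"
  shows "finite_dim s2 (f ` S)"
proof -
  interpret module_hom s1 s2 f by fact
  obtain B where "finite B" "B \<subseteq> S" "S \<subseteq> m1.span B"
    using assms(2) by (auto simp: finite_dim_def)
  thus ?thesis
    unfolding finite_dim_def by (intro exI[of _ "f ` B"]) (auto simp: span_image)
qed

lemma finite_dim_inj_image:
  assumes "module_hom s1 s2 f" and W: "module.subspace s1 W" and inj: "inj_on f W"
    and "finite_dim s2 (f ` W)"
  shows "finite_dim s1 W"
proof -
  interpret module_hom s1 s2 f by fact
  obtain C where "finite C" "C \<subseteq> f ` W" "f ` W \<subseteq> m2.span C"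
    using assms(4) by (auto simp: finite_dim_def)
  then obtain B where B: "finite B" "B \<subseteq> W" "C = f ` B" by (metis finite_subset_image)
  have "W \<subseteq> m1.span B"
  proof
    fix x assume x: "x \<in> W"
    hence "f x \<in> f ` m1.span B" using \<open>f ` W \<subseteq> m2.span C\<close> by (auto simp: B(3) span_image)
    then obtain y where y: "y \<in> m1.span B" "f x = f y" by blast
    moreover have "y \<in> W" using y(1) m1.span_minimal[OF B(2) W] by blast
    ultimately show "x \<in> m1.span B" using inj x by (metis inj_onD)
  qed
  thus ?thesis using B by (auto simp: finite_dim_def)
qed

lemma (in vector_space) finite_dim_subset:
  assumes "finite_dim scale V" "W \<subseteq> V"
  shows "finite_dim scale W"
proof -
  obtain B where B: "finite B" "V \<subseteq> span B" using assms(1) by (auto simp: finite_dim_def)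
  obtain C where C: "C \<subseteq> W" "independent C" "W \<subseteq> span C"
    using maximal_independent_subset[of W] by blast
  have "finite C" using independent_span_bound[OF B(1) C(2)] B(2) C(1) assms(2) by blast
  with C show ?thesis by (auto simp: finite_dim_def)
qed

lemma sorted_split:
  fixes l :: "nat list"
  assumes "sorted_wrt (<) l"
  shows "l = filter (\<lambda>j. j < a) l @ filter (\<lambda>j. a \<le> j) l"
  using assms
proof (induction l)
  case (Cons j l)
  show ?case
  proof (cases "j < a")
    case False
    hence "filter (\<lambda>j. j < a) l = []" using Cons by (auto simp: filter_empty_conv)
    thus ?thesis using False Cons by simp
  qed (use Cons in auto)
qed auto

context james_space
begin

sublocale JS: banach_space_on "smulJ" J N
  by (rule banach_space_J)

lemma var_le_rho2: "var x l \<le> rho2 x l"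
  by (simp add: rho2_def)

lemma jump_le: "x \<in> seqs \<Longrightarrow> i \<le> j \<Longrightarrow> jump x i j \<le> 2 * (nrm i (x i))\<^sup>2 + 2 * (nrm j (x j))\<^sup>2"
proof -
  assume x: "x \<in> seqs" and ij: "i \<le> j"
  have "nrm j (tr i j (x i) - x j) \<le> nrm j (tr i j (x i)) + nrm j (x j)"
    using x ij by (intro B.nrm_diff_le tr_mem) (auto simp: seqsD)
  also have "\<dots> \<le> nrm i (x i) + nrm j (x j)"
    using tr_contraction[OF ij seqsD[OF x]] by simp
  finally have "jump x i j \<le> (nrm i (x i) + nrm j (x j))\<^sup>2"
    unfolding jump_def using B.nrm_nonneg[OF jump_diff_mem[OF x ij]] by (intro power_mono) auto
  moreover have "0 \<le> (nrm i (x i) - nrm j (x j))\<^sup>2" by simp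
  ultimately show ?thesis by (simp add: power2_sum power2_diff)
qed

text \<open>
  The contribution of a block to \<open>rho2\<close> when the list enters it from an index where the vector vanishes:
  the extra first term is the jump into the block.
\<close>

definition block_sq :: "(nat \<Rightarrow> 'v) \<Rightarrow> nat list \<Rightarrow> real" where
  "block_sq y l = (if l = [] then 0 else (nrm (hd l) (y (hd l)))\<^sup>2 + rho2 y l)"

text \<open>
  A list that passes through a block has a jump into it, which costs the norm at the first index, and
  a jump out of it, which costs at most the norm at the last index because the transition maps are
  contractions.  All other differences outside the block are zero.
\<close>

lemma rho2_le_block_sq:
  assumes y: "y \<in> seqs" and l: "sorted_wrt (<) l"
    and zero: "\<And>j. j \<in> set l \<Longrightarrow> \<not> (a \<le> j \<and> j < b) \<Longrightarrow> y j = 0"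
  shows "rho2 y l \<le> block_sq y (filter (\<lambda>j. a \<le> j \<and> j < b) l)"
proof -
  define l0 where "l0 = filter (\<lambda>j. j < a) l"
  define l1 where "l1 = filter (\<lambda>j. a \<le> j \<and> j < b) l"
  define l2 where "l2 = filter (\<lambda>j. b \<le> j) (filter (\<lambda>j. a \<le> j) l)"
  have l_eq: "l = l0 @ l1 @ l2"
  proof -
    have "filter (\<lambda>j. a \<le> j) l = filter (\<lambda>j. j < b) (filter (\<lambda>j. a \<le> j) l) @ l2"
      unfolding l2_def using l by (intro sorted_split sorted_wrt_filter)
    also have "filter (\<lambda>j. j < b) (filter (\<lambda>j. a \<le> j) l) = l1"
      by (simp add: l1_def conj_commute)
    finally show ?thesis using sorted_split[OF l, of a] by (simp add: l0_def)
  qed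
  have zero': "y j = 0" if "j \<in> set l0 \<union> set l2" for j
    using that zero[of j] by (auto simp: l0_def l2_def)
  have sorted: "sorted_wrt (<) l0" "sorted_wrt (<) l1" "sorted_wrt (<) l2"
    using l by (auto simp: l0_def l1_def l2_def intro: sorted_wrt_filter)
  have var0: "var y l0 = 0" "var y l2 = 0" using sorted zero' by (auto intro: var_zero)
  have last0: "last_sq y l0 = 0" "last_sq y l2 = 0" using zero' by (auto simp: last_sq_def)
  show ?thesis
  proof (cases "l1 = []")
    case True
    have "var y (l0 @ l2) = 0"
      using l True zero' unfolding l_eq by (intro var_zero) auto
    thus ?thesis using last0 True
      by (simp add: l_eq[symmetric] block_sq_def l1_def[symmetric])
         (simp add: l_eq rho2_def last_sq_append)
  next
    case False
    define h where "h = (nrm (hd l1) (y (hd l1)))\<^sup>2"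
    have "jump y (last l0) (hd l1) = h" if "l0 \<noteq> []"
    proof -
      have "last l0 < a" "a \<le> hd l1" "y (last l0) = 0"
        using that False last_in_set[OF that] hd_in_set[OF False] zero' by (auto simp: l0_def l1_def)
      thus ?thesis by (simp add: h_def jump_def B.nrm_uminus[OF seqsD[OF y]])
    qed
    moreover have "jump y (last l1) (hd l2) \<le> last_sq y l1" if "l2 \<noteq> []"
    proof -
      have *: "last l1 \<le> hd l2" "y (hd l2) = 0"
        using that False last_in_set[OF False] hd_in_set[OF that] zero' by (auto simp: l1_def l2_def)
      have "(nrm (hd l2) (tr (last l1) (hd l2) (y (last l1))))\<^sup>2 \<le> (nrm (last l1) (y (last l1)))\<^sup>2"
        using tr_contraction[OF *(1) seqsD[OF y]] B.nrm_nonneg[OF tr_mem[OF *(1) seqsD[OF y]]]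
        by (intro power_mono) auto
      thus ?thesis using * False by (simp add: jump_def last_sq_def)
    qed
    moreover have "h \<ge> 0" by (simp add: h_def)
    ultimately have "rho2 y (l0 @ l1 @ l2) \<le> h + rho2 y l1"
      using False var0 last0 by (auto simp: rho2_def var_append last_sq_append)
    thus ?thesis using False by (simp add: l_eq[symmetric] block_sq_def h_def l1_def[symmetric])
  qed
qed

definition single :: "nat \<Rightarrow> 'v \<Rightarrow> nat \<Rightarrow> 'v" where
  "single n v = (\<lambda>j. if j = n then v else 0)"

lemma single_self [simp]: "single n v n = v"
  by (simp add: single_def)

lemma module_hom_single: "module_hom smul smulJ (single n)"
  using vector_space_axioms JS.vector_space_axioms
  by (intro module_hom.intro module_hom_axioms.intro)
     (auto simp: single_def scale_seq_def fun_eq_iff module_iff_vector_space)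

lemma module_hom_coordinate: "module_hom smulJ smul (\<lambda>x. x n)"
  using vector_space_axioms JS.vector_space_axioms
  by (intro module_hom.intro module_hom_axioms.intro)
     (auto simp: scale_seq_def module_iff_vector_space)

lemma single_J:
  assumes v: "v \<in> X n"
  shows "single n v \<in> J" "N (single n v) \<le> nrm n v"
proof -
  have seqs: "single n v \<in> seqs" using v by (auto simp: seqs_def single_def)
  have "rho2 (single n v) l \<le> 2 * (nrm n v)\<^sup>2" if l: "sorted_wrt (<) l" for l
  proof -
    have "rho2 (single n v) l \<le> block_sq (single n v) (filter (\<lambda>j. n \<le> j \<and> j < Suc n) l)"
      using seqs l by (rule rho2_le_block_sq) (auto simp: single_def)
    also have "(\<lambda>j. n \<le> j \<and> j < Suc n) = (\<lambda>j. j = n)" by auto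
    also have "filter (\<lambda>j. j = n) l = [] \<or> filter (\<lambda>j. j = n) l = [n]"
    proof -
      have "distinct l" using l by (simp add: strict_sorted_iff)
      thus ?thesis by (induction l) (auto simp: filter_empty_conv)
    qed
    hence "block_sq (single n v) (filter (\<lambda>j. j = n) l) \<le> 2 * (nrm n v)\<^sup>2"
      by (auto simp: block_sq_def)
    finally show ?thesis .
  qed
  hence "single n v \<in> J_hat'" "N (single n v) \<le> nrm n v"
    using J_hatI[of "single n v" "nrm n v"] seqs B.nrm_nonneg[OF v] by auto
  moreover have "(\<lambda>j. nrm j (single n v j)) \<longlonglongrightarrow> 0"
    by (rule tendsto_eventually, rule eventually_sequentiallyI[of "Suc n"]) (simp add: single_def)
  ultimately show "single n v \<in> J" "N (single n v) \<le> nrm n v" by (auto simp: J_space_def)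
qed

definition restr :: "nat set \<Rightarrow> (nat \<Rightarrow> 'v) \<Rightarrow> nat \<Rightarrow> 'v" where
  "restr A x = (\<lambda>j. if j \<in> A then x j else 0)"

lemma restr_J:
  assumes x: "x \<in> seqs" and A: "finite A"
  shows "restr A x \<in> J" "N (restr A x) \<le> (\<Sum>j\<in>A. nrm j (x j))"
proof -
  have eq: "restr A x = (\<Sum>j\<in>A. single j (x j))"
  proof
    fix i
    have "(\<Sum>j\<in>A. single j (x j)) i = (\<Sum>j\<in>A. single j (x j) i)"
      using A by (induction A rule: finite_induct) auto
    also have "\<dots> = (\<Sum>j\<in>A. if j = i then x i else 0)"
      by (intro sum.cong) (auto simp: single_def)
    also have "\<dots> = restr A x i" using A by (simp add: restr_def)
    finally show "restr A x i = (\<Sum>j\<in>A. single j (x j)) i" by simp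
  qed
  show "restr A x \<in> J" unfolding eq using x by (intro JS.sum_mem single_J seqsD)
  have "N (\<Sum>j\<in>A. single j (x j)) \<le> (\<Sum>j\<in>A. N (single j (x j)))"
    using x by (intro JS.nrm_sum_le single_J seqsD)
  also have "\<dots> \<le> (\<Sum>j\<in>A. nrm j (x j))"
    using x by (intro sum_mono single_J(2) seqsD)
  finally show "N (restr A x) \<le> (\<Sum>j\<in>A. nrm j (x j))" by (simp add: eq)
qed

text \<open>
  Take a list on which \<open>var x\<close> is within \<open>e\<close> of its supremum.  Whatever is appended behind this list
  can increase \<open>var x\<close> only by less than \<open>e\<close>.
\<close>

lemma var_tail_small:
  assumes x: "x \<in> J" and e: "e > 0"
  obtains m where "\<And>l. sorted_wrt (<) l \<Longrightarrow> (\<And>j. j \<in> set l \<Longrightarrow> m \<le> j) \<Longrightarrow> var x l < e"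
proof -
  define A where "A = {l :: nat list. sorted_wrt (<) l}"
  have var_le: "var x l \<le> 2 * (N x)\<^sup>2" if "l \<in> A" for l
    using rho2_le_of_J_hat(1)[OF J_J_hat[OF x], of l] var_le_rho2[of x l] that by (simp add: A_def)
  hence bdd: "bdd_above (var x ` A)" by (rule bdd_aboveI2)
  have "[] \<in> A" by (simp add: A_def)
  hence "(SUP l\<in>A. var x l) - e < (SUP l\<in>A. var x l)" "A \<noteq> {}" using e by auto
  then obtain l0 where l0: "l0 \<in> A" "(SUP l\<in>A. var x l) - e < var x l0"
    using less_cSUP_iff[OF _ bdd] by blast
  show ?thesis
  proof (rule that)
    fix l assume l: "sorted_wrt (<) l" "\<And>j. j \<in> set l \<Longrightarrow> Suc (Max (set l0 \<union> {0})) \<le> j"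
    have "i < j" if "i \<in> set l0" "j \<in> set l" for i j
    proof -
      have "i \<le> Max (set l0 \<union> {0})" using that(1) by (intro Max_ge) auto
      thus ?thesis using l(2)[OF that(2)] by linarith
    qed
    hence "l0 @ l \<in> A" using l(1) l0(1) by (auto simp: A_def sorted_wrt_append)
    hence "var x (l0 @ l) \<le> (SUP l\<in>A. var x l)" by (rule cSUP_upper[OF _ bdd])
    moreover have "var x l0 + var x l \<le> var x (l0 @ l)" by (simp add: var_append)
    ultimately show "var x l < e" using l0(2) by linarith
  qed
qed

text \<open>
  On a list far out, \<open>var x\<close> is small by the previous lemma, and the entry and exit terms of the tail
  are small because the coordinates tend to zero.
\<close>

lemma J_tail_small:
  assumes x: "x \<in> J" and e: "e > 0"
  obtains m where "\<And>b. b \<ge> m \<Longrightarrow> N (x - restr {..<b} x) \<le> e"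
proof -
  have d: "(e / 2)\<^sup>2 > 0" using e by simp
  obtain m1 where m1: "\<And>l. sorted_wrt (<) l \<Longrightarrow> (\<And>j. j \<in> set l \<Longrightarrow> m1 \<le> j) \<Longrightarrow> var x l < (e / 2)\<^sup>2"
    using var_tail_small[OF x d] by blast
  have "(\<lambda>n. nrm n (x n)) \<longlonglongrightarrow> 0" using x by (simp add: J_space_def)
  hence "\<forall>\<^sub>F n in sequentially. nrm n (x n) < e / 2" using e by (intro order_tendstoD(2)) auto
  then obtain m2 where m2: "\<And>n. n \<ge> m2 \<Longrightarrow> nrm n (x n) < e / 2" by (auto simp: eventually_sequentially)
  have m2': "(nrm n (x n))\<^sup>2 \<le> (e / 2)\<^sup>2" if "n \<ge> m2" for n
    using m2[OF that] B.nrm_nonneg[OF J_mem[OF x]] by (intro power_mono) auto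
  show ?thesis
  proof (rule that)
    fix b assume b: "b \<ge> max m1 m2"
    define y where "y = x - restr {..<b} x"
    have yJ: "y \<in> J" unfolding y_def using x restr_J(1)[OF J_seqs[OF x]] by (intro JS.diff_mem) auto
    have y_eq: "y j = (if b \<le> j then x j else 0)" for j by (simp add: y_def restr_def)
    (* The block is infinite; on the given list its right end may be any bound of the list. *)
    have "rho2 y l \<le> 2 * e\<^sup>2" if l: "sorted_wrt (<) l" for l
    proof -
      define l1 where "l1 = filter (\<lambda>j. b \<le> j \<and> j < Suc (Max (set l \<union> {0}))) l"
      have "rho2 y l \<le> block_sq y l1"
        unfolding l1_def using J_seqs[OF yJ] l by (rule rho2_le_block_sq) (auto simp: y_eq less_Suc_eq_le)
      also have "block_sq y l1 \<le> 3 * (e / 2)\<^sup>2"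
      proof (cases "l1 = []")
        case False
        have ge: "j \<ge> b" if "j \<in> set l1" for j using that by (simp add: l1_def)
        have "var y l1 = var x l1" using ge by (intro var_cong) (simp add: y_eq)
        moreover have "var x l1 < (e / 2)\<^sup>2"
          using l ge b by (intro m1) (auto simp: l1_def intro!: sorted_wrt_filter)
        ultimately have "var y l1 \<le> (e / 2)\<^sup>2" by simp
        moreover have "last_sq y l1 \<le> (e / 2)\<^sup>2"
          using False ge[OF last_in_set[OF False]] b m2'[of "last l1"] by (simp add: last_sq_def y_eq)
        moreover have "(nrm (hd l1) (y (hd l1)))\<^sup>2 \<le> (e / 2)\<^sup>2"
          using False ge[OF hd_in_set[OF False]] b m2'[of "hd l1"] by (simp add: y_eq)
        ultimately show ?thesis using False by (simp add: block_sq_def rho2_def)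
      qed (simp add: block_sq_def)
      also have "\<dots> \<le> 2 * e\<^sup>2" by (simp add: power_divide)
      finally show ?thesis .
    qed
    thus "N (x - restr {..<b} x) \<le> e"
      using J_hatI(2)[of y e] J_seqs[OF yJ] e by (simp add: y_def)
  qed
qed

lemma blocks_ordered:
  fixes s q :: "nat \<Rightarrow> nat"
  assumes "\<And>k. s k < q k" "\<And>k. q k \<le> s (Suc k)" "k < n"
  shows "q k \<le> s n"
  using assms(3)
proof (induction n)
  case (Suc n)
  thus ?case using assms(2)[of n] assms(1)[of n] by (cases "k = n") auto
qed simp

text \<open>
  Induction on the number of blocks: cut the list at the left end of the last block.  The one difference
  across the cut is split by \<open>(a + b)\<^sup>2 \<le> 2 * a\<^sup>2 + 2 * b\<^sup>2\<close>.  To absorb the first half the induction is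
  done for \<open>var + 2 * last_sq\<close>; the second half and the last block itself cost \<open>8 * (N (w n))\<^sup>2\<close>.
\<close>

lemma block_sum_bound:
  assumes w: "\<And>k. w k \<in> J"
    and supp: "\<And>k j. w k j \<noteq> 0 \<Longrightarrow> s k < j \<and> j < q k" and sq: "\<And>k. s k < q k" "\<And>k. q k \<le> s (Suc k)"
  shows "(N (\<Sum>k<n. w k))\<^sup>2 \<le> 4 * (\<Sum>k<n. (N (w k))\<^sup>2)"
proof -
  note s_mono = blocks_ordered[of s q, OF sq]
  have sumJ: "(\<Sum>k<n. w k) \<in> J" for n using w by (intro JS.sum_mem)
  have sum_zero: "(\<Sum>k<n. w k) j = 0" if "s n \<le> j" for n j
  proof -
    have "w k j = 0" if "k < n" for k
      using supp[of k j] s_mono[OF that] \<open>s n \<le> j\<close> by force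
    moreover have "(\<Sum>k<n. w k) j = (\<Sum>k<n. w k j)" by (induction n) auto
    ultimately show ?thesis by simp
  qed
  have var_sum: "var (\<Sum>k<n. w k) l + 2 * last_sq (\<Sum>k<n. w k) l \<le> 8 * (\<Sum>k<n. (N (w k))\<^sup>2)"
    if l: "sorted_wrt (<) l" for l n
    using l
  proof (induction n arbitrary: l)
    case 0
    have "var (\<lambda>_. 0) l = 0" using 0 by (intro var_zero) auto
    thus ?case by (simp add: last_sq_def zero_fun_def)
  next
    case (Suc n)
    define y where "y = (\<Sum>k<n. w k)"
    define z where "z = (\<Sum>k<Suc n. w k)"
    have z: "z = y + w n" by (simp add: z_def y_def)
    define l0 where "l0 = filter (\<lambda>j. j < Suc (s n)) l"
    define l1 where "l1 = filter (\<lambda>j. Suc (s n) \<le> j) l"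
    have l: "l = l0 @ l1" unfolding l0_def l1_def by (rule sorted_split[OF Suc.prems])
    have sorted: "sorted_wrt (<) l0" "sorted_wrt (<) l1"
      using Suc.prems by (auto simp: l0_def l1_def intro: sorted_wrt_filter)
    have z0: "z j = y j" if "j \<in> set l0" for j
      using that supp[of n j] by (auto simp: z l0_def)
    have z1: "z j = w n j" if "j \<in> set l1" for j
      using that sum_zero[of n j] by (auto simp: z y_def l1_def)
    have vars: "var z l0 = var y l0" "var z l1 = var (w n) l1"
      "last_sq z l0 = last_sq y l0" "last_sq z l1 = last_sq (w n) l1"
      using z0 z1 by (auto intro!: var_cong last_sq_cong)
    have IH: "var y l0 + 2 * last_sq y l0 \<le> 8 * (\<Sum>k<n. (N (w k))\<^sup>2)"
      using Suc.IH[OF sorted(1)] by (simp add: y_def)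
    show ?case
    proof (cases "l1 = []")
      case True
      hence "l = l0" using l by simp
      moreover have "(\<Sum>k<n. (N (w k))\<^sup>2) \<le> (\<Sum>k<Suc n. (N (w k))\<^sup>2)" by simp
      ultimately show ?thesis using IH vars unfolding z_def[symmetric] \<open>l = l0\<close> by linarith
    next
      case False
      have wn: "rho2 (w n) l1 \<le> 2 * (N (w n))\<^sup>2"
        using rho2_le_of_J_hat(1)[OF J_J_hat[OF w] sorted(2)] .
      have last: "last_sq (w n) l1 \<le> 2 * (N (w n))\<^sup>2"
        using False last_sq_le[OF J_J_hat[OF w]] by (simp add: last_sq_def)
      have hd: "(nrm (hd l1) (w n (hd l1)))\<^sup>2 \<le> 2 * (N (w n))\<^sup>2"
        by (rule last_sq_le[OF J_J_hat[OF w]])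
      have "jump z (last l0) (hd l1) \<le> 2 * last_sq y l0 + 2 * (nrm (hd l1) (w n (hd l1)))\<^sup>2" if ne: "l0 \<noteq> []"
      proof -
        have "last l0 \<le> hd l1"
          using last_in_set[OF ne] hd_in_set[OF False] by (auto simp: l0_def l1_def)
        hence "jump z (last l0) (hd l1) \<le> 2 * (nrm (last l0) (z (last l0)))\<^sup>2 + 2 * (nrm (hd l1) (z (hd l1)))\<^sup>2"
          using sumJ[of "Suc n"] by (intro jump_le J_seqs) (simp_all only: z_def)
        thus ?thesis using z0[OF last_in_set[OF ne]] z1[OF hd_in_set[OF False]] ne by (simp add: last_sq_def)
      qed
      hence "var z l + 2 * last_sq z l
             \<le> var y l0 + 2 * last_sq y l0 + 2 * (nrm (hd l1) (w n (hd l1)))\<^sup>2 + var (w n) l1 + 2 * last_sq (w n) l1"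
        using False vars by (auto simp: l var_append last_sq_append add_increasing)
      also have "\<dots> \<le> 8 * (\<Sum>k<n. (N (w k))\<^sup>2) + 8 * (N (w n))\<^sup>2"
        using IH wn last hd by (simp add: rho2_def)
      finally show ?thesis unfolding z_def[symmetric] sum.lessThan_Suc[of "\<lambda>k. (N (w k))\<^sup>2"] by (simp only: distrib_left)
    qed
  qed
  have rho2_sum: "rho2 (\<Sum>k<n. w k) l \<le> 8 * (\<Sum>k<n. (N (w k))\<^sup>2)" if "sorted_wrt (<) l" for l
    using var_sum[OF that, of n] last_sq_nonneg[of "\<Sum>k<n. w k" l] unfolding rho2_def by linarith
  define K where "K = 2 * sqrt (\<Sum>k<n. (N (w k))\<^sup>2)"
  have K2: "K\<^sup>2 = 4 * (\<Sum>k<n. (N (w k))\<^sup>2)"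
    by (simp add: K_def power_mult_distrib sum_nonneg)
  have "N (\<Sum>k<n. w k) \<le> K"
    using rho2_sum by (intro J_hatI(2) J_seqs sumJ) (auto simp: K2 K_def sum_nonneg)
  thus ?thesis using power_mono[OF _ JS.nrm_nonneg[OF sumJ], of n K 2] K2 by simp
qed

section \<open>Recentring on disjoint intervals\<close>

text \<open>
  Plain restriction to an interval is useless for a lower estimate: the vector may have large, slowly
  varying coordinates, so that every restriction to an interval has a large norm.  Subtracting the
  transported value at the left end \<open>s\<close> removes this and keeps vectors that vanish at \<open>s\<close>.
\<close>

definition recentre :: "nat \<Rightarrow> nat \<Rightarrow> (nat \<Rightarrow> 'v) \<Rightarrow> nat \<Rightarrow> 'v" where
  "recentre s q x = (\<lambda>j. if s < j \<and> j < q then x j - tr s j (x s) else 0)"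

lemma recentre_seqs: "x \<in> seqs \<Longrightarrow> recentre s q x \<in> seqs"
  by (auto simp: seqs_def recentre_def intro!: B.diff_mem tr_mem)

lemma recentre_add: "x \<in> seqs \<Longrightarrow> y \<in> seqs \<Longrightarrow> recentre s q (x + y) = recentre s q x + recentre s q y"
  by (auto simp: recentre_def fun_eq_iff tr_add seqsD)

lemma recentre_scale: "x \<in> seqs \<Longrightarrow> recentre s q (smulJ c x) = smulJ c (recentre s q x)"
  by (auto simp: recentre_def scale_seq_def fun_eq_iff tr_scale seqsD scale_right_diff_distrib)

text \<open>
  The subtracted sequence is transported into itself by the transition maps, so it cancels in every difference.
\<close>

lemma var_recentre:
  assumes x: "x \<in> seqs" and l: "sorted_wrt (<) l" "\<And>j. j \<in> set l \<Longrightarrow> s < j \<and> j < q"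
  shows "var (recentre s q x) l = var x l"
  using l
proof (induction l rule: induct_list012)
  case (3 i j l)
  have ij: "s < i" "i < q" "s < j" "j < q" "i \<le> j" "s \<le> i" "s \<le> j" using 3 by force+
  have "tr i j (x i - tr s i (x s)) - (x j - tr s j (x s)) = tr i j (x i) - x j"
    using ij seqsD[OF x] tr_mem[OF ij(6) seqsD[OF x]] by (simp add: tr_diff tr_tr)
  moreover have "recentre s q x i = x i - tr s i (x s)" "recentre s q x j = x j - tr s j (x s)"
    using ij by (simp_all add: recentre_def)
  ultimately have "jump (recentre s q x) i j = jump x i j"
    by (simp only: jump_def)
  thus ?case using 3 by simp
qed auto

text \<open>
  The boundary terms of the recentred vector at an index \<open>j\<close> have the size of the difference of \<open>x\<close> between \<open>s\<close>
  and \<open>j\<close>.  So \<open>rho2\<close> of the recentred vector is bounded by the variation of \<open>x\<close> over two lists in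
  \<open>{s..<q}\<close>; a list that maximises the variation among the finitely many serves for both.
\<close>

lemma recentre_J:
  assumes x: "x \<in> seqs"
  shows "recentre s q x \<in> J"
    and "\<exists>l. sorted_wrt (<) l \<and> set l \<subseteq> {s..<q} \<and> (N (recentre s q x))\<^sup>2 \<le> var x l"
proof -
  define y where "y = recentre s q x"
  have y_seqs: "y \<in> seqs" unfolding y_def by (rule recentre_seqs[OF x])
  define A where "A = {l. sorted_wrt (<) l \<and> set l \<subseteq> {s..<q}}"
  have "A \<subseteq> {l. set l \<subseteq> {s..<q} \<and> distinct l}" by (auto simp: A_def strict_sorted_iff)
  hence "finite A" by (rule finite_subset) (rule finite_subset_distinct, simp)
  moreover have "[] \<in> A" by (simp add: A_def)
  ultimately obtain m where m: "m \<in> A" "\<And>l. l \<in> A \<Longrightarrow> var x l \<le> var x m"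
  proof -
    have fin: "finite (var x ` A)" and ne: "var x ` A \<noteq> {}"
      using \<open>finite A\<close> \<open>[] \<in> A\<close> by auto
    obtain m where "m \<in> A" "var x m = Max (var x ` A)" using Max_in[OF fin ne] by auto
    with that[of m] Max_ge[OF fin] show ?thesis by auto
  qed
  have "rho2 y l \<le> 2 * (sqrt (var x m))\<^sup>2" if l: "sorted_wrt (<) l" for l
  proof -
    define l1 where "l1 = filter (\<lambda>j. Suc s \<le> j \<and> j < q) l"
    have "rho2 y l \<le> block_sq y l1"
      unfolding l1_def using y_seqs l by (rule rho2_le_block_sq) (auto simp: y_def recentre_def)
    also have "\<dots> \<le> 2 * var x m"
    proof (cases "l1 = []")
      case False
      have l1: "sorted_wrt (<) l1" "\<And>j. j \<in> set l1 \<Longrightarrow> s < j \<and> j < q"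
        using l by (auto simp: l1_def intro: sorted_wrt_filter)
      have nrm_y: "(nrm j (y j))\<^sup>2 = jump x s j" if "j \<in> set l1" for j
      proof -
        have j: "s < j" "j < q" "s \<le> j" using l1(2)[OF that] by auto
        have "nrm j (x j - tr s j (x s)) = nrm j (tr s j (x s) - x j)"
          using j x by (intro B.nrm_minus_commute tr_mem seqsD) auto
        thus ?thesis using j by (simp add: y_def recentre_def jump_def)
      qed
      have "block_sq y l1 = jump x s (hd l1) + var x l1 + jump x s (last l1)"
        using False nrm_y[OF hd_in_set[OF False]] nrm_y[OF last_in_set[OF False]] var_recentre[OF x l1]
        by (simp add: block_sq_def rho2_def last_sq_def y_def)
      also have "jump x s (hd l1) + var x l1 = var x (s # l1)"
        using False by (cases l1) auto
      also have "jump x s (last l1) = var x [s, last l1]" by simp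
      also have "var x (s # l1) \<le> var x m"
      proof (rule m(2))
        have "s < q" using l1(2)[OF hd_in_set[OF False]] by simp
        moreover have "s < j \<and> s \<le> j \<and> j < q" if "j \<in> set l1" for j using l1(2)[OF that] by simp
        ultimately show "s # l1 \<in> A" using l1(1) by (auto simp: A_def)
      qed
      also have "var x [s, last l1] \<le> var x m"
        using l1(2)[OF last_in_set[OF False]] by (intro m(2)) (auto simp: A_def)
      finally show ?thesis by simp
    qed (simp add: block_sq_def)
    finally show ?thesis by simp
  qed
  hence "y \<in> J_hat'" "N y \<le> sqrt (var x m)" using J_hatI[OF y_seqs, of "sqrt (var x m)"] by auto
  hence "(N y)\<^sup>2 \<le> (sqrt (var x m))\<^sup>2" using N_nonneg by (intro power_mono) auto
  moreover have "(\<lambda>j. nrm j (y j)) \<longlonglongrightarrow> 0"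
    by (rule tendsto_eventually, rule eventually_sequentiallyI[of q]) (simp add: y_def recentre_def)
  hence "y \<in> J" using \<open>y \<in> J_hat'\<close> by (simp add: J_space_def)
  ultimately show "recentre s q x \<in> J"
    "\<exists>l. sorted_wrt (<) l \<and> set l \<subseteq> {s..<q} \<and> (N (recentre s q x))\<^sup>2 \<le> var x l"
    using m(1) by (auto simp: A_def y_def)
qed

text \<open>
  Concatenate the lists that the previous lemma gives for the consecutive intervals.
\<close>

lemma recentre_square_sum:
  assumes x: "x \<in> J" and sq: "\<And>k. s k < q k" "\<And>k. q k \<le> s (Suc k)"
  shows "(\<Sum>k<n. (N (recentre (s k) (q k) x))\<^sup>2) \<le> 2 * (N x)\<^sup>2"
proof -
  have "\<exists>L. sorted_wrt (<) L \<and> (\<forall>j\<in>set L. j < s n) \<and>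
          (\<Sum>k<n. (N (recentre (s k) (q k) x))\<^sup>2) \<le> var x L"
  proof (induction n)
    case 0
    show ?case by (rule exI[of _ "[]"]) simp
  next
    case (Suc n)
    then obtain L where L: "sorted_wrt (<) L" "\<forall>j\<in>set L. j < s n"
      "(\<Sum>k<n. (N (recentre (s k) (q k) x))\<^sup>2) \<le> var x L" by blast
    obtain l where l: "sorted_wrt (<) l" "set l \<subseteq> {s n..<q n}" "(N (recentre (s n) (q n) x))\<^sup>2 \<le> var x l"
      using recentre_J(2)[OF J_seqs[OF x], of "s n" "q n"] by blast
    have "i < j" if "i \<in> set L" "j \<in> set l" for i j
      using that L(2) l(2) by force
    hence "sorted_wrt (<) (L @ l)" using L l by (simp add: sorted_wrt_append)
    moreover have "\<forall>j\<in>set (L @ l). j < s (Suc n)"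
    proof
      fix j assume "j \<in> set (L @ l)"
      hence "j < s n \<or> j < q n" using L(2) l(2) by auto
      thus "j < s (Suc n)" using sq(1)[of n] sq(2)[of n] by linarith
    qed
    moreover have "(\<Sum>k<Suc n. (N (recentre (s k) (q k) x))\<^sup>2) \<le> var x (L @ l)"
      using L(3) l(3) by (simp add: var_append add_increasing2)
    ultimately show ?case by blast
  qed
  then obtain L where "sorted_wrt (<) L" "(\<Sum>k<n. (N (recentre (s k) (q k) x))\<^sup>2) \<le> var x L" by blast
  thus ?thesis using rho2_le_of_J_hat(1)[OF J_J_hat[OF x], of L] var_le_rho2[of x L] by linarith
qed

end

context james_space
begin

section \<open>Subspaces of the James-type space\<close>

definition head :: "nat \<Rightarrow> (nat \<Rightarrow> 'v) \<Rightarrow> real" where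
  "head b x = (\<Sum>i<b. nrm i (x i))"

lemma head_nonneg: "x \<in> seqs \<Longrightarrow> head b x \<ge> 0"
  unfolding head_def by (intro sum_nonneg B.nrm_nonneg seqsD)

lemma head_add: "x \<in> seqs \<Longrightarrow> y \<in> seqs \<Longrightarrow> head b (x + y) \<le> head b x + head b y"
  unfolding head_def sum.distrib[symmetric] by (intro sum_mono) (simp add: B.nrm_triangle seqsD)

lemma head_scale: "x \<in> seqs \<Longrightarrow> head b (smulJ c x) = norm c * head b x"
  unfolding head_def sum_distrib_left by (intro sum.cong) (auto simp: scale_seq_def B.nrm_scale seqsD)

abbreviation contains_complemented :: "(nat \<Rightarrow> 'v) set \<Rightarrow> bool" where
  "contains_complemented M \<equiv> \<exists>W. JS.subspace W \<and> W \<subseteq> M \<and> \<not> finite_dim smulJ W \<and>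
     complemented_in smulJ J N W"

text \<open>
  Cut off the first \<open>s + 1\<close> coordinates, which are small by the choice of \<open>x\<close>, and a small tail.  The
  coordinate at \<open>s\<close> is removed as well, because \<open>s\<close> serves as the base point for recentring.
\<close>

lemma almost_block_exists:
  assumes M: "JS.subspace M" "M \<subseteq> J"
    and unb: "\<And>b c. \<exists>x\<in>M. c * head b x < N x" and e: "e > 0"
  obtains x q where "x \<in> M" "N x = 1" "s < q" "N (x - restr {Suc s..<q} x) \<le> e"
proof -
  obtain x0 where x0: "x0 \<in> M" "(2 / e) * head (Suc s) x0 < N x0" using unb by blast
  have x0J: "x0 \<in> J" using x0 M by blast
  have "(2 / e) * head (Suc s) x0 \<ge> 0" using head_nonneg[OF J_seqs[OF x0J]] e by simp
  with x0 have N0: "N x0 > 0" by linarith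
  define x where "x = smulJ (of_real (1 / N x0)) x0"
  have x: "x \<in> M" "x \<in> J" "N x = 1"
    using x0 N0 M x0J JS.nrm_scale_real[OF x0J, of "1 / N x0"]
    by (auto simp: x_def JS.subspace_scale JS.scale_mem simp del: of_real_divide)
  have "head (Suc s) x = head (Suc s) x0 / N x0"
    using head_scale[OF J_seqs[OF x0J]] N0 by (simp add: x_def norm_divide)
  also have "\<dots> \<le> e / 2" using x0(2) N0 e by (simp add: field_simps)
  finally have head: "head (Suc s) x \<le> e / 2" .
  obtain m where m: "\<And>b. b \<ge> m \<Longrightarrow> N (x - restr {..<b} x) \<le> e / 2"
    using J_tail_small[OF x(2), of "e / 2"] e by auto
  define q where "q = max m (Suc s)"
  have restr: "restr A x \<in> J" if "finite A" for A using restr_J(1)[OF J_seqs[OF x(2)] that] .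
  have "x - restr {Suc s..<q} x = (x - restr {..<q} x) + restr {..<Suc s} x"
    by (auto simp: restr_def fun_eq_iff q_def)
  moreover have "N ((x - restr {..<q} x) + restr {..<Suc s} x) \<le> N (x - restr {..<q} x) + N (restr {..<Suc s} x)"
    by (intro JS.nrm_triangle JS.diff_mem x(2) restr finite_lessThan)
  ultimately have "N (x - restr {Suc s..<q} x) \<le> N (x - restr {..<q} x) + N (restr {..<Suc s} x)"
    by (simp only:)
  also have "\<dots> \<le> e / 2 + e / 2"
    using m[of q] restr_J(2)[OF J_seqs[OF x(2)], of "{..<Suc s}"] head
    by (intro add_mono) (auto simp: q_def head_def)
  finally show ?thesis using that[of x q] x by (simp add: q_def)
qed

lemma almost_blocks_exist:
  assumes M: "JS.subspace M" "M \<subseteq> J"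
    and unb: "\<And>b c. \<exists>x\<in>M. c * head b x < N x" and e: "\<And>k. e k > 0"
  shows "\<exists>x s q. \<forall>k. x k \<in> M \<and> N (x k) = 1 \<and> s k < q k \<and> q k \<le> s (Suc k) \<and>
           N (x k - restr {Suc (s k)..<q k} (x k)) \<le> e k"
proof -
  define P where "P k = (\<lambda>(x, s, q). x \<in> M \<and> N x = 1 \<and> s < q \<and> N (x - restr {Suc s..<q} x) \<le> e k)" for k
  have "\<exists>t. \<forall>k. P k (t k) \<and> snd (snd (t k)) = fst (snd (t (Suc k)))"
  proof (rule dependent_nat_choice)
    obtain x q where "x \<in> M" "N x = 1" "0 < q" "N (x - restr {Suc 0..<q} x) \<le> e 0"
      using almost_block_exists[OF M unb e[of 0], of 0] by blast
    thus "\<exists>t. P 0 t" by (intro exI[of _ "(x, 0, q)"]) (simp add: P_def)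
  next
    fix t k assume "P k t"
    obtain x q where "x \<in> M" "N x = 1" "snd (snd t) < q"
      "N (x - restr {Suc (snd (snd t))..<q} x) \<le> e (Suc k)"
      using almost_block_exists[OF M unb e[of "Suc k"], of "snd (snd t)"] by blast
    thus "\<exists>t'. P (Suc k) t' \<and> snd (snd t) = fst (snd t')"
      by (intro exI[of _ "(x, snd (snd t), q)"]) (simp add: P_def)
  qed
  then obtain t where t: "\<And>k. P k (t k)" "\<And>k. snd (snd (t k)) = fst (snd (t (Suc k)))" by blast
  have P: "fst (t k) \<in> M \<and> N (fst (t k)) = 1 \<and> fst (snd (t k)) < snd (snd (t k)) \<and>
      N (fst (t k) - restr {Suc (fst (snd (t k)))..<snd (snd (t k))} (fst (t k))) \<le> e k" for k
    using t(1)[of k] by (cases "t k" rule: prod_cases3) (simp add: P_def)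
  show ?thesis
    by (rule exI[of _ "\<lambda>k. fst (t k)"], rule exI[of _ "\<lambda>k. fst (snd (t k))"],
        rule exI[of _ "\<lambda>k. snd (snd (t k))"]) (use P t(2) in \<open>simp only: order.refl simp_thms\<close>)
qed

text \<open>
  The functional \<open>g k\<close> is a rescaled functional that norms the block \<open>u k\<close>, applied to the vector recentred on the
  \<open>k\<close>-th interval.  Recentring fixes \<open>u k\<close> and annihilates the other blocks, which vanish on
  \<open>{s k..<q k}\<close>.  The squares of the \<open>g k v\<close> are summable with sum at most
  \<open>128 * (N v)\<^sup>2\<close>, and the upper estimate for blocks makes the series of the \<open>g k v \<cdot> x k\<close>
  convergent.
\<close>

lemma complemented_of_unbounded_head:
  assumes M: "JS.subspace M" "M \<subseteq> J" "JS.near_closed M"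
    and unb: "\<And>b c. \<exists>x\<in>M. c * head b x < N x"
  shows "contains_complemented M"
proof -
  (* The perturbation result is applied with C = 12 and K = 60, so the total perturbation may be
     at most 1/2880. *)
  define e :: "nat \<Rightarrow> real" where "e k = (1 / 6000) * (1 / 2) ^ k" for k
  have e_pos: "e k > 0" for k by (simp add: e_def)
  have e_sum: "(\<Sum>k<n. e k) \<le> 1 / 3000" for n
    unfolding e_def sum_distrib_left[symmetric] by (simp add: sum_gp_strict)
  have e_small: "e k \<le> 1 / 2" for k
    using power_le_one[of "1 / 2 :: real" k] by (simp add: e_def)
  obtain x s q where xsq: "\<forall>k. x k \<in> M \<and> N (x k) = 1 \<and> s k < q k \<and> q k \<le> s (Suc k) \<and>
      N (x k - restr {Suc (s k)..<q k} (x k)) \<le> e k"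
    using almost_blocks_exist[where e = e, OF M(1,2) unb e_pos] by blast
  hence x: "\<And>k. x k \<in> M" "\<And>k. N (x k) = 1" and sq: "\<And>k. s k < q k" "\<And>k. q k \<le> s (Suc k)"
    and close: "\<And>k. N (x k - restr {Suc (s k)..<q k} (x k)) \<le> e k"
    by simp_all
  note s_mono = blocks_ordered[of s q, OF sq]
  have xJ: "x k \<in> J" for k using x M by blast
  define u where "u k = restr {Suc (s k)..<q k} (x k)" for k
  have uJ: "u k \<in> J" for k unfolding u_def by (intro restr_J J_seqs xJ) simp
  have u_supp: "s k < j \<and> j < q k" if "u k j \<noteq> 0" for k j
    using that by (auto simp: u_def restr_def split: if_splits)
  have xu: "N (x k - u k) \<le> e k" for k using close by (simp add: u_def)
  have u_ge: "N (u k) \<ge> 1 / 2" for k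
    using JS.nrm_diff_ge[OF xJ uJ, of k k] xu[of k] e_small[of k] x(2)[of k] by simp
  have u_le: "N (u k) \<le> 2" for k
    using JS.nrm_diff_ge[OF uJ xJ, of k k] JS.nrm_minus_commute[OF xJ uJ, of k k] xu[of k] e_small[of k] x(2)[of k]
    by simp
  have "\<exists>f. JS.functional_on J f \<and> (\<forall>y\<in>J. norm (f y) \<le> 4 * N y) \<and> f (u k) = of_real (N (u k))" for k
    using JS.Hahn_Banach_functional[OF uJ[of k]] by metis
  then obtain f where f: "\<And>k. JS.functional_on J (f k)" "\<And>k y. y \<in> J \<Longrightarrow> norm (f k y) \<le> 4 * N y"
    "\<And>k. f k (u k) = of_real (N (u k))" by metis
  define R where "R k = recentre (s k) (q k)" for k
  define g where "g k v = f k (R k v) / of_real (N (u k))" for k v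
  have RJ: "R k v \<in> J" if "v \<in> J" for k v unfolding R_def using that by (intro recentre_J(1) J_seqs)
  have g_fun: "JS.functional_on J (g k)" for k
    unfolding JS.functional_on_def
  proof (intro conjI ballI allI)
    fix v w assume vw: "v \<in> J" "w \<in> J"
    have "R k (v + w) = R k v + R k w" unfolding R_def using vw by (intro recentre_add J_seqs)
    thus "g k (v + w) = g k v + g k w"
      using vw RJ by (simp add: g_def JS.functional_on_add[OF f(1)] add_divide_distrib)
  next
    fix c v assume v: "v \<in> J"
    have "R k (smulJ c v) = smulJ c (R k v)"
      unfolding R_def using v by (intro recentre_scale J_seqs)
    thus "g k (smulJ c v) = c * g k v"
      using v RJ by (simp add: g_def JS.functional_on_scale[OF f(1)])
  qed
  have g_le: "norm (g k v) \<le> 8 * N (R k v)" if v: "v \<in> J" for k v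
  proof -
    have "norm (g k v) = norm (f k (R k v)) / N (u k)"
      using u_ge[of k] by (simp add: g_def norm_divide)
    also have "\<dots> \<le> (4 * N (R k v)) / (1 / 2)"
      using f(2)[OF RJ[OF v]] u_ge[of k] JS.nrm_nonneg[OF RJ[OF v]] by (intro frac_le) auto
    finally show ?thesis by simp
  qed
  have g_sq: "(\<Sum>k<n. (norm (g k v))\<^sup>2) \<le> 128 * (N v)\<^sup>2" if v: "v \<in> J" for n v
  proof -
    have "(\<Sum>k<n. (norm (g k v))\<^sup>2) \<le> (\<Sum>k<n. (8 * N (R k v))\<^sup>2)"
      using g_le[OF v] by (intro sum_mono power_mono) auto
    also have "\<dots> = 64 * (\<Sum>k<n. (N (R k v))\<^sup>2)" by (simp add: power_mult_distrib sum_distrib_left)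
    also have "\<dots> \<le> 64 * (2 * (N v)\<^sup>2)"
      unfolding R_def using recentre_square_sum[where s = s and q = q, OF v sq] by (intro mult_left_mono) auto
    finally show ?thesis by simp
  qed
  have biorth: "g k (u l) = (if k = l then 1 else 0)" for k l
  proof -
    consider "k = l" | "k < l" | "l < k" by linarith
    thus ?thesis
    proof cases
      case 1
      have "u k (s k) = 0" using u_supp[of k "s k"] by auto
      hence "R k (u k) = u k"
        using u_supp[of k] by (auto simp: R_def recentre_def fun_eq_iff)
      thus ?thesis using 1 f(3)[of k] u_ge[of k] by (simp add: g_def)
    next
      case 2
      have "u l j = 0" if "j < q k" for j using u_supp[of l j] s_mono[OF 2] that by force
      hence "R k (u l) = 0" using sq(1)[of k] by (auto simp: R_def recentre_def fun_eq_iff)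
      thus ?thesis using 2 JS.functional_on_scale[OF f(1) JS.zero_mem, of k 0] by (simp add: g_def)
    next
      case 3
      have "u l j = 0" if "s k \<le> j" for j using u_supp[of l j] s_mono[OF 3] that by force
      hence "R k (u l) = 0" by (auto simp: R_def recentre_def fun_eq_iff)
      thus ?thesis using 3 JS.functional_on_scale[OF f(1) JS.zero_mem, of k 0] by (simp add: g_def)
    qed
  qed
  have upper: "N (\<Sum>k\<in>{m..<n}. smulJ (a k) (x k)) \<le> 5 * sqrt (\<Sum>k\<in>{m..<n}. (norm (a k))\<^sup>2)"
    for a m n
  proof -
    define A where "A = sqrt (\<Sum>k\<in>{m..<n}. (norm (a k))\<^sup>2)"
    have A: "A \<ge> 0" "A\<^sup>2 = (\<Sum>k\<in>{m..<n}. (norm (a k))\<^sup>2)" by (auto simp: A_def sum_nonneg)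
    define w where "w k = (if m \<le> k then smulJ (a k) (u k) else 0)" for k
    have wJ: "w k \<in> J" for k using uJ by (auto simp: w_def JS.scale_mem)
    have w_sum: "(\<Sum>k<n. w k) = (\<Sum>k\<in>{m..<n}. smulJ (a k) (u k))"
      by (rule sum.mono_neutral_cong_right) (auto simp: w_def)
    have "(N (\<Sum>k<n. w k))\<^sup>2 \<le> 4 * (\<Sum>k<n. (N (w k))\<^sup>2)"
    proof (rule block_sum_bound[where s = s and q = q, OF wJ _ sq])
      fix k j assume "w k j \<noteq> 0"
      hence "u k j \<noteq> 0" by (auto simp: w_def scale_seq_def split: if_splits)
      thus "s k < j \<and> j < q k" by (rule u_supp)
    qed
    also have "(\<Sum>k<n. (N (w k))\<^sup>2) = (\<Sum>k\<in>{m..<n}. (norm (a k) * N (u k))\<^sup>2)"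
      by (rule sum.mono_neutral_cong_right) (auto simp: w_def N_0 JS.nrm_scale uJ)
    also have "\<dots> \<le> (\<Sum>k\<in>{m..<n}. (norm (a k) * 2)\<^sup>2)"
      using u_le JS.nrm_nonneg[OF uJ] by (intro sum_mono power_mono mult_left_mono) auto
    also have "\<dots> = 4 * A\<^sup>2" by (simp add: A power_mult_distrib sum_distrib_left mult.commute)
    finally have "(N (\<Sum>k<n. w k))\<^sup>2 \<le> (4 * A)\<^sup>2" by (simp add: power_mult_distrib)
    hence 1: "N (\<Sum>k\<in>{m..<n}. smulJ (a k) (u k)) \<le> 4 * A"
      using A power2_le_imp_le[of "N (\<Sum>k<n. w k)" "4 * A"] w_sum by simp
    have "N (\<Sum>k\<in>{m..<n}. smulJ (a k) (x k - u k)) \<le> (\<Sum>k\<in>{m..<n}. norm (a k) * N (x k - u k))"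
      using xJ uJ by (intro JS.nrm_scaled_sum_le) (simp add: JS.diff_mem)
    also have "\<dots> \<le> (\<Sum>k\<in>{m..<n}. \<bar>norm (a k)\<bar> * \<bar>e k\<bar>)"
      using xu e_pos by (intro sum_mono) (auto intro!: mult_left_mono order.trans[OF xu])
    also have "\<dots> \<le> L2_set (\<lambda>k. norm (a k)) {m..<n} * L2_set e {m..<n}"
      by (rule L2_set_mult_ineq)
    also have "L2_set (\<lambda>k. norm (a k)) {m..<n} = A" by (simp add: L2_set_def A_def)
    also have "L2_set e {m..<n} \<le> 1"
    proof -
      have "L2_set e {m..<n} \<le> (\<Sum>k\<in>{m..<n}. e k)"
        using e_pos by (intro L2_set_le_sum) (auto intro: less_imp_le)
      also have "\<dots> \<le> (\<Sum>k<n. e k)"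
        using e_pos by (intro sum_mono2) (auto intro: less_imp_le)
      also have "\<dots> \<le> 1" using e_sum[of n] by simp
      finally show ?thesis .
    qed
    hence "A * L2_set e {m..<n} \<le> A * 1" using A by (intro mult_left_mono) auto
    finally have 2: "N (\<Sum>k\<in>{m..<n}. smulJ (a k) (x k - u k)) \<le> A" by (simp only: mult_1_right)
    have "(\<Sum>k\<in>{m..<n}. smulJ (a k) (x k))
          = (\<Sum>k\<in>{m..<n}. smulJ (a k) (u k)) + (\<Sum>k\<in>{m..<n}. smulJ (a k) (x k - u k))"
      by (simp add: JS.scale_right_diff_distrib sum_subtractf)
    hence "N (\<Sum>k\<in>{m..<n}. smulJ (a k) (x k)) \<le>
             N (\<Sum>k\<in>{m..<n}. smulJ (a k) (u k)) + N (\<Sum>k\<in>{m..<n}. smulJ (a k) (x k - u k))"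
      using JS.nrm_triangle[of "\<Sum>k\<in>{m..<n}. smulJ (a k) (u k)" "\<Sum>k\<in>{m..<n}. smulJ (a k) (x k - u k)"]
        xJ uJ by (simp only: JS.mem_simps)
    with 1 2 show ?thesis by (simp add: A_def)
  qed
  show ?thesis
  proof (rule JS.perturbed_biorthogonal_complemented[OF M x(1) uJ g_fun _ biorth])
    fix k v assume v: "v \<in> J"
    (* The constant 12 comes from 128 \<le> 12 * 12. *)
    have "(norm (g k v))\<^sup>2 \<le> (\<Sum>i<Suc k. (norm (g i v))\<^sup>2)"
      by (simp add: sum_nonneg)
    also have "\<dots> \<le> 128 * (N v)\<^sup>2" by (rule g_sq[OF v])
    also have "\<dots> \<le> (12 * N v)\<^sup>2" using zero_le_power2[of "N v"] by (simp add: power_mult_distrib)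
    finally show "norm (g k v) \<le> 12 * N v"
      by (rule power2_le_imp_le) (use JS.nrm_nonneg[OF v] in simp)
  next
    fix n v assume v: "v \<in> J"
    have "N (\<Sum>k<n. smulJ (g k v) (x k)) \<le> 5 * sqrt (\<Sum>k<n. (norm (g k v))\<^sup>2)"
      using upper[of "\<lambda>k. g k v" 0 n] by (simp add: atLeast0LessThan)
    also have "sqrt (\<Sum>k<n. (norm (g k v))\<^sup>2) \<le> sqrt ((12 * N v)\<^sup>2)"
    proof (rule real_sqrt_le_mono)
      show "(\<Sum>k<n. (norm (g k v))\<^sup>2) \<le> (12 * N v)\<^sup>2"
        by (rule order.trans[OF g_sq[OF v]]) (simp add: power_mult_distrib)
    qed
    also have "sqrt ((12 * N v)\<^sup>2) = 12 * N v"
      by (rule real_sqrt_unique) (use JS.nrm_nonneg[OF v] in simp_all)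
    finally show "N (\<Sum>k<n. smulJ (g k v) (x k)) \<le> 60 * N v" by simp
  next
    fix v d assume v: "v \<in> J" and d: "(d :: real) > 0"
    have "summable (\<lambda>k. (norm (g k v))\<^sup>2)"
      using g_sq[OF v] by (intro summableI_nonneg_bounded) auto
    moreover have "(d / 5)\<^sup>2 > 0" using d by simp
    ultimately obtain M0 where M0: "\<And>m n. m \<ge> M0 \<Longrightarrow> norm (\<Sum>k\<in>{m..<n}. (norm (g k v))\<^sup>2) < (d / 5)\<^sup>2"
      unfolding summable_Cauchy by blast
    define S where "S n = (\<Sum>k<n. smulJ (g k v) (x k))" for n
    have SJ: "S n \<in> J" for n unfolding S_def using xJ by (simp add: JS.mem_simps)
    have less: "N (S n - S m) < d" if "m \<ge> M0" "m \<le> n" for m n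
    proof -
      have "S n - S m = (\<Sum>k\<in>{m..<n}. smulJ (g k v) (x k))"
        unfolding S_def using that(2) sum_diff_nat_ivl[of 0 m n "\<lambda>k. smulJ (g k v) (x k)"]
        by (simp add: atLeast0LessThan)
      hence "N (S n - S m) \<le> 5 * sqrt (\<Sum>k\<in>{m..<n}. (norm (g k v))\<^sup>2)" using upper by simp
      also have "sqrt (\<Sum>k\<in>{m..<n}. (norm (g k v))\<^sup>2) < sqrt ((d / 5)\<^sup>2)"
        using M0[OF that(1), of n] by (intro real_sqrt_less_mono) (simp add: sum_nonneg)
      also have "5 * sqrt ((d / 5)\<^sup>2) = d" using d by simp
      finally show ?thesis by simp
    qed
    have "N (S m - S n) < d" if "m \<ge> M0" "n \<ge> M0" for m n
      using less[of m n] less[of n m] that JS.nrm_minus_commute[OF SJ SJ, of m n] by (cases "m \<le> n") auto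
    thus "\<exists>M0. \<forall>m\<ge>M0. \<forall>n\<ge>M0. N ((\<Sum>k<m. smulJ (g k v) (x k)) - (\<Sum>k<n. smulJ (g k v) (x k))) < d"
      by (auto simp: S_def)
  next
    show "(\<Sum>k<n. N (x k - u k)) \<le> 1 / 3000" for n
      using sum_mono[of "{..<n}" "\<lambda>k. N (x k - u k)" e] xu e_sum[of n] by simp
  qed auto
qed

text \<open>
  On the closure \<open>Z\<close> of \<open>W\<close> the \<open>m\<close>-th coordinate is an isomorphism onto a closed subspace of \<open>X m\<close>.  A
  projection \<open>Q\<close> onto a subspace of this image yields the projection that sends \<open>v\<close> to the unique \<open>z \<in> Z\<close> with
  \<open>z m = Q (v m)\<close>.
\<close>

lemma complemented_of_coordinate_bound:
  assumes M: "JS.subspace M" "M \<subseteq> J" "JS.near_closed M"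
    and W: "JS.subspace W" "W \<subseteq> M" "\<not> finite_dim smulJ W"
    and bound: "\<And>x. x \<in> W \<Longrightarrow> N x \<le> c * nrm m (x m)" and c: "c > 0"
    and sub: "subprojective smul (X m) (nrm m)"
  shows "contains_complemented M"
proof -
  interpret C: module_hom "smulJ" smul "\<lambda>x. x m" by (rule module_hom_coordinate)
  have WJ: "W \<subseteq> J" using W M by blast
  define Z where "Z = JS.nclosure W"
  have Z: "JS.subspace Z" "Z \<subseteq> J" "JS.near_closed Z" "Z \<subseteq> M" "W \<subseteq> Z"
    unfolding Z_def using JS.subspace_nclosure[OF W(1) WJ] JS.nclosure_subset JS.near_closed_nclosure[OF WJ]
      JS.nclosure_minimal[OF M(3) W(2)] JS.subset_nclosure[OF WJ] by auto
  have boundZ: "N z \<le> c * nrm m (z m)" if z: "z \<in> Z" for z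
  proof (rule field_le_epsilon)
    fix e :: real assume e: "e > 0"
    have zJ: "z \<in> J" using z Z by blast
    have "e / (1 + 2 * c) > 0" using e c by simp
    then obtain w where w: "w \<in> W" "N (w - z) < e / (1 + 2 * c)"
      using z unfolding Z_def JS.nclosure_def by blast
    have wJ: "w \<in> J" using w WJ by blast
    have d: "w - z \<in> J" using wJ zJ by (rule JS.diff_mem)
    have "N z \<le> N w + N (w - z)"
      using JS.nrm_diff_ge[OF zJ wJ] JS.nrm_minus_commute[OF zJ wJ] by linarith
    moreover have "nrm m (w m) \<le> nrm m (z m) + 2 * N (w - z)"
      using B.nrm_diff_ge[OF J_mem[OF wJ] J_mem[OF zJ], of m] coordinate_le[OF J_J_hat[OF d], of m]
      by (simp only: fun_diff_def)
    hence "c * nrm m (w m) \<le> c * (nrm m (z m) + 2 * N (w - z))" using c by (intro mult_left_mono) auto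
    ultimately have "N z \<le> c * (nrm m (z m) + 2 * N (w - z)) + N (w - z)"
      using bound[OF w(1)] by linarith
    also have "\<dots> = c * nrm m (z m) + (1 + 2 * c) * N (w - z)" by (simp add: algebra_simps)
    also have "(1 + 2 * c) * N (w - z) \<le> e" using w(2) c by (simp add: field_simps)
    finally show "N z \<le> c * nrm m (z m) + e" by simp
  qed
  have inj: "z = z'" if "z \<in> Z" "z' \<in> Z" "z m = z' m" for z z'
  proof -
    have "z - z' \<in> Z" using that Z(1) by (simp add: JS.subspace_diff)
    hence "N (z - z') \<le> 0" "z - z' \<in> J" using boundZ[of "z - z'"] that Z by auto
    thus ?thesis using JS.nrm_nonneg[of "z - z'"] JS.nrm_eq_0_iff[of "z - z'"] by simp
  qed
  define Y where "Y = (\<lambda>x. x m) ` Z"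
  have Y: "subspace Y" unfolding Y_def using Z(1) by (rule C.subspace_image)
  have YX: "Y \<subseteq> X m" unfolding Y_def using Z(2) J_mem by blast
  have "\<not> finite_dim smul Y"
  proof
    assume "finite_dim smul Y"
    hence "finite_dim smul ((\<lambda>x. x m) ` W)"
      by (rule finite_dim_subset) (use Z(5) in \<open>auto simp: Y_def\<close>)
    hence "finite_dim smulJ W"
      using finite_dim_inj_image[OF module_hom_coordinate W(1)] inj Z(5) by (auto simp: inj_on_def)
    with W(3) show False by simp
  qed
  moreover have "closedin (Metric_space.mtopology (X m) (ndist (X m) (nrm m))) Y"
    unfolding B.closedin_iff_near_closed[OF YX] B.near_closed_def
  proof safe
    fix l assume l: "l \<in> X m" "\<forall>e>0. \<exists>y\<in>Y. nrm m (y - l) < e"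
    have "\<exists>z\<in>Z. nrm m (z m - l) < 1 / Suc n" for n
      using l(2)[rule_format, of "1 / Suc n"] by (auto simp: Y_def)
    then obtain z where z: "\<And>n. z n \<in> Z" "\<And>n. nrm m (z n m - l) < 1 / Suc n" by metis
    have zJ: "z n \<in> J" for n using z Z by blast
    have lim: "(\<lambda>n. nrm m (z n m - l)) \<longlonglongrightarrow> 0"
    proof (rule null_sequence_squeeze[OF _ _ LIMSEQ_Suc[OF lim_1_over_n]])
      show "0 \<le> nrm m (z n m - l)" for n by (intro B.nrm_nonneg B.diff_mem J_mem zJ l(1))
      show "nrm m (z n m - l) \<le> 1 / real (Suc n)" for n using z(2)[of n] by simp
    qed
    have zz: "N (z i - z j) \<le> c * (nrm m (z i m - l) + nrm m (z j m - l))" for i j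
    proof -
      have "N (z i - z j) \<le> c * nrm m (z i m - z j m)"
        using boundZ[OF JS.subspace_diff[OF Z(1) z(1) z(1)], of i j] by simp
      also have "nrm m (z i m - z j m) \<le> nrm m (z i m - l) + nrm m (z j m - l)"
        using B.nrm_diff_triangle[OF J_mem[OF zJ] l(1) J_mem[OF zJ], of i j]
          B.nrm_minus_commute[OF l(1) J_mem[OF zJ], of j] by simp
      finally show ?thesis using c by simp
    qed
    obtain z0 where z0: "z0 \<in> J" "(\<lambda>n. N (z n - z0)) \<longlonglongrightarrow> 0"
    proof (rule JS.Cauchy_imp_limit[of z])
      fix e :: real assume e: "e > 0"
      have "\<forall>\<^sub>F n in sequentially. nrm m (z n m - l) < e / (2 * c)"
        using e c by (intro order_tendstoD(2)[OF lim]) simp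
      then obtain n0 where n0: "\<And>n. n \<ge> n0 \<Longrightarrow> nrm m (z n m - l) < e / (2 * c)"
        by (auto simp: eventually_sequentially)
      have "N (z i - z j) < e" if "i \<ge> n0" "j \<ge> n0" for i j
      proof -
        have "c * (nrm m (z i m - l) + nrm m (z j m - l)) < c * (e / (2 * c) + e / (2 * c))"
          using n0[OF that(1)] n0[OF that(2)] c by (intro mult_strict_left_mono add_strict_mono)
        also have "\<dots> = e" using c by simp
        finally show ?thesis using zz[of i j] by simp
      qed
      thus "\<exists>n0. \<forall>i\<ge>n0. \<forall>j\<ge>n0. N (z i - z j) < e" by blast
    qed (use zJ in auto)
    have "z0 \<in> Z" by (rule JS.near_closed_limit[OF Z(3) z(1) z0])
    moreover have "z0 m = l"
    proof (rule B.limit_unique[of "\<lambda>n. z n m" m])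
      show "(\<lambda>n. nrm m (z n m - z0 m)) \<longlonglongrightarrow> 0"
      proof (rule null_sequence_squeeze)
        show "(\<lambda>n. 2 * N (z n - z0)) \<longlonglongrightarrow> 0" using tendsto_mult_right_zero[OF z0(2)] by simp
        show "nrm m (z n m - z0 m) \<le> 2 * N (z n - z0)" for n
          using coordinate_le[OF J_J_hat[OF JS.diff_mem[OF zJ[of n] z0(1)]], of m] by (simp only: fun_diff_def)
        show "0 \<le> nrm m (z n m - z0 m)" for n
          by (intro B.nrm_nonneg B.diff_mem J_mem zJ z0)
      qed
    qed (use lim l J_mem zJ z0 in auto)
    ultimately show "l \<in> Y" by (auto simp: Y_def)
  qed
  ultimately obtain Q0 where Q0: "subspace Q0" "Q0 \<subseteq> Y" "\<not> finite_dim smul Q0"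
    "complemented_in smul (X m) (nrm m) Q0"
    using sub[unfolded subprojective_def, rule_format, of Y] Y YX by blast
  obtain Q K where Q: "linear_on smul (X m) (X m) Q" "\<And>x. x \<in> X m \<Longrightarrow> nrm m (Q x) \<le> K * nrm m x"
    "\<And>x. x \<in> X m \<Longrightarrow> Q (Q x) = Q x" "Q ` X m = Q0"
    using Q0(4) by (auto simp: complemented_in_def bounded_linear_on_def)
  define U where "U = {z \<in> Z. z m \<in> Q0}"
  have U_image: "(\<lambda>x. x m) ` U = Q0" using Q0(2) by (auto simp: U_def Y_def)
  have U: "JS.subspace U"
  proof -
    have "U = Z \<inter> (\<lambda>x. x m) -` Q0" by (auto simp: U_def)
    thus ?thesis using JS.subspace_inter[OF Z(1) C.subspace_vimage[OF Q0(1)]] by simp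
  qed
  have "\<not> finite_dim smulJ U"
    using finite_dim_image[OF module_hom_coordinate, of U m] U_image Q0(3) by auto
  moreover have "complemented_in smulJ J N U"
  proof -
    define P where "P v = (THE z. z \<in> Z \<and> z m = Q (v m))" for v
    have P: "P v \<in> Z \<and> P v m = Q (v m)" if v: "v \<in> J" for v
    proof -
      have "Q (v m) \<in> Y" using Q(4) Q0(2) J_mem[OF v] by blast
      then obtain z where z: "z \<in> Z" "z m = Q (v m)" by (auto simp: Y_def)
      show ?thesis
        unfolding P_def
      proof (rule theI[of "\<lambda>z. z \<in> Z \<and> z m = Q (v m)"])
        show "z \<in> Z \<and> z m = Q (v m)" using z by blast
        show "y = z" if "y \<in> Z \<and> y m = Q (v m)" for y by (rule inj) (use that z in simp_all)
      qed
    qed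
    have P_eq: "P v = z" if "v \<in> J" "z \<in> Z" "z m = Q (v m)" for v z
      using P[OF that(1)] that by (intro inj) auto
    have PJ: "P v \<in> J" if "v \<in> J" for v using P[OF that] Z by blast
    have PU: "P v \<in> U" if "v \<in> J" for v using P[OF that] Q(4) J_mem[OF that] by (auto simp: U_def)
    have "linear_on smulJ J J P"
      unfolding linear_on_def
    proof (intro conjI ballI allI)
      fix v w assume vw: "v \<in> J" "w \<in> J"
      have "Q (v m + w m) = Q (v m) + Q (w m)" using Q(1) J_mem vw by (simp add: linear_on_def)
      thus "P (v + w) = P v + P w"
        using P vw Z(1) by (intro P_eq) (auto simp: JS.add_mem JS.subspace_add)
    next
      fix a v assume v: "v \<in> J"
      have "Q (smul a (v m)) = smul a (Q (v m))" using Q(1) J_mem v by (simp add: linear_on_def)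
      thus "P (smulJ a v) = smulJ a (P v)"
        using P v Z(1) by (intro P_eq) (auto simp: JS.scale_mem JS.subspace_scale, simp add: scale_seq_def)
    qed (rule PJ)
    moreover have "N (P v) \<le> (c * \<bar>K\<bar> * 2) * N v" if v: "v \<in> J" for v
    proof -
      have "N (P v) \<le> c * nrm m (Q (v m))" using boundZ[of "P v"] P[OF v] by simp
      also have "\<dots> \<le> c * (\<bar>K\<bar> * nrm m (v m))"
      proof -
        have "K * nrm m (v m) \<le> \<bar>K\<bar> * nrm m (v m)"
          using B.nrm_nonneg[OF J_mem[OF v]] by (intro mult_right_mono) auto
        thus ?thesis using Q(2)[OF J_mem[OF v]] c by (intro mult_left_mono) auto
      qed
      also have "\<dots> \<le> c * (\<bar>K\<bar> * (2 * N v))"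
        using coordinate_le[OF J_J_hat[OF v]] c by (intro mult_left_mono) auto
      finally show ?thesis by simp
    qed
    moreover have fix_U: "P z = z" if "z \<in> U" for z
    proof (rule P_eq)
      show "z \<in> J" "z \<in> Z" using that Z by (auto simp: U_def)
      have "z m \<in> Q ` X m" using that Q(4) by (simp add: U_def)
      then obtain y where "y \<in> X m" "z m = Q y" by blast
      thus "z m = Q (z m)" using Q(3) by simp
    qed
    moreover have "P ` J = U"
    proof
      show "P ` J \<subseteq> U" using PU by blast
      show "U \<subseteq> P ` J"
      proof
        fix z assume "z \<in> U"
        hence "z = P z" "z \<in> J" using fix_U Z by (auto simp: U_def)
        thus "z \<in> P ` J" by (rule image_eqI)
      qed
    qed
    ultimately show ?thesis
      unfolding complemented_in_def bounded_linear_on_def using PU by blast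
  qed
  moreover have "U \<subseteq> M" using Z by (auto simp: U_def)
  ultimately show ?thesis using U by blast
qed

text \<open>
  Induction on \<open>b\<close> finds the least \<open>b\<close> for which \<open>head b\<close> dominates the norm on an infinite-dimensional
  subspace: either a smaller \<open>b\<close> works on some subspace, or \<open>head b\<close> can be made so small on a subspace
  that the last coordinate alone dominates the norm there.
\<close>

lemma complemented_of_bounded_head:
  assumes M: "JS.subspace M" "M \<subseteq> J" "JS.near_closed M"
    and W: "JS.subspace W" "W \<subseteq> M" "\<not> finite_dim smulJ W"
    and bound: "\<And>x. x \<in> W \<Longrightarrow> N x \<le> c * head b x"
    and sub: "\<And>n. subprojective smul (X n) (nrm n)"
  shows "contains_complemented M"
  using W bound
proof (induction b arbitrary: W c)
  case 0
  have "x = 0" if "x \<in> W" for x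
  proof -
    have "x \<in> J" using that 0 M by blast
    moreover have "N x \<le> 0" using 0(4)[OF that] by (simp add: head_def)
    ultimately show ?thesis using JS.nrm_nonneg[of x] JS.nrm_eq_0_iff[of x] by simp
  qed
  hence "finite_dim smulJ W"
    using JS.subspace_0[OF 0(1)] unfolding finite_dim_def
    by (intro exI[of _ "{0}"]) (auto intro: JS.span_base)
  with 0 show ?case by simp
next
  case (Suc b)
  have WJ: "W \<subseteq> J" using Suc.prems M by blast
  show ?case
  proof (cases "\<exists>W' c'. JS.subspace W' \<and> W' \<subseteq> W \<and> \<not> finite_dim smulJ W' \<and>
                   (\<forall>x\<in>W'. N x \<le> c' * head b x)")
    case True
    then obtain W' c' where "JS.subspace W'" "W' \<subseteq> W" "\<not> finite_dim smulJ W'"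
      "\<And>x. x \<in> W' \<Longrightarrow> N x \<le> c' * head b x" by blast
    with Suc.prems(2) show ?thesis by (intro Suc.IH[of W' c']) auto
  next
    case False
    define d where "d = max c 1"
    have d: "d > 0" by (simp add: d_def)
    have bound_d: "N x \<le> d * head (Suc b) x" if "x \<in> W" for x
    proof -
      have "c * head (Suc b) x \<le> d * head (Suc b) x"
        using head_nonneg[OF J_seqs, of x] that WJ by (intro mult_right_mono) (auto simp: d_def)
      thus ?thesis using Suc.prems(4)[OF that] by linarith
    qed
    obtain W' where W': "JS.subspace W'" "W' \<subseteq> W" "\<not> finite_dim smulJ W'"
      "\<And>x. x \<in> W' \<Longrightarrow> head b x \<le> (1 / (2 * d)) * N x"
    proof (rule JS.small_seminorm_subspace[OF Suc.prems(1) WJ Suc.prems(3)])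
      show "head b x \<ge> 0" if "x \<in> J" for x using that by (intro head_nonneg J_seqs)
      show "head b (x + y) \<le> head b x + head b y" if "x \<in> J" "y \<in> J" for x y
        using that by (intro head_add J_seqs)
      show "head b (smulJ a x) = norm a * head b x" if "x \<in> J" for a x
        using that by (intro head_scale J_seqs)
      show "\<exists>x\<in>W'. a * head b x < N x"
        if "JS.subspace W'" "W' \<subseteq> W" "\<not> finite_dim smulJ W'" for W' a
        using False that by (meson not_le)
      show "1 / (2 * d) > 0" using d by simp
    qed (use that in blast)
    have "N x \<le> (2 * d) * nrm b (x b)" if x: "x \<in> W'" for x
    proof -
      have "N x \<le> d * head b x + d * nrm b (x b)"
        using bound_d[of x] x W'(2) by (auto simp: head_def algebra_simps)
      also have "d * head b x \<le> d * ((1 / (2 * d)) * N x)"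
        using W'(4)[OF x] d by (intro mult_left_mono) auto
      also have "d * ((1 / (2 * d)) * N x) = N x / 2" using d by simp
      finally show ?thesis by simp
    qed
    thus ?thesis
      using M W' Suc.prems(2) d sub by (intro complemented_of_coordinate_bound[of M W' "2 * d" b]) auto
  qed
qed

lemma subprojective_J:
  assumes sub: "\<And>n. subprojective smul (X n) (nrm n)"
  shows "subprojective smulJ J N"
  unfolding subprojective_def
proof safe
  fix M assume M: "JS.subspace M" "M \<subseteq> J" "\<not> finite_dim smulJ M"
    and closed: "closedin (Metric_space.mtopology J (ndist J N)) M"
  have closed: "JS.near_closed M" using closed JS.closedin_iff_near_closed[OF M(2)] by simp
  show "contains_complemented M"
  proof (cases "\<exists>b c. \<forall>x\<in>M. N x \<le> c * head b x")
    case True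
    then obtain b c where "\<And>x. x \<in> M \<Longrightarrow> N x \<le> c * head b x" by blast
    thus ?thesis
      by (rule complemented_of_bounded_head[OF M(1,2) closed M(1) subset_refl M(3) _ sub])
  next
    case False
    hence "\<exists>x\<in>M. c * head b x < N x" for b c by (meson not_le)
    thus ?thesis by (rule complemented_of_unbounded_head[OF M(1,2) closed])
  qed
qed

text \<open>
  The image of a closed subspace under the embedding \<open>single n\<close> is closed, since coordinates are
  continuous.  A projection \<open>P\<close> onto a subspace of this image gives the projection
  \<open>v \<mapsto> P (single n v) n\<close> on \<open>X n\<close>.
\<close>

lemma subprojective_coordinate:
  assumes sub: "subprojective smulJ J N"
  shows "subprojective smul (X n) (nrm n)"
  unfolding subprojective_def
proof safe
  fix M assume M: "subspace M" "M \<subseteq> X n" "\<not> finite_dim smul M"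
    and closed: "closedin (Metric_space.mtopology (X n) (ndist (X n) (nrm n))) M"
  have closed: "B.near_closed n M" using closed B.closedin_iff_near_closed[OF M(2)] by simp
  interpret S: module_hom smul "smulJ" "single n" by (rule module_hom_single)
  interpret C: module_hom "smulJ" smul "\<lambda>x. x n" by (rule module_hom_coordinate)
  define M' where "M' = single n ` M"
  have M': "JS.subspace M'" unfolding M'_def using M(1) by (rule S.subspace_image)
  have M'J: "M' \<subseteq> J" unfolding M'_def using M(2) single_J(1) by blast
  have coord_image: "(\<lambda>x. x n) ` single n ` A = A" for A by (auto simp: image_image)
  have "\<not> finite_dim smulJ M'"
    using finite_dim_image[OF module_hom_coordinate, of M' n] M(3) by (auto simp: M'_def coord_image)
  moreover have "closedin (Metric_space.mtopology J (ndist J N)) M'"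
    unfolding JS.closedin_iff_near_closed[OF M'J] JS.near_closed_def
  proof safe
    fix l assume l: "l \<in> J" "\<forall>e>0. \<exists>x\<in>M'. N (x - l) < e"
    have approx: "\<exists>v\<in>M. N (single n v - l) < e" if "e > 0" for e
      using l(2) that by (auto simp: M'_def)
    have near: "nrm j (single n v j - l j) \<le> 2 * N (single n v - l)" if "v \<in> M" for v j
    proof -
      have "single n v - l \<in> J" using that M l single_J by (intro JS.diff_mem) auto
      thus ?thesis using coordinate_le[OF J_J_hat, of "single n v - l" j] by simp
    qed
    have "l n \<in> M"
    proof -
      have "\<exists>v\<in>M. nrm n (v - l n) < e" if e: "e > 0" for e
      proof -
        obtain v where "v \<in> M" "N (single n v - l) < e / 2" using approx[of "e / 2"] e by auto
        thus ?thesis using near[of v n] by (intro bexI[of _ v]) auto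
      qed
      thus ?thesis using closed J_mem[OF l(1)] by (auto simp: B.near_closed_def)
    qed
    moreover have "l j = 0" if "j \<noteq> n" for j
    proof -
      have "nrm j (l j) \<le> 0 + e" if e: "e > 0" for e
      proof -
        obtain v where v: "v \<in> M" "N (single n v - l) < e / 2" using approx[of "e / 2"] e by auto
        have "nrm j (single n v j - l j) = nrm j (l j)"
          using \<open>j \<noteq> n\<close> B.nrm_uminus[OF J_mem[OF l(1)], of j] by (simp add: single_def)
        thus ?thesis using near[OF v(1), of j] v(2) by simp
      qed
      hence "nrm j (l j) \<le> 0" by (rule field_le_epsilon)
      thus ?thesis using B.nrm_nonneg[OF J_mem[OF l(1)], of j] B.nrm_eq_0_iff[OF J_mem[OF l(1)], of j] by simp
    qed
    hence "l = single n (l n)" by (auto simp: single_def fun_eq_iff)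
    ultimately show "l \<in> M'" unfolding M'_def by (metis image_eqI)
  qed
  ultimately obtain U where U: "JS.subspace U" "U \<subseteq> M'" "\<not> finite_dim smulJ U"
    "complemented_in smulJ J N U"
    using sub[unfolded subprojective_def, rule_format, of M'] M' M'J by blast
  obtain P K where P: "linear_on smulJ J J P" "\<And>x. x \<in> J \<Longrightarrow> N (P x) \<le> K * N x"
    "\<And>x. x \<in> J \<Longrightarrow> P (P x) = P x" "P ` J = U"
    using U(4) by (auto simp: complemented_in_def bounded_linear_on_def)
  have U_single: "single n (y n) = y" if "y \<in> U" for y using that U(2) by (auto simp: M'_def)
  define W where "W = (\<lambda>x. x n) ` U"
  have "single n ` W = U" using U_single by (force simp: W_def image_image)
  hence "\<not> finite_dim smul W" using finite_dim_image[OF module_hom_single, of W n] U(3) by auto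
  moreover have "subspace W" unfolding W_def using U(1) by (rule C.subspace_image)
  moreover have "W \<subseteq> M" using U(2) by (auto simp: W_def M'_def)
  moreover have "complemented_in smul (X n) (nrm n) W"
  proof -
    define Q where "Q v = P (single n v) n" for v
    have PU: "P (single n v) \<in> U" and PJ: "P (single n v) \<in> J" if "v \<in> X n" for v
      using P(1,4) single_J(1)[OF that] by (auto simp: linear_on_def)
    have P_fix: "P y = y" if "y \<in> U" for y using that P(3,4) by force
    have "linear_on smul (X n) (X n) Q"
      unfolding linear_on_def
    proof (intro conjI ballI allI)
      show "Q v \<in> X n" if "v \<in> X n" for v unfolding Q_def using J_mem[OF PJ[OF that]] .
      show "Q (v + w) = Q v + Q w" if "v \<in> X n" "w \<in> X n" for v w
        using P(1) single_J(1)[OF that(1)] single_J(1)[OF that(2)] by (simp add: Q_def S.add linear_on_def)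
      show "Q (smul c v) = smul c (Q v)" if "v \<in> X n" for c v
      proof -
        have "P (smulJ c (single n v)) = smulJ c (P (single n v))"
          using P(1) single_J(1)[OF that] by (simp add: linear_on_def)
        thus ?thesis by (simp only: Q_def S.scale) (simp add: scale_seq_def)
      qed
    qed
    moreover have "nrm n (Q v) \<le> (2 * \<bar>K\<bar>) * nrm n v" if v: "v \<in> X n" for v
    proof -
      have "nrm n (Q v) \<le> 2 * N (P (single n v))"
        unfolding Q_def by (rule coordinate_le[OF J_J_hat[OF PJ[OF v]]])
      also have "N (P (single n v)) \<le> \<bar>K\<bar> * N (single n v)"
        using P(2)[OF single_J(1)[OF v]] mult_right_mono[OF abs_ge_self[of K] JS.nrm_nonneg[OF single_J(1)[OF v]]]
        by linarith
      also have "\<bar>K\<bar> * N (single n v) \<le> \<bar>K\<bar> * nrm n v"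
        using single_J(2)[OF v] by (intro mult_left_mono) auto
      finally show ?thesis by simp
    qed
    moreover have "Q (Q v) = Q v" if "v \<in> X n" for v
      using U_single[OF PU[OF that]] P_fix[OF PU[OF that]] by (simp add: Q_def)
    moreover have "Q ` X n = W"
    proof
      show "Q ` X n \<subseteq> W" using PU by (auto simp: Q_def W_def)
      show "W \<subseteq> Q ` X n"
      proof
        fix w assume "w \<in> W"
        then obtain y where y: "y \<in> U" "w = y n" by (auto simp: W_def)
        have "Q (y n) = y n" using U_single[OF y(1)] P_fix[OF y(1)] by (simp add: Q_def)
        moreover have "y n \<in> X n" using y(1) U(2) M'J J_mem by blast
        ultimately show "w \<in> Q ` X n" using y(2) by (metis image_eqI)
      qed
    qed
    ultimately show ?thesis
      unfolding complemented_in_def bounded_linear_on_def by blast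
  qed
  ultimately show "\<exists>W. subspace W \<and> W \<subseteq> M \<and> \<not> finite_dim smul W \<and> complemented_in smul (X n) (nrm n) W"
    by blast
qed

end

theorem corollary5p3:
  fixes smul :: "'k::{real_normed_field, banach} \<Rightarrow> 'v::ab_group_add \<Rightarrow> 'v"
    and X :: "nat \<Rightarrow> 'v set"
    and nrm :: "nat \<Rightarrow> 'v \<Rightarrow> real"
    and \<phi> :: "nat \<Rightarrow> 'v \<Rightarrow> 'v"
  assumes "\<And>n. banach_space_on smul (X n) (nrm n)"
    and "X 0 = {0}"
    and "\<And>n. bounded_linear_on smul (X n) (nrm n) (X (Suc n)) (nrm (Suc n)) (\<phi> n)"
    and "\<And>n. onorm_on (X n) (nrm n) (nrm (Suc n)) (\<phi> n) \<le> 1"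
  shows "subprojective (scale_seq smul) (J_space X nrm \<phi>) (J_norm nrm \<phi>) \<longleftrightarrow>
         (\<forall>n. subprojective smul (X n) (nrm n))"
proof -
  interpret vector_space smul
    using assms(1)[of 0] by (rule banach_space_on.axioms(1))
  interpret james_space smul X nrm \<phi>
    by (intro james_space.intro james_space_axioms.intro vector_space_axioms assms)
  show ?thesis using subprojective_J subprojective_coordinate by blast
qed

end
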